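(* Let $\beta,\gamma\in\mathbb R$, let $\mathcal W,\varepsilon_0$ be as in the context, let $0<\varepsilon\le\varepsilon_0$, let $u$ be the global small-data solution with $\|u(1)\|_\Sigma\le\varepsilon$, and let $A$ be its modified scattering profile. Set $A_0=A(-\gamma)$ and $M_0=\int_{\mathbb R}\mathcal W(x)\,dx$, and suppose that $M_0A_0\ne0$. Then there are constants $c_2,c_\infty>0$ and $T_*>0$, depending on the fixed solution, such that $$\|\mathcal P_{u,+}-\mathcal P_u(T)\|_2\ge c_2|M_0||A_0|^5T^{-7/4},\qquad \|\mathcal P_{u,+}-\mathcal P_u(T)\|_\infty\ge c_\infty|M_0||A_0|^5T^{-3/2}$$ for every $T\ge T_*$. Thus both powers of $T$ in the upper bounds $\|\mathcal P_{u,+}-\mathcal P_u(T)\|_2\le C_{\beta,\mathcal W}\varepsilon^5T^{-7/4}$ and $\|\mathcal P_{u,+}-\mathcal P_u(T)\|_\infty\le C_{\beta,\mathcal W}\varepsilon^5T^{-3/2}$ (valid for $T\ge1$) are optimal when $M_0A_0\ne0$.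
   Context: Notation: $\langle x\rangle=(1+x^2)^{1/2}$; $\|\cdot\|_q$ is the $L^q(\mathbb R)$ norm; $C_0(\mathbb R)$ is the space of continuous functions vanishing at infinity; $\Sigma=\{f\in H^1(\mathbb R):xf\in L^2(\mathbb R)\}$ with $\|f\|_\Sigma=\|f\|_{H^1}+\|xf\|_2$; Fourier transform $\widehat f(\zeta)=\int_{\mathbb R}e^{-i\zeta y}f(y)\,dy$. Assumption on $\mathcal W$: $\mathcal W:\mathbb R\to\mathbb R$ is smooth and there exist $p>2$ and constants $C_{\mathcal W,j}>0$ such that $|\partial_x^j\mathcal W(x)|\le C_{\mathcal W,j}\langle x\rangle^{-p-j}$ for all $x\in\mathbb R$ and all integers $j\ge0$. Equation: $i\partial_tu+\partial_y^2u-\beta|u|^2u+\mathcal W(y+\gamma t)|u|^4u=0$, $t\ge1$, $y\in\mathbb R$ (mild solutions). Small-data solution and profile: $\varepsilon_0=\varepsilon_0(\beta,\mathcal W)>0$ is a sufficiently small threshold, independent of $\gamma$, and $C_\delta,C>0$ are constants such that whenever $\|u_1\|_\Sigma\le\varepsilon\le\varepsilon_0$ there is a unique global solution $u\in C([1,\infty);\Sigma)\cap C^1([1,\infty);H^{-1})$ with $u(1)=u_1$; with $\delta=C_\delta|\beta|\varepsilon^2<1/16$ it satisfies $\|u(t)\|_\infty\le C\varepsilon t^{-1/2}$, $\|u(t)\|_{H^1}+\|(y+2it\partial_y)u(t)\|_2\le C\varepsilon t^\delta$ for $t\ge1$, and there is a unique $A\in L^2\cap L^\infty$ (the modified scattering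 profile) with $\|A\|_2+\|A\|_\infty\le C\varepsilon$ and $$\Big\|u(t,y)-t^{-1/2}e^{iy^2/(4t)}A(y/t)e^{-i\beta|A(y/t)|^2\log t}\Big\|_{L^q_y}\le C\varepsilon t^{-b_q+2\delta},\quad t\ge1,\ q\in\{2,\infty\},\quad b_2=\tfrac12,\ b_\infty=\tfrac34 .$$ Moreover $A\in H^\varsigma(\mathbb R)$ for every $\varsigma<1-2\delta$; $A$ denotes its continuous representative, so $A(-\gamma)$ makes sense. Cubic-renormalized profile: $$\mathcal P_u(t,\zeta)=e^{it\zeta^2}\widehat u(t,\zeta)+i\beta\int_1^te^{is\zeta^2}\,\widehat{|u(s)|^2u(s)}(\zeta)\,ds,\qquad t\ge1;$$ as $t\to\infty$, $\mathcal P_u(t)$ converges in $L^2_\zeta$ and uniformly to a limit $\mathcal P_{u,+}\in L^2(\mathbb R)\cap C_0(\mathbb R)$. *)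

theory Defs
  imports "HOL-Probability.Essential_Supremum"
begin

section \<open>Function spaces on the real line\<close>

text \<open>
  Elements of the Lebesgue and Sobolev spaces are represented by Borel functions, and the notions
  for them do not depend on the representative modulo null sets. The norms are real-valued and meaningful
  only for members of the respective space, so each estimate is accompanied by membership
  unless the latter is automatic.
\<close>

definition japanese :: "real \<Rightarrow> real" where
  "japanese x = sqrt (1 + x\<^sup>2)"

definition L2 :: "(real \<Rightarrow> complex) set" where
  "L2 = {f \<in> borel_measurable borel. integrable lborel (\<lambda>x. (cmod (f x))\<^sup>2)}"

definition L2_norm :: "(real \<Rightarrow> complex) \<Rightarrow> real" where
  "L2_norm f = sqrt (LINT x|lborel. (cmod (f x))\<^sup>2)"

definition Linf :: "(real \<Rightarrow> complex) set" where
  "Linf = {f \<in> borel_measurable borel. esssup lborel (\<lambda>x. ereal (cmod (f x))) < \<infinity>}"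

definition Linf_norm :: "(real \<Rightarrow> complex) \<Rightarrow> real" where
  "Linf_norm f = real_of_ereal (esssup lborel (\<lambda>x. ereal (cmod (f x))))"

definition C0 :: "(real \<Rightarrow> complex) set" where
  "C0 = {f. continuous_on UNIV f \<and> (f \<longlongrightarrow> 0) at_infinity}"

definition smooth :: "(real \<Rightarrow> real) \<Rightarrow> bool" where
  "smooth f \<longleftrightarrow> (\<forall>j x. (deriv ^^ j) f differentiable (at x))"

definition test_function :: "(real \<Rightarrow> real) \<Rightarrow> bool" where
  "test_function \<phi> \<longleftrightarrow> smooth \<phi> \<and> (\<exists>R. \<forall>x. \<bar>x\<bar> > R \<longrightarrow> \<phi> x = 0)"

text \<open>Real-valued test functions suffice, by linearity.\<close>

definition has_weak_deriv :: "(real \<Rightarrow> complex) \<Rightarrow> (real \<Rightarrow> complex) \<Rightarrow> bool" where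
  "has_weak_deriv f g \<longleftrightarrow>
     (\<forall>\<phi>. test_function \<phi> \<longrightarrow>
        (LINT x|lborel. deriv \<phi> x *\<^sub>R f x) = - (LINT x|lborel. \<phi> x *\<^sub>R g x))"

definition H1 :: "(real \<Rightarrow> complex) set" where
  "H1 = {f \<in> L2. \<exists>g\<in>L2. has_weak_deriv f g}"

definition weak_deriv :: "(real \<Rightarrow> complex) \<Rightarrow> real \<Rightarrow> complex" where
  "weak_deriv f = (SOME g. g \<in> L2 \<and> has_weak_deriv f g)"

definition H1_norm :: "(real \<Rightarrow> complex) \<Rightarrow> real" where
  "H1_norm f = sqrt ((L2_norm f)\<^sup>2 + (L2_norm (weak_deriv f))\<^sup>2)"

definition Sigma_space :: "(real \<Rightarrow> complex) set" where
  "Sigma_space = {f \<in> H1. (\<lambda>x. of_real x * f x) \<in> L2}"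

definition Sigma_norm :: "(real \<Rightarrow> complex) \<Rightarrow> real" where
  "Sigma_norm f = H1_norm f + L2_norm (\<lambda>x. of_real x * f x)"


section \<open>Fourier transform\<close>

text \<open>
  The integral converges absolutely for integrable functions, in particular for the elements of
  \<open>Sigma_space\<close> and for the cubic power of such a function.
\<close>

definition fourier :: "(real \<Rightarrow> complex) \<Rightarrow> real \<Rightarrow> complex" where
  "fourier f \<zeta> = (LINT y|lborel. cis (- (\<zeta> * y)) * f y)"

text \<open>The Fourier--Plancherel transform of a square-integrable function.\<close>

definition has_L2_fourier :: "(real \<Rightarrow> complex) \<Rightarrow> (real \<Rightarrow> complex) \<Rightarrow> bool" where
  "has_L2_fourier f g \<longleftrightarrow> f \<in> L2 \<and> g \<in> L2 \<and>
     ((\<lambda>R. L2_norm (\<lambda>\<zeta>. fourier (\<lambda>y. indicator {-R..R} y * f y) \<zeta> - g \<zeta>)) \<longlongrightarrow> 0) at_top"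

text \<open>The fractional Sobolev space of order \<open>s \<ge> 0\<close>; for \<open>s < 0\<close> this is just \<open>L2\<close>.\<close>

definition Hs :: "real \<Rightarrow> (real \<Rightarrow> complex) set" where
  "Hs s = {f \<in> L2. \<exists>g. has_L2_fourier f g \<and> (\<lambda>\<zeta>. of_real (japanese \<zeta> powr s) * g \<zeta>) \<in> L2}"


section \<open>The equation\<close>

definition admissible_potential :: "(real \<Rightarrow> real) \<Rightarrow> bool" where
  "admissible_potential W \<longleftrightarrow> smooth W \<and>
     (\<exists>p>2. \<exists>K :: nat \<Rightarrow> real. \<forall>j. K j > 0 \<and>
        (\<forall>x. \<bar>(deriv ^^ j) W x\<bar> \<le> K j * japanese x powr (- p - real j)))"

text \<open>
  The free group \<open>exp (i t \<partial>\<^sub>y\<^sup>2)\<close> for \<open>t \<ge> 0\<close> on integrable functions, given by its kernel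
  \<open>(4 \<pi> i t)\<^sup>-\<^sup>1\<^sup>/\<^sup>2 exp (i (y - x)\<^sup>2 / (4 t))\<close>, with the principal branch of the root.
\<close>

definition free_group :: "real \<Rightarrow> (real \<Rightarrow> complex) \<Rightarrow> real \<Rightarrow> complex" where
  "free_group t f y =
     (if t = 0 then f y
      else (LINT x|lborel. cis ((y - x)\<^sup>2 / (4 * t)) * f x) / csqrt (4 * of_real pi * \<i> * of_real t))"

definition cubic :: "(real \<Rightarrow> complex) \<Rightarrow> real \<Rightarrow> complex" where
  "cubic f y = of_real ((cmod (f y))\<^sup>2) * f y"

definition nonlinearity ::
    "real \<Rightarrow> real \<Rightarrow> (real \<Rightarrow> real) \<Rightarrow> real \<Rightarrow> (real \<Rightarrow> complex) \<Rightarrow> real \<Rightarrow> complex" where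
  "nonlinearity \<beta> \<gamma> W t f y =
     of_real \<beta> * cubic f y - of_real (W (y + \<gamma> * t) * (cmod (f y)) ^ 4) * f y"

text \<open>
  In the following, \<open>u t\<close> is the function \<open>y \<mapsto> u(t,y)\<close>; only times \<open>t \<ge> 1\<close> are relevant.
\<close>

definition mild_solution ::
    "real \<Rightarrow> real \<Rightarrow> (real \<Rightarrow> real) \<Rightarrow> (real \<Rightarrow> real \<Rightarrow> complex) \<Rightarrow> bool" where
  "mild_solution \<beta> \<gamma> W u \<longleftrightarrow>
     (\<forall>t\<ge>1. AE y in lborel.
        u t y = free_group (t - 1) (u 1) y
          - \<i> * (LINT s:{1..t}|lborel. free_group (t - s) (nonlinearity \<beta> \<gamma> W s (u s)) y))"

definition continuous_in_Sigma :: "(real \<Rightarrow> real \<Rightarrow> complex) \<Rightarrow> bool" where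
  "continuous_in_Sigma u \<longleftrightarrow>
     (\<forall>t\<ge>1. u t \<in> Sigma_space) \<and>
     (\<forall>t\<ge>1. ((\<lambda>s. Sigma_norm (\<lambda>y. u s y - u t y)) \<longlongrightarrow> 0) (at t within {1..}))"

text \<open>
  Membership in \<open>C\<^sup>1([1,\<infinity>);H\<^sup>-\<^sup>1)\<close>. An element of \<open>H\<^sup>-\<^sup>1\<close> is represented by its Fourier transform, a
  function that is square-integrable with weight \<open>(1 + \<zeta>\<^sup>2)\<^sup>-\<^sup>1\<close>; \<open>v t\<close> is the Fourier transform
  of the derivative of \<open>u\<close> at \<open>t\<close>.
\<close>

definition C1_in_Hm1 :: "(real \<Rightarrow> real \<Rightarrow> complex) \<Rightarrow> bool" where
  "C1_in_Hm1 u \<longleftrightarrow>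
     (\<exists>v :: real \<Rightarrow> real \<Rightarrow> complex.
        (\<forall>t\<ge>1. (\<lambda>\<zeta>. v t \<zeta> / of_real (japanese \<zeta>)) \<in> L2) \<and>
        (\<forall>t\<ge>1. ((\<lambda>s. L2_norm (\<lambda>\<zeta>. (v s \<zeta> - v t \<zeta>) / of_real (japanese \<zeta>))) \<longlongrightarrow> 0)
                  (at t within {1..})) \<and>
        (\<forall>t\<ge>1. ((\<lambda>s. L2_norm (\<lambda>\<zeta>.
                    ((fourier (u s) \<zeta> - fourier (u t) \<zeta>) / of_real (s - t) - v t \<zeta>)
                      / of_real (japanese \<zeta>))) \<longlongrightarrow> 0)
                  (at t within {1..})))"

definition global_solution ::
    "real \<Rightarrow> real \<Rightarrow> (real \<Rightarrow> real) \<Rightarrow> (real \<Rightarrow> real \<Rightarrow> complex) \<Rightarrow> bool" where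
  "global_solution \<beta> \<gamma> W u \<longleftrightarrow>
     continuous_in_Sigma u \<and> C1_in_Hm1 u \<and> mild_solution \<beta> \<gamma> W u"


section \<open>Small-data theory and modified scattering\<close>

definition small_data_bounds ::
    "real \<Rightarrow> real \<Rightarrow> real \<Rightarrow> (real \<Rightarrow> real \<Rightarrow> complex) \<Rightarrow> bool" where
  "small_data_bounds C \<delta> \<epsilon> u \<longleftrightarrow>
     (\<forall>t\<ge>1. u t \<in> Linf \<and> Linf_norm (u t) \<le> C * \<epsilon> * t powr (- 1/2) \<and>
        H1_norm (u t) + L2_norm (\<lambda>y. of_real y * u t y + 2 * \<i> * of_real t * weak_deriv (u t) y)
          \<le> C * \<epsilon> * t powr \<delta>)"

definition asymptotic_form ::
    "real \<Rightarrow> (real \<Rightarrow> complex) \<Rightarrow> real \<Rightarrow> real \<Rightarrow> complex" where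
  "asymptotic_form \<beta> A t y =
     of_real (t powr (- 1/2)) * cis (y\<^sup>2 / (4 * t)) * A (y / t)
       * cis (- \<beta> * (cmod (A (y / t)))\<^sup>2 * ln t)"

definition scattering_profile ::
    "real \<Rightarrow> real \<Rightarrow> real \<Rightarrow> real \<Rightarrow> (real \<Rightarrow> real \<Rightarrow> complex) \<Rightarrow> (real \<Rightarrow> complex) \<Rightarrow> bool" where
  "scattering_profile \<beta> C \<delta> \<epsilon> u A \<longleftrightarrow>
     A \<in> L2 \<and> A \<in> Linf \<and> L2_norm A + Linf_norm A \<le> C * \<epsilon> \<and>
     (\<forall>t\<ge>1. (\<lambda>y. u t y - asymptotic_form \<beta> A t y) \<in> L2 \<inter> Linf \<and>
        L2_norm (\<lambda>y. u t y - asymptotic_form \<beta> A t y) \<le> C * \<epsilon> * t powr (- 1/2 + 2 * \<delta>) \<and>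
        Linf_norm (\<lambda>y. u t y - asymptotic_form \<beta> A t y) \<le> C * \<epsilon> * t powr (- 3/4 + 2 * \<delta>))"

text \<open>
  \<open>\<epsilon>\<^sub>0\<close> is a small-data threshold with constants \<open>C\<^sub>\<delta>\<close>, \<open>C\<close>, uniformly in the speed \<open>\<gamma>\<close>.
  Uniqueness refers to functions modulo null sets.
\<close>

definition small_data_threshold ::
    "real \<Rightarrow> (real \<Rightarrow> real) \<Rightarrow> real \<Rightarrow> real \<Rightarrow> real \<Rightarrow> bool" where
  "small_data_threshold \<beta> W \<epsilon>\<^sub>0 C\<^sub>\<delta> C \<longleftrightarrow>
     \<epsilon>\<^sub>0 > 0 \<and> C\<^sub>\<delta> > 0 \<and> C > 0 \<and>
     (\<forall>\<gamma> \<epsilon> u\<^sub>1. 0 < \<epsilon> \<longrightarrow> \<epsilon> \<le> \<epsilon>\<^sub>0 \<longrightarrow> u\<^sub>1 \<in> Sigma_space \<longrightarrow> Sigma_norm u\<^sub>1 \<le> \<epsilon> \<longrightarrow>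
        (let \<delta> = C\<^sub>\<delta> * \<bar>\<beta>\<bar> * \<epsilon>\<^sup>2 in
          \<delta> < 1/16 \<and>
          (\<exists>u. global_solution \<beta> \<gamma> W u \<and> u 1 = u\<^sub>1) \<and>
          (\<forall>u v. global_solution \<beta> \<gamma> W u \<longrightarrow> u 1 = u\<^sub>1 \<longrightarrow>
                 global_solution \<beta> \<gamma> W v \<longrightarrow> v 1 = u\<^sub>1 \<longrightarrow>
                 (\<forall>t\<ge>1. AE y in lborel. u t y = v t y)) \<and>
          (\<forall>u. global_solution \<beta> \<gamma> W u \<longrightarrow> u 1 = u\<^sub>1 \<longrightarrow>
             small_data_bounds C \<delta> \<epsilon> u \<and>
             (\<exists>A. scattering_profile \<beta> C \<delta> \<epsilon> u A) \<and>
             (\<forall>A B. scattering_profile \<beta> C \<delta> \<epsilon> u A \<longrightarrow> scattering_profile \<beta> C \<delta> \<epsilon> u B \<longrightarrow>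
                    (AE x in lborel. A x = B x)) \<and>
             (\<forall>A. scattering_profile \<beta> C \<delta> \<epsilon> u A \<longrightarrow> (\<forall>s < 1 - 2 * \<delta>. A \<in> Hs s)))))"


section \<open>The cubic-renormalized profile\<close>

definition cubic_profile ::
    "real \<Rightarrow> (real \<Rightarrow> real \<Rightarrow> complex) \<Rightarrow> real \<Rightarrow> real \<Rightarrow> complex" where
  "cubic_profile \<beta> u t \<zeta> =
     cis (t * \<zeta>\<^sup>2) * fourier (u t) \<zeta>
       + \<i> * of_real \<beta> * (LINT s:{1..t}|lborel. cis (s * \<zeta>\<^sup>2) * fourier (cubic (u s)) \<zeta>)"

definition cubic_profile_limit ::
    "real \<Rightarrow> (real \<Rightarrow> real \<Rightarrow> complex) \<Rightarrow> (real \<Rightarrow> complex) \<Rightarrow> bool" where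
  "cubic_profile_limit \<beta> u P \<longleftrightarrow>
     P \<in> L2 \<and> P \<in> C0 \<and>
     (\<forall>t\<ge>1. cubic_profile \<beta> u t \<in> L2) \<and>
     ((\<lambda>t. L2_norm (\<lambda>\<zeta>. P \<zeta> - cubic_profile \<beta> u t \<zeta>)) \<longlongrightarrow> 0) at_top \<and>
     uniform_limit UNIV (cubic_profile \<beta> u) P at_top"

end

theory Submission
  imports Defs "HOL-Probability.Characteristic_Functions" "HOL-Complex_Analysis.Complex_Analysis"
begin

text \<open>
  The Fourier transform turns the mild formulation into Duhamel's formula, and the
  renormalization removes the cubic term from it. What remains is
  \<open>P - P\<^sub>u(T) = i \<integral>\<^sub>T\<^sup>\<infinity> cis (s \<zeta>\<^sup>2) (Q s)^(\<zeta>) ds\<close> with the localized quintic term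
  \<open>Q s y = W (y + \<gamma> s) |u|\<^sup>4 u\<close> (lemma \<open>cubic_profile_limit_eq\<close>). The whole theorem is a statement
  on the size of this oscillatory integral, and the upper bounds rest on the decay
  \<open>\<parallel>Q s\<parallel>\<^sub>1 = O(\<epsilon>\<^sup>5 s\<^sup>-\<^sup>5\<^sup>/\<^sup>2)\<close>, which follows from the dispersive decay of \<open>u\<close>, uniformly in \<open>\<gamma>\<close>.

  The supremum bound is obtained by integrating \<open>s\<^sup>-\<^sup>5\<^sup>/\<^sup>2\<close> over \<open>s > T\<close>. The square-integral bound gains
  another \<open>T\<^sup>-\<^sup>1\<^sup>/\<^sup>4\<close> from oscillation. It is the dual Strichartz estimate at the endpoint pair
  \<open>L\<^sup>4\<^sup>/\<^sup>3\<^sub>t L\<^sup>1\<^sub>y\<close>, proved by expanding the square (\<open>TT*\<close>): the pairing of the times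
  \<open>s\<close> and \<open>r\<close> is bounded by \<open>|s - r|\<^sup>-\<^sup>1\<^sup>/\<^sup>2 \<parallel>Q s\<parallel>\<^sub>1 \<parallel>Q r\<parallel>\<^sub>1\<close>, and the double integral of
  \<open>|s - r|\<^sup>-\<^sup>1\<^sup>/\<^sup>2 (s r)\<^sup>-\<^sup>5\<^sup>/\<^sup>2\<close> over \<open>s, r > T\<close> scales like \<open>T\<^sup>-\<^sup>7\<^sup>/\<^sup>2\<close>
  (lemma \<open>oscillatory_tail_Gaussian_L2\<close>). All exchanges of integrals are made absolutely
  convergent by Gaussian factors, so that everything rests on one explicit integral, the Fourier
  transform of a Gaussian of complex width (lemma \<open>Fourier_Gaussian\<close>).

  For the lower bounds, the potential only sees \<open>u\<close> along the ray \<open>y = - \<gamma> s\<close>, where modified scattering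
  describes it. Completing the square in the phase shows that, at frequency
  \<open>\<zeta> = \<eta> - \<gamma>/2\<close>, the integrand is
  \<open>s\<^sup>-\<^sup>5\<^sup>/\<^sup>2 M0 |A0|\<^sup>4 A0 cis (- \<beta> |A0|\<^sup>2 ln s)\<close> up to the relative error
  \<open>O(s\<^sup>-\<^sup>1\<^sup>/\<^sup>8 + s \<eta>\<^sup>2 + |\<eta>|)\<close> (lemma \<open>integrand_asymptotics\<close>).
  The logarithm in the phase makes continuity of \<open>A\<close> insufficient here; a Hoelder bound is used, which comes
  from \<open>A \<in> H\<^sup>7\<^sup>/\<^sup>8\<close> by Fourier inversion (lemma \<open>Hs_imp_Holder\<close>). The leading term integrates
  in closed form to a multiple of \<open>T\<^sup>-\<^sup>3\<^sup>/\<^sup>2\<close> that does not vanish. Hence the tail is at least of this size on a frequency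
  window of width comparable to \<open>T\<^sup>-\<^sup>1\<^sup>/\<^sup>2\<close> around \<open>- \<gamma>/2\<close>, which gives \<open>T\<^sup>-\<^sup>3\<^sup>/\<^sup>2\<close> in the supremum norm and
  \<open>T\<^sup>-\<^sup>3\<^sup>/\<^sup>2 T\<^sup>-\<^sup>1\<^sup>/\<^sup>4 = T\<^sup>-\<^sup>7\<^sup>/\<^sup>4\<close> in the square-integral norm.
\<close>

section \<open>Integrals on the real line\<close>

text \<open>
  The Bochner integral of a function that is not integrable is \<open>0\<close>, so an integrable majorant alone
  suffices.
\<close>

lemma norm_integral_le_majorant:
  fixes f :: "'a \<Rightarrow> 'b::{banach, second_countable_topology}"
  assumes "integrable M g" and "AE x in M. norm (f x) \<le> g x"
  shows "norm (LINT x|M. f x) \<le> (LINT x|M. g x)"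
proof (cases "integrable M f")
  case True
  then have "(LINT x|M. norm (f x)) \<le> (LINT x|M. g x)"
    by (intro integral_mono_AE assms) auto
  then show ?thesis using integral_norm_bound[of M f] by linarith
next
  case False
  have "AE x in M. 0 \<le> g x" using assms(2) by eventually_elim (meson norm_ge_zero order_trans)
  then show ?thesis using False by (simp add: not_integrable_integral_eq integral_nonneg_AE)
qed

text \<open>
  The quadratic \<open>t \<mapsto> \<integral> (t |f| - |g|)\<^sup>2\<close> is nonnegative; its value at the minimum is the claim.
\<close>

lemma Cauchy_Schwarz_integral:
  fixes f g :: "'a \<Rightarrow> complex"
  assumes [measurable]: "f \<in> borel_measurable M" "g \<in> borel_measurable M"
    and f: "integrable M (\<lambda>x. (cmod (f x))\<^sup>2)" and g: "integrable M (\<lambda>x. (cmod (g x))\<^sup>2)"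
  shows "integrable M (\<lambda>x. f x * g x)"
    and "(LINT x|M. cmod (f x * g x)) \<le> sqrt (LINT x|M. (cmod (f x))\<^sup>2) * sqrt (LINT x|M. (cmod (g x))\<^sup>2)"
proof -
  have "integrable M (\<lambda>x. (cmod (f x))\<^sup>2 + (cmod (g x))\<^sup>2)"
    using f g by simp
  then show fg: "integrable M (\<lambda>x. f x * g x)"
  proof (rule Bochner_Integration.integrable_bound)
    show "AE x in M. norm (f x * g x) \<le> norm ((cmod (f x))\<^sup>2 + (cmod (g x))\<^sup>2)"
    proof (rule AE_I2)
      fix x
      have "2 * cmod (f x) * cmod (g x) \<le> (cmod (f x))\<^sup>2 + (cmod (g x))\<^sup>2"
        by (rule sum_squares_bound)
      moreover have "0 \<le> cmod (f x) * cmod (g x)" by simp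
      ultimately have "cmod (f x) * cmod (g x) \<le> (cmod (f x))\<^sup>2 + (cmod (g x))\<^sup>2" by linarith
      then show "norm (f x * g x) \<le> norm ((cmod (f x))\<^sup>2 + (cmod (g x))\<^sup>2)"
        by (simp add: norm_mult)
    qed
  qed simp
  define a b I where "a = (LINT x|M. (cmod (f x))\<^sup>2)" and "b = (LINT x|M. (cmod (g x))\<^sup>2)"
    and "I = (LINT x|M. cmod (f x * g x))"
  have nn: "a \<ge> 0" "b \<ge> 0" "I \<ge> 0" by (auto simp: a_def b_def I_def)
  have q: "0 \<le> t\<^sup>2 * a - 2 * t * I + b" for t
  proof -
    have "0 \<le> (LINT x|M. (t * cmod (f x) - cmod (g x))\<^sup>2)" by simp
    also have "(\<lambda>x. (t * cmod (f x) - cmod (g x))\<^sup>2) =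
        (\<lambda>x. t\<^sup>2 * (cmod (f x))\<^sup>2 - 2 * t * cmod (f x * g x) + (cmod (g x))\<^sup>2)"
      by (auto simp: power2_eq_square algebra_simps norm_mult)
    also have "(LINT x|M. t\<^sup>2 * (cmod (f x))\<^sup>2 - 2 * t * cmod (f x * g x) + (cmod (g x))\<^sup>2)
        = t\<^sup>2 * a - 2 * t * I + b"
      unfolding a_def b_def I_def using f g fg by simp
    finally show ?thesis .
  qed
  have "I\<^sup>2 \<le> a * b"
  proof (cases "a = 0")
    case True
    have "I = 0"
    proof (rule ccontr)
      assume "I \<noteq> 0"
      then show False using q[of "(b+1)/(2*I)"] True by simp
    qed
    then show ?thesis using nn by simp
  next
    case False
    then have "a > 0" using nn by simp
    have "(I/a)\<^sup>2 * a - 2 * (I/a) * I + b = b - I\<^sup>2/a"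
      using \<open>a > 0\<close> by (simp add: power2_eq_square field_simps)
    then have "0 \<le> b - I\<^sup>2/a" using q[of "I/a"] by linarith
    then show ?thesis using \<open>a > 0\<close> by (simp add: field_simps)
  qed
  then have "I \<le> sqrt (a * b)" by (rule real_le_rsqrt)
  then show "(LINT x|M. cmod (f x * g x)) \<le> sqrt (LINT x|M. (cmod (f x))\<^sup>2) * sqrt (LINT x|M. (cmod (g x))\<^sup>2)"
    by (simp add: a_def b_def I_def real_sqrt_mult)
qed

text \<open>
  Fubini's theorem in the one form in which it is used: a kernel that is bounded by a constant, between two
  integrable weights. Integrands that are only dominated by an integrable weight, such as
  \<open>s\<^sup>-\<^sup>5\<^sup>/\<^sup>2\<close> or \<open>(t - s)\<^sup>-\<^sup>1\<^sup>/\<^sup>2\<close>, are brought into it by dividing the weight out.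
\<close>

lemma kernel_exchange:
  fixes f g :: "real \<Rightarrow> complex" and k :: "real \<Rightarrow> real \<Rightarrow> complex"
  assumes f: "integrable lborel f" and g: "integrable lborel g"
    and k: "(\<lambda>(x, y). k x y) \<in> borel_measurable borel" and bd: "\<And>x y. cmod (k x y) \<le> c"
  shows "(LINT x|lborel. f x * (LINT y|lborel. g y * k x y))
       = (LINT y|lborel. g y * (LINT x|lborel. f x * k x y))"
proof -
  have [measurable]: "f \<in> borel_measurable borel" "g \<in> borel_measurable borel"
    using f g by auto
  have km [measurable]: "(\<lambda>(x, y). k x y) \<in> borel_measurable (borel \<Otimes>\<^sub>M borel)"
    using k by (simp add: borel_prod)
  have int: "integrable (lborel \<Otimes>\<^sub>M lborel) (\<lambda>(x, y). f x * (g y * k x y))"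
  proof (rule lborel_pair.Fubini_integrable)
    show "(\<lambda>(x, y). f x * (g y * k x y)) \<in> borel_measurable (lborel \<Otimes>\<^sub>M lborel)"
      by measurable
    have gk: "integrable lborel (\<lambda>y. g y * k x y)" for x
    proof (rule Bochner_Integration.integrable_bound)
      show "integrable lborel (\<lambda>y. c * cmod (g y))" using g by simp
      show "(\<lambda>y. g y * k x y) \<in> borel_measurable lborel"
        using measurable_compose_Pair1[OF _ km, of x] by measurable
      show "AE y in lborel. norm (g y * k x y) \<le> norm (c * cmod (g y))"
      proof (rule AE_I2)
        fix y
        have "cmod (g y) * cmod (k x y) \<le> cmod (g y) * \<bar>c\<bar>"
          using bd[of x y] by (intro mult_left_mono) auto
        then show "norm (g y * k x y) \<le> norm (c * cmod (g y))"
          by (simp add: norm_mult abs_mult mult.commute)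
      qed
    qed
    then show "AE x in lborel. integrable lborel (\<lambda>y. case (x, y) of (x, y) \<Rightarrow> f x * (g y * k x y))"
      by simp
    show "integrable lborel (\<lambda>x. LINT y|lborel. norm (case (x, y) of (x, y) \<Rightarrow> f x * (g y * k x y)))"
    proof (rule Bochner_Integration.integrable_bound)
      show "integrable lborel (\<lambda>x. cmod (f x) * (LINT y|lborel. c * cmod (g y)))" using f by simp
      show "AE x in lborel. norm (LINT y|lborel. norm (case (x, y) of (x, y) \<Rightarrow> f x * (g y * k x y)))
         \<le> norm (cmod (f x) * (LINT y|lborel. c * cmod (g y)))"
      proof (rule AE_I2)
        fix x
        have "norm (LINT y|lborel. cmod (g y * k x y)) \<le> (LINT y|lborel. c * cmod (g y))"
        proof (rule norm_integral_le_majorant)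
          show "integrable lborel (\<lambda>y. c * cmod (g y))" using g by simp
          show "AE y in lborel. norm (cmod (g y * k x y)) \<le> c * cmod (g y)"
            by (rule AE_I2) (use mult_right_mono[OF bd norm_ge_zero] in \<open>simp add: norm_mult mult.commute\<close>)
        qed
        then have "cmod (f x) * norm (LINT y|lborel. cmod (g y * k x y))
            \<le> cmod (f x) * norm (LINT y|lborel. c * cmod (g y))"
          by (intro mult_left_mono) auto
        then show "norm (LINT y|lborel. norm (case (x, y) of (x, y) \<Rightarrow> f x * (g y * k x y)))
         \<le> norm (cmod (f x) * (LINT y|lborel. c * cmod (g y)))"
          by (simp add: norm_mult[of "f x"] abs_mult del: norm_mult)
      qed
    qed measurable
  qed
  have "(LINT x|lborel. f x * (LINT y|lborel. g y * k x y))
      = (LINT x|lborel. LINT y|lborel. f x * (g y * k x y))"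
    by simp
  also have "\<dots> = (LINT y|lborel. LINT x|lborel. f x * (g y * k x y))"
    using lborel_pair.Fubini_integral[of "\<lambda>x y. f x * (g y * k x y)"] int by simp
  also have "\<dots> = (LINT y|lborel. g y * (LINT x|lborel. f x * k x y))"
    by (simp flip: integral_mult_right_zero add: mult.left_commute)
  finally show ?thesis .
qed

lemma has_bochner_integral_indicator_lborel:
  fixes f :: "real \<Rightarrow> real"
  assumes [measurable]: "f \<in> borel_measurable borel" "S \<in> sets borel"
    and nn: "\<And>x. x \<in> S \<Longrightarrow> 0 \<le> f x" and I: "(f has_integral I) S"
  shows "has_bochner_integral lborel (\<lambda>x. indicator S x * f x) I"
proof (rule has_bochner_integral_nn_integral)
  show "0 \<le> I" using has_integral_nonneg[OF I] nn by blast
  show "AE x in lborel. 0 \<le> indicator S x * f x"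
    using nn by (auto simp: indicator_def)
  have eq: "(if x \<in> S then f x else 0) = indicator S x * f x" for x by simp
  have "(\<integral>\<^sup>+ x. ennreal (if x \<in> S then f x else 0) \<partial>lborel) = ennreal I"
  proof (rule nn_integral_has_integral_lborel)
    show "((\<lambda>x. if x \<in> S then f x else 0) has_integral I) UNIV"
      using I by (simp only: has_integral_restrict_UNIV)
  qed (use nn in auto)
  then show "(\<integral>\<^sup>+ x. ennreal (indicator S x * f x) \<partial>lborel) = ennreal I" by (simp only: eq)
qed measurable

lemma powr_tail_integral:
  fixes e T :: real
  assumes "e < -1" "T > 0"
  shows "has_bochner_integral lborel (\<lambda>s. indicator {T..} s * s powr e) (- (T powr (e + 1)) / (e + 1))"
  by (rule has_bochner_integral_indicator_lborel) (use has_integral_powr_to_inf[OF assms] in auto)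

lemma powr_tail_integral_open:
  fixes e T :: real
  assumes "e < -1" "T > 0"
  shows "integrable lborel (\<lambda>s. indicator {T<..} s * s powr e)"
    and "(LINT s|lborel. indicator {T<..} s * s powr e) = - (T powr (e + 1)) / (e + 1)"
proof -
  have 1: "has_bochner_integral lborel (\<lambda>s. indicator {T..} s * s powr e) (- (T powr (e + 1)) / (e + 1))"
    by (rule powr_tail_integral[OF assms])
  have "integrable lborel (\<lambda>s. indicator {T<..} s *\<^sub>R (indicator {T..} s * s powr e))"
    by (rule integrable_mult_indicator) (use 1 in \<open>auto simp: has_bochner_integral_iff\<close>)
  also have "(\<lambda>s. indicator {T<..} s *\<^sub>R (indicator {T..} s * s powr e)) = (\<lambda>s. indicator {T<..} s * s powr e)"
    by (auto simp: indicator_def)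
  finally show "integrable lborel (\<lambda>s. indicator {T<..} s * s powr e)" .
  have "(LINT s|lborel. indicator {T<..} s * s powr e) = (LINT s|lborel. indicator {T..} s * s powr e)"
    by (rule integral_discrete_difference[of "{T}"]) (auto simp: indicator_def)
  then show "(LINT s|lborel. indicator {T<..} s * s powr e) = - (T powr (e + 1)) / (e + 1)"
    using 1 by (simp add: has_bochner_integral_iff)
qed

lemma inverse_sqrt_integral:
  fixes c :: real
  assumes "c \<ge> 0"
  shows "has_bochner_integral lborel (\<lambda>s. indicator {0..c} s * s powr (- 1/2)) (2 * sqrt c)"
proof (rule has_bochner_integral_indicator_lborel)
  have "((\<lambda>x. x powr (- 1/2)) has_integral (c powr (- 1/2 + 1) / (- 1/2 + 1))) {0..c}"
    by (rule has_integral_powr_from_0) (use assms in auto)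
  then show "((\<lambda>x. x powr (- 1/2)) has_integral (2 * sqrt c)) {0..c}"
    using assms by (simp add: powr_half_sqrt mult.commute)
qed auto

lemma inverse_sqrt_integral_left:
  fixes c t :: real
  assumes "c \<ge> 0"
  shows "has_bochner_integral lborel (\<lambda>s. indicator {t - c..t} s * (t - s) powr (- 1/2)) (2 * sqrt c)"
proof -
  have "has_bochner_integral lborel (\<lambda>s. indicator {0..c} (t + (-1) * s) * (t + (-1) * s) powr (- 1/2)) (2 * sqrt c)"
    using inverse_sqrt_integral[OF assms]
      lborel_has_bochner_integral_real_affine_iff[of "-1" "\<lambda>s. indicator {0..c} s * s powr (- 1/2)" "2 * sqrt c" t]
    by simp
  moreover have "indicator {0..c} (t + (-1) * s) = (indicator {t - c..t} s :: real)" for s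
    by (auto simp: indicator_def)
  ultimately show ?thesis by simp
qed

lemma inverse_sqrt_integral_right:
  fixes c t :: real
  assumes "c \<ge> 0"
  shows "has_bochner_integral lborel (\<lambda>s. indicator {t..t + c} s * (s - t) powr (- 1/2)) (2 * sqrt c)"
proof -
  have "has_bochner_integral lborel (\<lambda>s. indicator {0..c} (- t + 1 * s) * (- t + 1 * s) powr (- 1/2)) (2 * sqrt c)"
    using inverse_sqrt_integral[OF assms]
      lborel_has_bochner_integral_real_affine_iff[of 1 "\<lambda>s. indicator {0..c} s * s powr (- 1/2)" "2 * sqrt c" "-t"]
    by simp
  moreover have "indicator {0..c} (- t + 1 * s) = (indicator {t..t + c} s :: real)" for s
    by (auto simp: indicator_def)
  ultimately show ?thesis by simp
qed

lemma cis_measurable [measurable]: "cis \<in> borel_measurable borel"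
  by (intro borel_measurable_continuous_onI continuous_intros)

lemma cnj_measurable [measurable]: "cnj \<in> borel_measurable borel"
  by (intro borel_measurable_continuous_onI continuous_intros)

section \<open>Function spaces\<close>

lemma japanese_ge_1: "japanese x \<ge> 1"
  by (simp add: japanese_def)

lemma japanese_ge_abs: "japanese x \<ge> \<bar>x\<bar>"
  unfolding japanese_def by (rule real_le_rsqrt) simp

lemma japanese_measurable [measurable]: "japanese \<in> borel_measurable borel"
  unfolding japanese_def[abs_def] by measurable

lemma japanese_powr_integrable:
  assumes "q > 1"
  shows "integrable lborel (\<lambda>x. japanese x powr (- q))"
proof -
  define h where "h x = indicator {1..} x * x powr (- q)" for x :: real
  have h: "integrable lborel h"
    using powr_tail_integral[of "- q" 1] assms unfolding h_def[abs_def] by (simp add: has_bochner_integral_iff)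
  then have h': "integrable lborel (\<lambda>x. h (0 + (-1) * x))"
    by (subst lborel_integrable_real_affine_iff) auto
  have "integrable lborel (\<lambda>x. indicator {-1..1} x + h x + h (0 + (-1) * x))"
    using h h' by simp
  then show ?thesis
  proof (rule Bochner_Integration.integrable_bound)
    show "AE x in lborel. norm (japanese x powr (- q)) \<le> norm (indicator {-1..1} x + h x + h (0 + (-1) * x))"
    proof (rule AE_I2)
      fix x :: real
      have nn: "h y \<ge> 0" for y by (simp add: h_def)
      have "japanese x powr (- q) \<le> indicator {-1..1} x + h x + h (0 + (-1) * x)"
      proof (cases "\<bar>x\<bar> \<le> 1")
        case True
        have "japanese x powr (- q) \<le> 1 powr (- q)"
          by (rule powr_mono2') (use japanese_ge_1 assms in auto)
        moreover have "indicator {-1..1} x = (1::real)" using True by (auto simp: indicator_def)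
        ultimately show ?thesis using nn[of x] nn[of "0 + (-1) * x"] by (simp add: powr_def)
      next
        case False
        then have "japanese x powr (- q) \<le> \<bar>x\<bar> powr (- q)"
          by (intro powr_mono2') (use japanese_ge_abs assms in auto)
        also have "\<dots> \<le> h x + h (0 + (-1) * x)"
          using False by (auto simp: h_def indicator_def abs_if)
        finally show ?thesis by (simp add: indicator_def)
      qed
      then show "norm (japanese x powr (- q)) \<le> norm (indicator {-1..1} x + h x + h (0 + (-1) * x))"
        using nn[of x] nn[of "0 + (-1) * x"] by simp
    qed
  qed measurable
qed

lemma L2_measurable: "f \<in> L2 \<Longrightarrow> f \<in> borel_measurable borel"
  by (simp add: L2_def)

lemma L2_norm_nonneg [simp]: "L2_norm f \<ge> 0"
  by (simp add: L2_norm_def)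

lemma L2_norm_power2: "(L2_norm f)\<^sup>2 = (LINT x|lborel. (cmod (f x))\<^sup>2)"
  by (simp add: L2_norm_def)

lemma L2_diff:
  assumes "f \<in> L2" "g \<in> L2"
  shows "(\<lambda>x. f x - g x) \<in> L2"
proof -
  have [measurable]: "f \<in> borel_measurable borel" "g \<in> borel_measurable borel"
    using assms by (auto simp: L2_def)
  have "integrable lborel (\<lambda>x. 2 * (cmod (f x))\<^sup>2 + 2 * (cmod (g x))\<^sup>2)"
    using assms by (simp add: L2_def)
  then have "integrable lborel (\<lambda>x. (cmod (f x - g x))\<^sup>2)"
  proof (rule Bochner_Integration.integrable_bound)
    show "AE x in lborel. norm ((cmod (f x - g x))\<^sup>2) \<le> norm (2 * (cmod (f x))\<^sup>2 + 2 * (cmod (g x))\<^sup>2)"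
    proof (rule AE_I2)
      fix x
      have "(cmod (f x - g x))\<^sup>2 \<le> (cmod (f x) + cmod (g x))\<^sup>2"
        by (intro power_mono norm_triangle_ineq4) auto
      also have "\<dots> \<le> 2 * (cmod (f x))\<^sup>2 + 2 * (cmod (g x))\<^sup>2"
        using sum_squares_bound[of "cmod (f x)" "cmod (g x)"] by (simp add: power2_sum)
      finally show "norm ((cmod (f x - g x))\<^sup>2) \<le> norm (2 * (cmod (f x))\<^sup>2 + 2 * (cmod (g x))\<^sup>2)" by simp
    qed
  qed measurable
  then show ?thesis by (simp add: L2_def)
qed

text \<open>
  Cauchy--Schwarz for \<open>f = (\<langle>x\<rangle> f) \<langle>x\<rangle>\<^sup>-\<^sup>1\<close>; this is what makes Fourier transforms of elements of
  \<open>Sigma_space\<close> pointwise integrals.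
\<close>

lemma weighted_L2_imp_L1:
  assumes f: "f \<in> L2" and xf: "(\<lambda>x. of_real x * f x) \<in> L2"
  shows "integrable lborel f"
    and "(LINT x|lborel. cmod (f x)) \<le> sqrt (LINT x|lborel. japanese x powr (- 2)) * (L2_norm f + L2_norm (\<lambda>x. of_real x * f x))"
proof -
  have [measurable]: "f \<in> borel_measurable borel" using f by (rule L2_measurable)
  define g where "g x = complex_of_real (japanese x) * f x" for x
  define j where "j x = complex_of_real (inverse (japanese x))" for x
  have [measurable]: "g \<in> borel_measurable borel" "j \<in> borel_measurable borel"
    unfolding g_def[abs_def] j_def[abs_def] by measurable
  have j2: "(cmod (j x))\<^sup>2 = japanese x powr (- 2)" for x
  proof -
    have "cmod (j x) = inverse (japanese x)"
      using japanese_ge_1[of x] unfolding j_def norm_of_real by simp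
    then show ?thesis using japanese_ge_1[of x] by (simp add: powr_minus powr_numeral power_inverse)
  qed
  have g2: "(cmod (g x))\<^sup>2 = (cmod (f x))\<^sup>2 + (cmod (of_real x * f x))\<^sup>2" for x
    by (simp add: g_def norm_mult power_mult_distrib japanese_def algebra_simps)
  have fgj: "f x = g x * j x" for x
    using japanese_ge_1[of x] by (simp add: g_def j_def field_simps)
  have ig: "integrable lborel (\<lambda>x. (cmod (g x))\<^sup>2)"
    unfolding g2 using f xf by (simp add: L2_def)
  have ij: "integrable lborel (\<lambda>x. (cmod (j x))\<^sup>2)"
    unfolding j2 by (rule japanese_powr_integrable) simp
  show "integrable lborel f"
    using Cauchy_Schwarz_integral(1)[OF _ _ ig ij] by (simp flip: fgj)
  have "(LINT x|lborel. cmod (f x)) \<le> sqrt (LINT x|lborel. (cmod (g x))\<^sup>2) * sqrt (LINT x|lborel. (cmod (j x))\<^sup>2)"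
    using Cauchy_Schwarz_integral(2)[OF _ _ ig ij] by (simp flip: fgj)
  also have "(LINT x|lborel. (cmod (g x))\<^sup>2) = (L2_norm f)\<^sup>2 + (L2_norm (\<lambda>x. of_real x * f x))\<^sup>2"
    unfolding g2 L2_norm_power2 using f xf by (simp add: L2_def)
  also have "sqrt ((L2_norm f)\<^sup>2 + (L2_norm (\<lambda>x. of_real x * f x))\<^sup>2) \<le> L2_norm f + L2_norm (\<lambda>x. of_real x * f x)"
    by (rule sqrt_sum_squares_le_sum) auto
  finally show "(LINT x|lborel. cmod (f x)) \<le> sqrt (LINT x|lborel. japanese x powr (- 2)) * (L2_norm f + L2_norm (\<lambda>x. of_real x * f x))"
    unfolding j2 by (simp add: mult.commute mult_right_mono)
qed

lemma Linf_AE: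
  assumes "f \<in> Linf"
  shows "AE y in lborel. cmod (f y) \<le> Linf_norm f"
proof -
  define e where "e = esssup lborel (\<lambda>x. ereal (cmod (f x)))"
  have "AE x in lborel. ereal (cmod (f x)) \<le> e" unfolding e_def by (rule esssup_AE)
  moreover have "e < \<infinity>" using assms by (simp add: Linf_def e_def)
  ultimately show ?thesis
    unfolding Linf_norm_def e_def[symmetric]
    by (auto elim!: eventually_mono) (cases e; auto)
qed

lemma Linf_norm_le:
  assumes f: "f \<in> borel_measurable borel" and le: "\<And>x. cmod (f x) \<le> c"
  shows "f \<in> Linf" "Linf_norm f \<le> c"
proof -
  define e where "e = esssup lborel (\<lambda>x. ereal (cmod (f x)))"
  have ec: "e \<le> ereal c"
    unfolding e_def by (rule esssup_I) (use f le in auto)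
  then show "f \<in> Linf" using f by (auto simp: Linf_def e_def[symmetric] intro: le_less_trans)
  have "c \<ge> 0" using le[of 0] norm_ge_zero[of "f 0"] by linarith
  then show "Linf_norm f \<le> c"
    unfolding Linf_norm_def e_def[symmetric] using ec by (cases e) auto
qed

text \<open>
  A nonempty open set is not a null set.
\<close>

lemma AE_le_imp_le_continuous:
  fixes f :: "real \<Rightarrow> 'a::real_normed_vector"
  assumes cont: "continuous_on UNIV f" and le: "AE x in lborel. norm (f x) \<le> c"
  shows "norm (f x) \<le> c"
proof (rule ccontr)
  assume "\<not> norm (f x) \<le> c"
  define S where "S = {x. c < norm (f x)}"
  have "open S" unfolding S_def by (intro open_Collect_less continuous_intros cont)
  moreover have "x \<in> S" using \<open>\<not> norm (f x) \<le> c\<close> by (simp add: S_def)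
  moreover have "S \<in> null_sets lborel"
    using le \<open>open S\<close> by (subst AE_iff_null_sets) (auto simp: S_def not_less)
  ultimately show False
    using open_not_negligible[of S] null_sets_completion_iff[of S lborel]
    by (auto simp: negligible_iff_null_sets)
qed

lemma Linf_norm_ge:
  assumes "f \<in> Linf" "continuous_on UNIV f"
  shows "cmod (f x) \<le> Linf_norm f"
  using AE_le_imp_le_continuous[OF assms(2) Linf_AE[OF assms(1)]] .

section \<open>Gaussian integrals of complex width\<close>

lemma Fourier_Gaussian_real:
  fixes a z :: real
  assumes "a > 0"
  shows "integrable lborel (\<lambda>x. exp (- a * x\<^sup>2))"
    and "(LINT x|lborel. of_real (exp (- a * x\<^sup>2)) * cis (z * x))
       = of_real (sqrt (pi / a) * exp (- z\<^sup>2 / (4 * a)))"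
proof -
  define c where "c = sqrt (2 * a)"
  have c: "c > 0" "c\<^sup>2 = 2 * a" using assms by (auto simp: c_def)
  have "integrable lborel (\<lambda>x. std_normal_density x)" by simp
  then have "integrable lborel (\<lambda>x. sqrt (2 * pi) * std_normal_density (0 + c * x))"
    using lborel_integrable_real_affine_iff[of c std_normal_density 0] c by simp
  moreover have gd: "sqrt (2 * pi) * std_normal_density (0 + c * x) = exp (- a * x\<^sup>2)" for x
    by (simp add: std_normal_density_def power_mult_distrib c)
  ultimately show "integrable lborel (\<lambda>x. exp (- a * x\<^sup>2))" by (simp only: gd)
  have "of_real (exp (- (z/c)\<^sup>2 / 2)) = (LINT x|std_normal_distribution. iexp ((z/c) * x))"
    using fun_cong[OF char_std_normal_distribution, of "z/c"] unfolding char_def by (simp only:)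
  also have "\<dots> = (LINT x|lborel. std_normal_density x *\<^sub>R iexp ((z/c) * x))"
    by (subst integral_density) auto
  also have "\<dots> = c *\<^sub>R (LINT x|lborel. std_normal_density (0 + c * x) *\<^sub>R iexp ((z/c) * (0 + c * x)))"
    using lborel_integral_real_affine[of c "\<lambda>x. std_normal_density x *\<^sub>R iexp ((z/c) * x)" 0] c
    by simp
  also have "\<dots> = c *\<^sub>R (LINT x|lborel. of_real (1 / sqrt (2*pi)) * (of_real (exp (- a * x\<^sup>2)) * cis (z * x)))"
  proof -
    have "std_normal_density (0 + c * x) = 1 / sqrt (2*pi) * exp (- a * x\<^sup>2)" for x
      by (simp add: std_normal_density_def power_mult_distrib c)
    moreover have "iexp ((z/c) * (0 + c * x)) = cis (z * x)" for x
      using c by (simp add: cis_conv_exp)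
    ultimately show ?thesis by (simp add: scaleR_conv_of_real mult.assoc)
  qed
  also have "\<dots> = of_real (c / sqrt (2*pi)) * (LINT x|lborel. of_real (exp (- a * x\<^sup>2)) * cis (z * x))"
    by (simp add: scaleR_conv_of_real)
  finally have e: "of_real (exp (- (z/c)\<^sup>2 / 2)) = complex_of_real (c / sqrt (2*pi)) *
     (LINT x|lborel. of_real (exp (- a * x\<^sup>2)) * cis (z * x))" .
  have "(z/c)\<^sup>2 / 2 = z\<^sup>2 / (4*a)" using c by (simp add: power_divide)
  moreover have "sqrt (2*pi) / c = sqrt (pi / a)"
    unfolding c_def by (simp add: real_sqrt_divide[symmetric])
  moreover have "(LINT x|lborel. of_real (exp (- a * x\<^sup>2)) * cis (z * x))
      = complex_of_real (sqrt (2*pi) / c) * of_real (exp (- (z/c)\<^sup>2 / 2))"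
    unfolding e using c by simp
  ultimately show "(LINT x|lborel. of_real (exp (- a * x\<^sup>2)) * cis (z * x))
       = of_real (sqrt (pi / a) * exp (- z\<^sup>2 / (4 * a)))" by simp
qed

text \<open>
  The inverse of a number with positive real part has positive real part, so the exponent has real part at most \<open>0\<close>.
\<close>

lemma norm_Gaussian_transform_le_1:
  assumes "Re a > 0"
  shows "cmod (exp (- of_real (z\<^sup>2) / (4 * a))) \<le> 1"
proof -
  have "- complex_of_real (z\<^sup>2) / (4 * a) = of_real (- z\<^sup>2 / 4) * inverse a"
    by (simp add: field_simps)
  then have "Re (- complex_of_real (z\<^sup>2) / (4 * a)) = (- z\<^sup>2 / 4) * Re (inverse a)"
    by (simp only: times_complex.sel Re_complex_of_real Im_complex_of_real mult_zero_left diff_0_right)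
  also have "\<dots> \<le> 0"
    by (rule mult_nonpos_nonneg) (use assms in auto)
  finally show ?thesis by (simp only: norm_exp_eq_Re exp_le_one_iff)
qed

text \<open>
  For real \<open>a > 0\<close> this is the characteristic function of a normal distribution. Both sides are
  holomorphic in the half plane \<open>Re a > 0\<close> and hence agree there. The left-hand side is holomorphic as the locally uniform
  limit of its truncations to \<open>[- n, n]\<close>.
\<close>

lemma Fourier_Gaussian:
  fixes a :: complex and z :: real
  assumes "Re a > 0"
  shows "integrable lborel (\<lambda>x. exp (- a * of_real (x\<^sup>2)) * cis (z * x))"
    and "(LINT x|lborel. exp (- a * of_real (x\<^sup>2)) * cis (z * x))
       = of_real (sqrt pi) / csqrt a * exp (- of_real (z\<^sup>2) / (4 * a))"
proof -
  have int: "integrable lborel (\<lambda>x. exp (- a * of_real (x\<^sup>2)) * cis (z * x))" if "Re a > 0" for a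
    using Fourier_Gaussian_real(1)[OF that]
  proof (rule Bochner_Integration.integrable_bound)
    have "(\<lambda>x. exp (- a * of_real (x\<^sup>2)) * cis (z * x)) \<in> borel_measurable borel"
      by (intro borel_measurable_continuous_onI continuous_intros)
    then show "(\<lambda>x. exp (- a * of_real (x\<^sup>2)) * cis (z * x)) \<in> borel_measurable lborel"
      by simp
  qed (auto simp: norm_mult)
  then show "integrable lborel (\<lambda>x. exp (- a * of_real (x\<^sup>2)) * cis (z * x))" using assms .
  define S where "S = {a. Re a > 0}"
  define F where "F a = (LINT x|lborel. exp (- a * of_real (x\<^sup>2)) * cis (z * x))" for a
  define f where "f n a = integral (cbox (- real n) (real n)) (\<lambda>x. exp (- a * of_real (x\<^sup>2)) * cis (z * x))"
    for n :: nat and a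
  have S: "open S" "convex S" "connected S"
    unfolding S_def using open_halfspace_Re_gt convex_halfspace_Re_gt[of 0] convex_connected by auto
  have ci: "continuous_on UNIV (\<lambda>x::real. exp (- a * of_real (x\<^sup>2)) * cis (z * x))" for a
    by (intro continuous_intros)
  have fhol: "f n holomorphic_on S" for n
    unfolding f_def
  proof (rule leibniz_rule_holomorphic)
    show "((\<lambda>a. exp (- a * of_real (t\<^sup>2)) * cis (z * t)) has_field_derivative
        (- of_real (t\<^sup>2) * exp (- a * of_real (t\<^sup>2)) * cis (z * t))) (at a within S)" for a and t :: real
      by (auto intro!: derivative_eq_intros)
    show "(\<lambda>x. exp (- a * of_real (x\<^sup>2)) * cis (z * x)) integrable_on cbox (- real n) (real n)" for a
      by (rule integrable_continuous) (rule continuous_on_subset[OF ci], simp)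
    show "continuous_on (S \<times> cbox (- real n) (real n))
        (\<lambda>(a, t). - of_real (t\<^sup>2) * exp (- a * of_real (t\<^sup>2)) * cis (z * t))"
      unfolding split_beta by (intro continuous_intros)
  qed (rule S)
  have "F holomorphic_on S"
  proof (rule holomorphic_uniform_sequence[OF S(1) fhol])
    fix a0 assume "a0 \<in> S"
    define r where "r = Re a0 / 2"
    have r: "r > 0" using \<open>a0 \<in> S\<close> by (simp add: S_def r_def)
    have ge: "Re a \<ge> r" if "a \<in> cball a0 r" for a
    proof -
      have "\<bar>Re (a0 - a)\<bar> \<le> r" using that abs_Re_le_cmod[of "a0 - a"] by (simp add: dist_norm)
      then have "Re a0 - Re a \<le> Re a0 / 2" by (simp only: r_def minus_complex.sel abs_le_iff)
      then show ?thesis unfolding r_def by linarith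
    qed
    have ir: "integrable lborel (\<lambda>x. exp (- r * x\<^sup>2))" by (rule Fourier_Gaussian_real(1)[OF r])
    define e where "e n = (LINT x|lborel. indicator (- {- real n..real n}) x * exp (- r * x\<^sup>2))" for n
    have e0: "e \<longlonglongrightarrow> (LINT x::real|lborel. (0::real))"
      unfolding e_def
    proof (rule integral_dominated_convergence[where w = "\<lambda>x::real. exp (- r * x\<^sup>2)"])
      show "AE x in lborel. (\<lambda>n. indicator (- {- real n..real n}) x * exp (- r * x\<^sup>2)) \<longlonglongrightarrow> 0"
      proof (rule AE_I2)
        fix x :: real
        obtain N :: nat where N: "real N > \<bar>x\<bar>" using reals_Archimedean2 by blast
        have "\<forall>\<^sub>F n in sequentially. indicator (- {- real n..real n}) x * exp (- r * x\<^sup>2) = 0"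
          using eventually_ge_at_top[of N]
        proof eventually_elim
          case (elim n)
          then have "real n > \<bar>x\<bar>" using N by linarith
          then have "x \<in> {- real n..real n}" by auto
          then show ?case by simp
        qed
        then show "(\<lambda>n. indicator (- {- real n..real n}) x * exp (- r * x\<^sup>2)) \<longlonglongrightarrow> 0"
          by (rule tendsto_eventually)
      qed
      show "AE x in lborel. norm (indicator (- {- real n..real n}) x * exp (- r * x\<^sup>2)) \<le> exp (- r * x\<^sup>2)" for n
        by (auto simp: indicator_def)
    qed (use ir in auto)
    have bd: "cmod (f n a - F a) \<le> e n" if a: "a \<in> cball a0 r" for n a
    proof -
      define h where "h x = exp (- a * of_real (x\<^sup>2)) * cis (z * x)" for x :: real
      have ih: "integrable lborel h" unfolding h_def using int[of a] ge[OF a] r by simp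
      have si: "set_integrable lborel {- real n..real n} h"
        unfolding set_integrable_def by (rule integrable_mult_indicator) (use ih in auto)
      have "f n a = (LINT x|lborel. indicator {- real n..real n} x *\<^sub>R h x)"
        using set_borel_integral_eq_integral(2)[OF si] unfolding f_def h_def set_lebesgue_integral_def by simp
      then have "F a - f n a = (LINT x|lborel. h x - indicator {- real n..real n} x *\<^sub>R h x)"
        unfolding F_def h_def[symmetric] using ih si unfolding set_integrable_def by simp
      also have "cmod \<dots> \<le> (LINT x|lborel. indicator (- {- real n..real n}) x * exp (- r * x\<^sup>2))"
      proof (rule Bochner_Integration.integral_norm_bound_integral)
        show "integrable lborel (\<lambda>x. h x - indicator {- real n..real n} x *\<^sub>R h x)"
          using ih si unfolding set_integrable_def by simp
        show "integrable lborel (\<lambda>x. indicator (- {- real n..real n}) x * exp (- r * x\<^sup>2))"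
          using integrable_mult_indicator[OF _ ir, of "- {- real n..real n}"] by simp
        fix x :: real
        have "cmod (h x) \<le> exp (- r * x\<^sup>2)"
          using ge[OF a] unfolding h_def by (simp add: norm_mult mult_right_mono)
        then show "cmod (h x - indicator {- real n..real n} x *\<^sub>R h x) \<le> indicator (- {- real n..real n}) x * exp (- r * x\<^sup>2)"
          by (auto simp: indicator_def)
      qed
      finally show ?thesis by (simp add: e_def norm_minus_commute)
    qed
    have "uniform_limit (cball a0 r) f F sequentially"
    proof (rule uniform_limitI)
      fix \<epsilon> :: real assume "\<epsilon> > 0"
      have "e \<longlonglongrightarrow> 0" using e0 by simp
      then have "\<forall>\<^sub>F n in sequentially. e n < \<epsilon>" using \<open>\<epsilon> > 0\<close> by (rule order_tendstoD)
      then show "\<forall>\<^sub>F n in sequentially. \<forall>x\<in>cball a0 r. dist (f n x) (F x) < \<epsilon>"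
        by eventually_elim (use bd in \<open>fastforce simp: dist_norm intro: le_less_trans\<close>)
    qed
    moreover have "cball a0 r \<subseteq> S" using ge r by (force simp: S_def)
    ultimately show "\<exists>d>0. cball a0 d \<subseteq> S \<and> uniform_limit (cball a0 d) f F sequentially"
      using r by blast
  qed
  moreover define G where "G a = of_real (sqrt pi) / csqrt a * exp (- of_real (z\<^sup>2) / (4 * a))" for a
  have "G holomorphic_on S"
    unfolding G_def S_def
    by (intro holomorphic_intros) (auto simp: complex_nonpos_Reals_iff)
  ultimately have hol: "(\<lambda>a. F a - G a) holomorphic_on S" by (intro holomorphic_intros)
  have "F a - G a = 0"
  proof (rule analytic_continuation[OF hol S(1) S(3), of "of_real ` {0<..}" 1])
    show "complex_of_real ` {0<..} \<subseteq> S" "1 \<in> S" "a \<in> S" using assms by (auto simp: S_def)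
    show "1 islimpt complex_of_real ` {0<..}"
    proof (rule islimpt_approachable[THEN iffD2], intro allI impI)
      fix e :: real assume "e > 0"
      have "complex_of_real (1 + e/2) \<in> complex_of_real ` {0<..}"
        using \<open>e > 0\<close> by (intro imageI) simp
      moreover have "complex_of_real (1 + e/2) \<noteq> 1" "dist (complex_of_real (1 + e/2)) 1 < e"
        using \<open>e > 0\<close> by (auto simp: dist_norm norm_divide)
      ultimately show "\<exists>x'\<in>complex_of_real ` {0<..}. x' \<noteq> 1 \<and> dist x' 1 < e"
        by blast
    qed
    fix w assume "w \<in> complex_of_real ` {0<..}"
    then obtain b where b: "b > 0" "w = of_real b" by auto
    have eb: "exp (- complex_of_real b * of_real (x\<^sup>2)) = of_real (exp (- b * x\<^sup>2))" for x
      unfolding exp_of_real[symmetric] by simp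
    have ez: "exp (- complex_of_real (z\<^sup>2) / (4 * of_real b)) = of_real (exp (- z\<^sup>2 / (4 * b)))"
      unfolding exp_of_real[symmetric] by simp
    have sb: "csqrt (of_real b) = of_real (sqrt b)"
      using b(1) csqrt_of_real_nonneg[of "of_real b"] by simp
    have "F w = of_real (sqrt (pi / b) * exp (- z\<^sup>2 / (4 * b)))"
      unfolding F_def b(2) eb by (rule Fourier_Gaussian_real(2)[OF b(1)])
    also have "\<dots> = of_real (sqrt pi / sqrt b) * of_real (exp (- z\<^sup>2 / (4 * b)))"
      by (simp only: real_sqrt_divide of_real_mult)
    also have "\<dots> = G w"
      unfolding G_def b(2) ez sb by (simp only: of_real_divide)
    finally show "F w - G w = 0" by (simp only: diff_self)
  qed
  then show "(LINT x|lborel. exp (- a * of_real (x\<^sup>2)) * cis (z * x))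
       = of_real (sqrt pi) / csqrt a * exp (- of_real (z\<^sup>2) / (4 * a))"
    by (simp add: F_def G_def)
qed

text \<open>
  The dispersive estimate of the Schroedinger group, at the level of its regularized kernel. Here
  \<open>a = \<kappa> - i \<tau>\<close>, and the bound \<open>|a| \<ge> |\<tau>|\<close> makes it uniform in \<open>\<kappa>\<close>.
\<close>

lemma Gaussian_dispersive_bound:
  fixes \<kappa> \<tau> z :: real
  assumes "\<kappa> > 0" "\<tau> \<noteq> 0"
  shows "cmod (LINT x|lborel. of_real (exp (- \<kappa> * x\<^sup>2)) * cis (\<tau> * x\<^sup>2) * cis (- (z * x))) \<le> sqrt pi * \<bar>\<tau>\<bar> powr (- 1/2)"
proof -
  define a where "a = Complex \<kappa> (- \<tau>)"
  have a: "Re a > 0" "a \<noteq> 0" using assms by (auto simp: a_def complex_eq_iff)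
  have "(LINT x|lborel. of_real (exp (- \<kappa> * x\<^sup>2)) * cis (\<tau> * x\<^sup>2) * cis (- (z * x)))
     = (LINT x|lborel. exp (- a * of_real (x\<^sup>2)) * cis (- z * x))"
  proof (rule Bochner_Integration.integral_cong[OF refl])
    fix x :: real
    have "- a * of_real (x\<^sup>2) = of_real (- \<kappa> * x\<^sup>2) + \<i> * of_real (\<tau> * x\<^sup>2)"
      by (simp add: a_def complex_eq_iff)
    then have "exp (- a * of_real (x\<^sup>2)) = of_real (exp (- \<kappa> * x\<^sup>2)) * cis (\<tau> * x\<^sup>2)"
      unfolding exp_of_real[symmetric] cis_conv_exp exp_add[symmetric] by simp
    then show "of_real (exp (- \<kappa> * x\<^sup>2)) * cis (\<tau> * x\<^sup>2) * cis (- (z * x)) = exp (- a * of_real (x\<^sup>2)) * cis (- z * x)"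
      by simp
  qed
  also have "\<dots> = of_real (sqrt pi) / csqrt a * exp (- of_real (z\<^sup>2) / (4 * a))"
    using Fourier_Gaussian(2)[OF a(1), of "- z"] by simp
  also have "cmod \<dots> \<le> sqrt pi * \<bar>\<tau>\<bar> powr (- 1/2)"
  proof -
    have 1: "cmod (exp (- complex_of_real (z\<^sup>2) / (4 * a))) \<le> 1"
      using norm_Gaussian_transform_le_1[OF a(1)] .
    have "\<bar>\<tau>\<bar> \<le> cmod a" using abs_Im_le_cmod[of a] by (simp add: a_def)
    then have "sqrt \<bar>\<tau>\<bar> \<le> cmod (csqrt a)" by simp
    then have "inverse (cmod (csqrt a)) \<le> inverse (sqrt \<bar>\<tau>\<bar>)"
      using assms by (intro le_imp_inverse_le) auto
    also have "inverse (sqrt \<bar>\<tau>\<bar>) = \<bar>\<tau>\<bar> powr (- 1/2)"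
      by (simp add: powr_minus powr_half_sqrt)
    finally have 2: "inverse (cmod (csqrt a)) \<le> \<bar>\<tau>\<bar> powr (- 1/2)" .
    have "cmod (of_real (sqrt pi) / csqrt a * exp (- of_real (z\<^sup>2) / (4 * a)))
        = sqrt pi * inverse (cmod (csqrt a)) * cmod (exp (- complex_of_real (z\<^sup>2) / (4 * a)))"
      by (simp only: norm_mult norm_inverse norm_of_real divide_inverse abs_of_nonneg real_sqrt_ge_zero pi_ge_zero)
    also have "\<dots> \<le> sqrt pi * \<bar>\<tau>\<bar> powr (- 1/2) * 1"
      by (intro mult_mono 1 2) auto
    finally show ?thesis by simp
  qed
  finally show ?thesis .
qed

text \<open>
  A modulated Gaussian is an integrable substitute for the plane wave \<open>cis (- \<zeta> x)\<close>, on which the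
  free group acts by the factor \<open>cis (- t \<zeta>\<^sup>2)\<close>. The evolution is explicit, bounded uniformly in the width,
  and tends to the evolved plane wave.
\<close>

lemma free_group_modulated_Gaussian:
  fixes \<zeta> t x :: real
  assumes t: "t > 0"
  defines "\<phi> \<equiv> \<lambda>\<kappa> y. of_real (exp (- \<kappa> * y\<^sup>2)) * cis (- (\<zeta> * y))"
  shows "\<kappa> > 0 \<Longrightarrow> cmod (free_group t (\<phi> \<kappa>) x) \<le> 1"
    and "((\<lambda>\<kappa>. free_group t (\<phi> \<kappa>) x) \<longlongrightarrow> cis (- (t * \<zeta>\<^sup>2)) * cis (- (\<zeta> * x))) (at_right 0)"
proof -
  define a where "a \<kappa> = Complex \<kappa> (- (1 / (4 * t)))" for \<kappa>
  define b where "b = 4 * of_real pi * \<i> * of_real t"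
  define w where "w = \<zeta> + x / (2 * t)"
  define E where "E \<kappa> = exp (- of_real (w\<^sup>2) / (4 * a \<kappa>))" for \<kappa>
  define R where "R \<kappa> = cis (x\<^sup>2 / (4 * t)) * (of_real (sqrt pi) / csqrt (a \<kappa>) * E \<kappa>) / csqrt b" for \<kappa>
  have formula: "free_group t (\<phi> \<kappa>) x = R \<kappa>"
    if "\<kappa> > 0" for \<kappa>
  proof -
    have "Re (a \<kappa>) > 0" using that by (simp add: a_def)
    have "(LINT y|lborel. cis ((x - y)\<^sup>2 / (4 * t)) * \<phi> \<kappa> y)
        = (LINT y|lborel. cis (x\<^sup>2 / (4 * t)) * (exp (- a \<kappa> * of_real (y\<^sup>2)) * cis (- w * y)))"
    proof (rule Bochner_Integration.integral_cong[OF refl])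
      fix y :: real
      have 1: "- a \<kappa> * of_real (y\<^sup>2) = of_real (- \<kappa> * y\<^sup>2) + \<i> * of_real (y\<^sup>2 / (4 * t))"
        by (simp add: a_def complex_eq_iff)
      have 2: "exp (- a \<kappa> * of_real (y\<^sup>2)) = of_real (exp (- \<kappa> * y\<^sup>2)) * cis (y\<^sup>2 / (4 * t))"
        unfolding 1 exp_of_real[symmetric] cis_conv_exp exp_add[symmetric] by simp
      have 3: "(x - y)\<^sup>2 / (4 * t) + - (\<zeta> * y) = x\<^sup>2 / (4 * t) + y\<^sup>2 / (4 * t) + - w * y"
        using t by (simp add: w_def field_simps power2_eq_square)
      have "cis ((x - y)\<^sup>2 / (4 * t)) * \<phi> \<kappa> y = of_real (exp (- \<kappa> * y\<^sup>2)) * cis ((x - y)\<^sup>2 / (4 * t) + - (\<zeta> * y))"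
        unfolding \<phi>_def by (simp add: cis_mult mult.left_commute)
      also have "\<dots> = cis (x\<^sup>2 / (4 * t)) * (exp (- a \<kappa> * of_real (y\<^sup>2)) * cis (- w * y))"
        unfolding 2 3 cis_mult[symmetric] by (simp add: mult_ac)
      finally show "cis ((x - y)\<^sup>2 / (4 * t)) * \<phi> \<kappa> y
        = cis (x\<^sup>2 / (4 * t)) * (exp (- a \<kappa> * of_real (y\<^sup>2)) * cis (- w * y))" .
    qed
    also have "\<dots> = cis (x\<^sup>2 / (4 * t)) * (of_real (sqrt pi) / csqrt (a \<kappa>) * E \<kappa>)"
      using Fourier_Gaussian(2)[OF \<open>Re (a \<kappa>) > 0\<close>, of "- w"] by (simp add: E_def)
    finally show ?thesis using t by (simp add: free_group_def b_def R_def)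
  qed
  show "cmod (free_group t (\<phi> \<kappa>) x) \<le> 1" if \<kappa>: "\<kappa> > 0"
  proof -
    have 1: "cmod (E \<kappa>) \<le> 1"
      unfolding E_def by (rule norm_Gaussian_transform_le_1) (use \<kappa> in \<open>simp add: a_def\<close>)
    have "1 / (4 * t) \<le> cmod (a \<kappa>)" using abs_Im_le_cmod[of "a \<kappa>"] t by (simp add: a_def)
    then have "sqrt (1 / (4 * t)) * sqrt (4 * pi * t) \<le> cmod (csqrt (a \<kappa>)) * cmod (csqrt b)"
      using t by (intro mult_mono) (auto simp: b_def norm_mult)
    also have "sqrt (1 / (4 * t)) * sqrt (4 * pi * t) = sqrt pi"
      using t by (simp flip: real_sqrt_mult)
    finally have 2: "sqrt pi \<le> cmod (csqrt (a \<kappa>)) * cmod (csqrt b)" .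
    have "cmod (free_group t (\<phi> \<kappa>) x) = sqrt pi / (cmod (csqrt (a \<kappa>)) * cmod (csqrt b)) * cmod (E \<kappa>)"
      by (simp add: formula[OF \<kappa>] R_def norm_mult norm_divide)
    also have "\<dots> \<le> 1 * 1"
      by (intro mult_mono 1) (use 2 pi_gt_zero in \<open>auto simp: divide_le_eq_1 intro: less_le_trans\<close>)
    finally show ?thesis by simp
  qed
  have a0: "a 0 \<notin> \<real>\<^sub>\<le>\<^sub>0" "a 0 \<noteq> 0" using t by (auto simp: a_def complex_nonpos_Reals_iff complex_eq_iff)
  \<comment> \<open>The two principal roots have arguments \<open>- \<pi>/4\<close> and \<open>\<pi>/4\<close>, so that no sign is lost.\<close>
  have sq: "csqrt (a 0) * csqrt b = of_real (sqrt pi)"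
  proof -
    have n: "cmod (a 0) = 1 / (4 * t)" "cmod b = 4 * pi * t"
      using t by (auto simp: a_def b_def norm_mult cmod_def)
    define r r' where "r = sqrt (1 / (8 * t))" and "r' = sqrt (2 * pi * t)"
    have 1: "csqrt (a 0) = Complex r (- r)"
      unfolding complex_eq_iff csqrt.sel n using t by (simp add: r_def a_def)
    have 2: "csqrt b = Complex r' r'"
      unfolding complex_eq_iff csqrt.sel n using t by (simp add: r'_def b_def)
    have "r * r' = sqrt (pi / 4)"
      using t by (simp add: r_def r'_def flip: real_sqrt_mult)
    then have "r * r' = sqrt pi / 2"
      by (simp add: real_sqrt_divide)
    then show ?thesis unfolding 1 2 by (simp add: complex_eq_iff mult.commute)
  qed
  have "(R \<longlongrightarrow> R 0) (at_right 0)"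
  proof -
    have al: "((\<lambda>\<kappa>. a \<kappa>) \<longlongrightarrow> a 0) (at_right 0)"
      unfolding a_def by (rule tendsto_Complex[OF tendsto_ident_at tendsto_const])
    have sl: "((\<lambda>\<kappa>. csqrt (a \<kappa>)) \<longlongrightarrow> csqrt (a 0)) (at_right 0)"
      by (rule isCont_tendsto_compose[OF continuous_at_csqrt[OF a0(1)] al])
    have El: "(E \<longlongrightarrow> E 0) (at_right 0)"
      unfolding E_def
      by (rule tendsto_exp, rule tendsto_divide[OF tendsto_const tendsto_mult[OF tendsto_const al]])
         (use a0 in simp)
    have "csqrt (a 0) \<noteq> 0" "csqrt b \<noteq> 0" using a0 t by (auto simp: b_def)
    then show ?thesis unfolding R_def
      by (intro tendsto_divide tendsto_mult tendsto_const sl El)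
  qed
  also have "R 0
      = cis (x\<^sup>2 / (4 * t)) * E 0 * (of_real (sqrt pi) / (csqrt (a 0) * csqrt b))"
    by (simp add: R_def)
  also have "\<dots> = cis (x\<^sup>2 / (4 * t)) * E 0" unfolding sq by simp
  also have "E 0 = cis (- (t * w\<^sup>2))"
  proof -
    have "- of_real (w\<^sup>2) / (4 * a 0) = \<i> * of_real (- (t * w\<^sup>2))"
      using t by (simp add: a_def complex_eq_iff Re_divide Im_divide power2_eq_square)
    then show ?thesis unfolding E_def cis_conv_exp by simp
  qed
  also have "cis (x\<^sup>2 / (4 * t)) * cis (- (t * w\<^sup>2)) = cis (- (t * \<zeta>\<^sup>2)) * cis (- (\<zeta> * x))"
  proof -
    have "x\<^sup>2 / (4 * t) + - (t * w\<^sup>2) = - (t * \<zeta>\<^sup>2) + - (\<zeta> * x)"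
      using t by (simp add: w_def field_simps power2_eq_square)
    then show ?thesis unfolding cis_mult by simp
  qed
  finally have "(R \<longlongrightarrow>
      cis (- (t * \<zeta>\<^sup>2)) * cis (- (\<zeta> * x))) (at_right 0)" .
  then show "((\<lambda>\<kappa>. free_group t (\<phi> \<kappa>) x) \<longlongrightarrow> cis (- (t * \<zeta>\<^sup>2)) * cis (- (\<zeta> * x))) (at_right 0)"
    by (rule Lim_transform_eventually)
       (rule eventually_mono[OF eventually_at_right_less], simp add: formula)
qed

section \<open>Continuous paths of integrable functions\<close>

lemma fourier_measurable [measurable]:
  assumes [measurable]: "f \<in> borel_measurable borel"
  shows "fourier f \<in> borel_measurable borel"
  unfolding fourier_def[abs_def]
  by (rule lborel.borel_measurable_lebesgue_integral) measurable

lemma fourier_bound: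
  assumes "integrable lborel f"
  shows "cmod (fourier f \<zeta>) \<le> (LINT x|lborel. cmod (f x))"
  unfolding fourier_def
  by (rule norm_integral_le_majorant) (use assms in \<open>auto simp: norm_mult\<close>)

text \<open>
  Norm continuity on \<open>[1, \<infinity>)\<close> with values in \<open>L\<^sup>1\<close>. A solution is given only for each time
  separately, without joint measurability in time and space; this continuity is what makes
  its Fourier transform and its free evolution jointly continuous, so that Fubini's theorem applies.
\<close>

definition L1_path :: "(real \<Rightarrow> real \<Rightarrow> complex) \<Rightarrow> bool" where
  "L1_path N \<longleftrightarrow> (\<forall>s\<ge>1. integrable lborel (N s)) \<and>
     (\<forall>s\<ge>1. ((\<lambda>r. LINT y|lborel. cmod (N r y - N s y)) \<longlongrightarrow> 0) (at s within {1..}))"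

lemma L1_path_integrable: "L1_path N \<Longrightarrow> s \<ge> 1 \<Longrightarrow> integrable lborel (N s)"
  by (simp add: L1_path_def)

text \<open>
  The change of \<open>N\<close> is controlled by its continuity in \<open>L\<^sup>1\<close>, the change of the bounded factor \<open>m\<close> by dominated
  convergence against the fixed function \<open>N (fst a)\<close>.
\<close>

lemma L1_path_integral_continuous:
  fixes m :: "real \<times> real \<Rightarrow> real \<Rightarrow> complex"
  assumes N: "L1_path N" and D: "D \<subseteq> {1..} \<times> UNIV"
    and m: "\<And>p. p \<in> D \<Longrightarrow> m p \<in> borel_measurable borel"
    and bd: "\<And>p x. p \<in> D \<Longrightarrow> cmod (m p x) \<le> 1"
    and cont: "\<And>x. continuous_on D (\<lambda>p. m p x)"
  shows "continuous_on D (\<lambda>p. LINT x|lborel. m p x * N (fst p) x)"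
proof (rule continuous_on_sequentiallyI)
  fix u :: "nat \<Rightarrow> real \<times> real" and a
  assume u: "\<forall>n. u n \<in> D" and a: "a \<in> D" and lim: "u \<longlonglongrightarrow> a"
  define d where "d r = (LINT y|lborel. cmod (N r y - N (fst a) y))" for r
  have ge: "fst p \<ge> 1" if "p \<in> D" for p using D that by auto
  have iN: "integrable lborel (N (fst p))" if "p \<in> D" for p
    by (rule L1_path_integrable[OF N ge[OF that]])
  have imN: "integrable lborel (\<lambda>x. m p x * N (fst q) x)" if "p \<in> D" "q \<in> D" for p q
  proof (rule Bochner_Integration.integrable_bound[OF iN[OF that(2)]])
    show "(\<lambda>x. m p x * N (fst q) x) \<in> borel_measurable lborel"
      using m[OF that(1)] iN[OF that(2)] by (auto intro!: borel_measurable_times)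
    show "AE x in lborel. norm (m p x * N (fst q) x) \<le> norm (N (fst q) x)"
      by (rule AE_I2) (use mult_right_mono[OF bd[OF that(1)] norm_ge_zero] in \<open>simp add: norm_mult\<close>)
  qed
  have "continuous (at (fst a) within {1..}) d"
    using N ge[OF a] by (simp add: continuous_within d_def[abs_def] L1_path_def)
  then have "(\<lambda>n. d (fst (u n))) \<longlonglongrightarrow> d (fst a)"
    by (rule continuous_within_tendsto_compose'[OF _ _ tendsto_fst[OF lim]]) (use u ge in auto)
  then have d0: "(\<lambda>n. d (fst (u n))) \<longlonglongrightarrow> 0" by (simp add: d_def)
  have "(\<lambda>n. (LINT x|lborel. m (u n) x * N (fst (u n)) x) - (LINT x|lborel. m (u n) x * N (fst a) x)) \<longlonglongrightarrow> 0"
  proof (rule Lim_null_comparison[OF _ d0], rule always_eventually, rule allI)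
    fix n
    have un: "u n \<in> D" using u by simp
    have "norm ((LINT x|lborel. m (u n) x * N (fst (u n)) x) - (LINT x|lborel. m (u n) x * N (fst a) x))
        = norm (LINT x|lborel. m (u n) x * (N (fst (u n)) x - N (fst a) x))"
      using imN[OF un un] imN[OF un a] by (simp add: right_diff_distrib)
    also have "\<dots> \<le> d (fst (u n))"
      unfolding d_def
    proof (rule norm_integral_le_majorant)
      show "integrable lborel (\<lambda>y. cmod (N (fst (u n)) y - N (fst a) y))"
        using iN[OF un] iN[OF a] by auto
      show "AE x in lborel. norm (m (u n) x * (N (fst (u n)) x - N (fst a) x)) \<le> cmod (N (fst (u n)) x - N (fst a) x)"
        by (rule AE_I2) (use mult_right_mono[OF bd[OF un] norm_ge_zero] in \<open>simp add: norm_mult\<close>)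
    qed
    finally show "norm ((LINT x|lborel. m (u n) x * N (fst (u n)) x) - (LINT x|lborel. m (u n) x * N (fst a) x)) \<le> d (fst (u n))" .
  qed
  moreover have "(\<lambda>n. LINT x|lborel. m (u n) x * N (fst a) x) \<longlonglongrightarrow> (LINT x|lborel. m a x * N (fst a) x)"
  proof (rule integral_dominated_convergence)
    show "integrable lborel (\<lambda>x. cmod (N (fst a) x))" using iN[OF a] by auto
    show "AE x in lborel. (\<lambda>n. m (u n) x * N (fst a) x) \<longlonglongrightarrow> m a x * N (fst a) x"
    proof (rule AE_I2)
      fix x
      have "(\<lambda>n. m (u n) x) \<longlonglongrightarrow> m a x"
        using continuous_on_tendsto_compose[OF cont lim a] u by simp
      then show "(\<lambda>n. m (u n) x * N (fst a) x) \<longlonglongrightarrow> m a x * N (fst a) x" by (intro tendsto_intros)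
    qed
    show "AE x in lborel. norm (m (u n) x * N (fst a) x) \<le> cmod (N (fst a) x)" for n
      by (rule AE_I2) (use mult_right_mono[OF bd[OF u[rule_format, of n]] norm_ge_zero] in \<open>simp add: norm_mult\<close>)
    show "(\<lambda>x. m a x * N (fst a) x) \<in> borel_measurable lborel" using imN[OF a a] by auto
    show "(\<lambda>x. m (u n) x * N (fst a) x) \<in> borel_measurable lborel" for n
      using imN[OF u[rule_format, of n] a] by auto
  qed
  ultimately have "(\<lambda>n. ((LINT x|lborel. m (u n) x * N (fst (u n)) x) - (LINT x|lborel. m (u n) x * N (fst a) x))
      + (LINT x|lborel. m (u n) x * N (fst a) x)) \<longlonglongrightarrow> 0 + (LINT x|lborel. m a x * N (fst a) x)"
    by (rule tendsto_add)
  then show "(\<lambda>n. LINT x|lborel. m (u n) x * N (fst (u n)) x) \<longlonglongrightarrow> (LINT x|lborel. m a x * N (fst a) x)"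
    by simp
qed

lemma L1_path_fourier_continuous:
  assumes "L1_path N"
  shows "continuous_on ({1..} \<times> UNIV) (\<lambda>(s, \<zeta>). fourier (N s) \<zeta>)"
proof -
  have "continuous_on ({1..} \<times> UNIV) (\<lambda>p. LINT x|lborel. cis (- (snd p * x)) * N (fst p) x)"
    by (rule L1_path_integral_continuous[OF assms]) (auto intro!: continuous_intros)
  then show ?thesis by (simp add: fourier_def split_beta)
qed

lemma L1_path_bounded:
  assumes N: "L1_path N"
  obtains B where "B \<ge> 0" "\<And>s. s \<in> {1..t} \<Longrightarrow> (LINT y|lborel. cmod (N s y)) \<le> B"
proof -
  define I where "I s = (LINT y|lborel. cmod (N s y))" for s
  have "continuous_on {1..t} I"
    unfolding continuous_on_eq_continuous_within
  proof
    fix s assume s: "s \<in> {1..t}"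
    have "((\<lambda>r. LINT y|lborel. cmod (N r y - N s y)) \<longlongrightarrow> 0) (at s within {1..t})"
      using N s unfolding L1_path_def by (auto intro: tendsto_within_subset)
    moreover have "\<forall>\<^sub>F r in at s within {1..t}. norm (I r - I s) \<le> (LINT y|lborel. cmod (N r y - N s y))"
      unfolding eventually_at
    proof (intro exI[of _ 1] conjI ballI impI)
      fix r assume "r \<in> {1..t}"
      then have i: "integrable lborel (N r)" "integrable lborel (N s)"
        using s by (auto intro: L1_path_integrable[OF N])
      have "norm (I r - I s) = norm (LINT y|lborel. cmod (N r y) - cmod (N s y))"
        using i by (simp add: I_def)
      also have "\<dots> \<le> (LINT y|lborel. cmod (N r y - N s y))"
        by (rule norm_integral_le_majorant) (use i norm_triangle_ineq3 in auto)
      finally show "norm (I r - I s) \<le> (LINT y|lborel. cmod (N r y - N s y))" .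
    qed simp
    ultimately have "((\<lambda>r. I r - I s) \<longlongrightarrow> 0) (at s within {1..t})"
      by (rule Lim_null_comparison[rotated])
    then show "continuous (at s within {1..t}) I"
      unfolding continuous_within by (rule LIM_zero_cancel)
  qed
  then have "bounded (I ` {1..t})"
    by (intro compact_imp_bounded compact_continuous_image) auto
  then obtain B where "\<forall>x\<in>I ` {1..t}. norm x \<le> B" unfolding bounded_iff by blast
  then have "I s \<le> max B 0" if "s \<in> {1..t}" for s
  proof -
    have "\<bar>I s\<bar> \<le> B" using \<open>\<forall>x\<in>I ` {1..t}. norm x \<le> B\<close> that by simp
    then show ?thesis by linarith
  qed
  then show thesis using that[of "max B 0"] by (simp add: I_def)
qed

section \<open>Duhamel's formula on the Fourier side\<close>

lemma norm_csqrt_kernel: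
  assumes "t > 0"
  shows "cmod (csqrt (4 * of_real pi * \<i> * of_real t)) = sqrt (4 * pi * t)"
  using assms by (simp add: norm_mult)

lemma free_group_bound:
  assumes "integrable lborel f" "t > 0"
  shows "cmod (free_group t f y) \<le> (LINT x|lborel. cmod (f x)) / sqrt (4 * pi * t)"
proof -
  have "cmod (LINT x|lborel. cis ((y - x)\<^sup>2 / (4 * t)) * f x) \<le> (LINT x|lborel. cmod (f x))"
    by (rule norm_integral_le_majorant) (use assms in \<open>auto simp: norm_mult\<close>)
  moreover have "free_group t f y = (LINT x|lborel. cis ((y - x)\<^sup>2 / (4 * t)) * f x)
      / csqrt (4 * of_real pi * \<i> * of_real t)"
    using assms(2) by (simp add: free_group_def)
  ultimately show ?thesis
    using assms(2) by (simp only: norm_divide norm_csqrt_kernel) (simp add: divide_right_mono)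
qed

lemma free_group_measurable:
  assumes [measurable]: "f \<in> borel_measurable borel"
  shows "free_group t f \<in> borel_measurable borel"
proof -
  have "(\<lambda>y. LINT x|lborel. cis ((y - x)\<^sup>2 / (4 * t)) * f x) \<in> borel_measurable borel"
    by (rule lborel.borel_measurable_lebesgue_integral) measurable
  then show ?thesis unfolding free_group_def[abs_def] by simp
qed

text \<open>
  The kernel of the free group depends on \<open>(y - x)\<^sup>2\<close> only.
\<close>

lemma free_group_symmetric:
  assumes f: "integrable lborel f" and g: "integrable lborel g"
  shows "(LINT y|lborel. g y * free_group t f y) = (LINT x|lborel. f x * free_group t g x)"
proof (cases "t = 0")
  case True
  then show ?thesis by (simp add: free_group_def mult.commute)
next
  case False
  define k where "k y x = cis ((y - x)\<^sup>2 / (4 * t)) / csqrt (4 * of_real pi * \<i> * of_real t)" for y x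
  have 1: "free_group t f y = (LINT x|lborel. f x * k y x)" for y
    using False by (simp add: free_group_def k_def mult.commute)
  have 2: "free_group t g x = (LINT y|lborel. g y * k y x)" for x
    using False by (simp add: free_group_def k_def mult.commute power2_commute)
  show ?thesis unfolding 1 2
  proof (rule kernel_exchange[OF g f])
    show "(\<lambda>(y, x). k y x) \<in> borel_measurable borel"
      unfolding k_def split_beta
      by (intro borel_measurable_continuous_onI continuous_intros) (use False in auto)
    show "cmod (k y x) \<le> 1 / cmod (csqrt (4 * of_real pi * \<i> * of_real t))" for y x
      by (simp add: k_def norm_divide)
  qed
qed

lemma L1_path_free_group_continuous:
  assumes N: "L1_path N"
  shows "continuous_on ({1..<t} \<times> UNIV) (\<lambda>(s, y). free_group (t - s) (N s) y)"
proof -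
  have "continuous_on ({1..<t} \<times> UNIV)
     (\<lambda>p. LINT x|lborel. cis ((snd p - x)\<^sup>2 / (4 * (t - fst p))) * N (fst p) x)"
  proof (rule L1_path_integral_continuous[OF N])
    show "continuous_on ({1..<t} \<times> UNIV) (\<lambda>p. cis ((snd p - x)\<^sup>2 / (4 * (t - fst p))))" for x :: real
      by (intro continuous_intros) auto
  qed auto
  moreover have "continuous_on ({1..<t} \<times> UNIV) (\<lambda>p :: real \<times> real. csqrt (4 * of_real pi * \<i> * of_real (t - fst p)))"
    by (intro continuous_intros continuous_on_compose2[OF continuous_on_csqrt])
       (auto simp: complex_nonpos_Reals_iff)
  ultimately have "continuous_on ({1..<t} \<times> UNIV)
     (\<lambda>p. (LINT x|lborel. cis ((snd p - x)\<^sup>2 / (4 * (t - fst p))) * N (fst p) x)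
        / csqrt (4 * of_real pi * \<i> * of_real (t - fst p)))"
    by (rule continuous_on_divide) auto
  then show ?thesis
    by (rule continuous_on_eq) (auto simp: free_group_def split: prod.splits)
qed

definition modulated_Gaussian :: "real \<Rightarrow> real \<Rightarrow> real \<Rightarrow> complex" where
  "modulated_Gaussian \<kappa> \<zeta> y = of_real (exp (- \<kappa> * y\<^sup>2)) * cis (- (\<zeta> * y))"

lemma modulated_Gaussian_integrable:
  assumes "\<kappa> > 0"
  shows "integrable lborel (modulated_Gaussian \<kappa> \<zeta>)"
  by (rule Bochner_Integration.integrable_bound[OF Fourier_Gaussian_real(1)[OF assms]])
     (auto simp: modulated_Gaussian_def[abs_def] norm_mult)

lemma modulated_Gaussian_measurable [measurable]: "modulated_Gaussian \<kappa> \<zeta> \<in> borel_measurable borel"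
  unfolding modulated_Gaussian_def[abs_def] by measurable

lemma modulated_Gaussian_bound: "\<kappa> > 0 \<Longrightarrow> cmod (modulated_Gaussian \<kappa> \<zeta> y) \<le> 1"
  by (simp add: modulated_Gaussian_def norm_mult)

lemma modulated_Gaussian_limit:
  assumes "filterlim \<kappa> (at_right 0) F"
  shows "((\<lambda>n. modulated_Gaussian (\<kappa> n) \<zeta> y) \<longlongrightarrow> cis (- (\<zeta> * y))) F"
proof -
  have "(\<kappa> \<longlongrightarrow> 0) F" using assms by (simp add: filterlim_at)
  then have "((\<lambda>n. of_real (exp (- \<kappa> n * y\<^sup>2)) * cis (- (\<zeta> * y))) \<longlongrightarrow> complex_of_real (exp (- 0 * y\<^sup>2)) * cis (- (\<zeta> * y))) F"
    by (intro tendsto_intros)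
  then show ?thesis by (simp add: modulated_Gaussian_def)
qed

text \<open>
  Limits under the integral sign are justified by the uniform bound on the evolved Gaussian.
\<close>

lemma free_group_pairing:
  assumes h: "integrable lborel h" and t: "t > 0"
  shows "\<kappa> > 0 \<Longrightarrow> cmod (LINT x|lborel. h x * free_group t (modulated_Gaussian \<kappa> \<zeta>) x) \<le> (LINT x|lborel. cmod (h x))"
    and "filterlim \<kappa>s (at_right 0) sequentially \<Longrightarrow>
      (\<lambda>n. LINT x|lborel. h x * free_group t (modulated_Gaussian (\<kappa>s n) \<zeta>) x)
        \<longlonglongrightarrow> cis (- (t * \<zeta>\<^sup>2)) * fourier h \<zeta>"
proof -
  have bd: "cmod (free_group t (modulated_Gaussian \<kappa> \<zeta>) x) \<le> 1" if "\<kappa> > 0" for \<kappa> x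
    using free_group_modulated_Gaussian(1)[OF t that] by (simp add: modulated_Gaussian_def[abs_def])
  have bd': "cmod (h x * free_group t (modulated_Gaussian \<kappa> \<zeta>) x) \<le> cmod (h x)" if "\<kappa> > 0" for \<kappa> x
    using mult_left_mono[OF bd[OF that] norm_ge_zero, of "h x"] by (simp add: norm_mult)
  show "cmod (LINT x|lborel. h x * free_group t (modulated_Gaussian \<kappa> \<zeta>) x) \<le> (LINT x|lborel. cmod (h x))"
    if "\<kappa> > 0"
    by (rule norm_integral_le_majorant) (use h bd'[OF that] in auto)
  assume lim: "filterlim \<kappa>s (at_right 0) sequentially"
  then have ev: "\<forall>\<^sub>F n in sequentially. \<kappa>s n > 0"
    by (auto simp: filterlim_at elim: eventually_mono)
  then obtain n0 where n0: "\<And>n. n \<ge> n0 \<Longrightarrow> \<kappa>s n > 0" by (auto simp: eventually_sequentially)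
  have [measurable]: "h \<in> borel_measurable borel" using h by auto
  have [measurable]: "free_group t (modulated_Gaussian \<kappa> \<zeta>) \<in> borel_measurable borel" for \<kappa>
    by (rule free_group_measurable) simp
  have "(\<lambda>n. LINT x|lborel. h x * free_group t (modulated_Gaussian (\<kappa>s (n + n0)) \<zeta>) x)
      \<longlonglongrightarrow> (LINT x|lborel. h x * (cis (- (t * \<zeta>\<^sup>2)) * cis (- (\<zeta> * x))))"
  proof (rule integral_dominated_convergence)
    show "integrable lborel (\<lambda>x. cmod (h x))" using h by simp
    show "AE x in lborel. norm (h x * free_group t (modulated_Gaussian (\<kappa>s (n + n0)) \<zeta>) x) \<le> cmod (h x)" for n
      using bd' n0 by (intro AE_I2) auto
    show "AE x in lborel. (\<lambda>n. h x * free_group t (modulated_Gaussian (\<kappa>s (n + n0)) \<zeta>) x)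
        \<longlonglongrightarrow> h x * (cis (- (t * \<zeta>\<^sup>2)) * cis (- (\<zeta> * x)))"
    proof (rule AE_I2)
      fix x
      have "(\<lambda>n. free_group t (modulated_Gaussian (\<kappa>s n) \<zeta>) x) \<longlonglongrightarrow> cis (- (t * \<zeta>\<^sup>2)) * cis (- (\<zeta> * x))"
        using filterlim_compose[OF free_group_modulated_Gaussian(2)[OF t] lim]
        by (simp add: modulated_Gaussian_def[abs_def])
      then have "(\<lambda>n. free_group t (modulated_Gaussian (\<kappa>s (n + n0)) \<zeta>) x) \<longlonglongrightarrow> cis (- (t * \<zeta>\<^sup>2)) * cis (- (\<zeta> * x))"
        by (rule LIMSEQ_ignore_initial_segment)
      then show "(\<lambda>n. h x * free_group t (modulated_Gaussian (\<kappa>s (n + n0)) \<zeta>) x)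
        \<longlonglongrightarrow> h x * (cis (- (t * \<zeta>\<^sup>2)) * cis (- (\<zeta> * x)))" by (rule tendsto_mult_left)
    qed
  qed measurable
  also have "(LINT x|lborel. h x * (cis (- (t * \<zeta>\<^sup>2)) * cis (- (\<zeta> * x)))) = cis (- (t * \<zeta>\<^sup>2)) * fourier h \<zeta>"
    unfolding fourier_def integral_mult_right_zero[symmetric] by (simp only: mult_ac)
  finally show "(\<lambda>n. LINT x|lborel. h x * free_group t (modulated_Gaussian (\<kappa>s n) \<zeta>) x)
        \<longlonglongrightarrow> cis (- (t * \<zeta>\<^sup>2)) * fourier h \<zeta>"
    by (rule LIMSEQ_offset)
qed

text \<open>
  A single term of the mild formulation need not be integrable in \<open>y\<close>, so it has no
  Fourier integral of its own. Therefore the equation is tested with modulated Gaussians, the free group is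
  moved onto them by symmetry, and the width tends to infinity. The singularity \<open>(t - s)\<^sup>-\<^sup>1\<^sup>/\<^sup>2\<close> of the
  kernel at the final time is integrable.
\<close>

lemma fourier_Duhamel:
  assumes N: "L1_path N" and f: "integrable lborel f" and g: "integrable lborel g" and t: "t \<ge> 1"
    and eq: "AE y in lborel. g y = free_group (t - 1) f y - \<i> * (LINT s:{1..t}|lborel. free_group (t - s) (N s) y)"
  shows "fourier g \<zeta> = cis (- ((t - 1) * \<zeta>\<^sup>2)) * fourier f \<zeta>
      - \<i> * (LINT s:{1..t}|lborel. cis (- ((t - s) * \<zeta>\<^sup>2)) * fourier (N s) \<zeta>)"
proof (cases "t = 1")
  case True
  have z: "(LINT s:{1..1}|lborel. h s) = 0" for h :: "real \<Rightarrow> complex"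
  proof -
    have "AE s in lborel. indicator {1..1} s *\<^sub>R h s = 0"
      using AE_lborel_singleton[of "1::real"] by eventually_elim (auto simp: indicator_def)
    then show ?thesis unfolding set_lebesgue_integral_def by (rule integral_eq_zero_AE)
  qed
  have "fourier g \<zeta> = fourier f \<zeta>"
    unfolding fourier_def
  proof (rule integral_cong_AE)
    show "AE y in lborel. cis (- (\<zeta> * y)) * g y = cis (- (\<zeta> * y)) * f y"
      using eq by eventually_elim (simp add: True z[simplified] free_group_def)
  qed (use f g in \<open>auto intro!: borel_measurable_times\<close>)
  then show ?thesis by (simp add: True z[simplified])
next
  case False
  then have t: "t > 1" using t by simp
  have [measurable]: "f \<in> borel_measurable borel" "g \<in> borel_measurable borel" using f g by auto
  obtain B where B: "B \<ge> 0" "\<And>s. s \<in> {1..t} \<Longrightarrow> (LINT y|lborel. cmod (N s y)) \<le> B"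
    using L1_path_bounded[OF N] by blast
  have iN: "integrable lborel (N s)" if "s \<in> {1..t}" for s
    using L1_path_integrable[OF N] that by auto
  define \<kappa> where "\<kappa> n = inverse (real (Suc n))" for n
  have \<kappa>: "\<kappa> n > 0" for n by (simp add: \<kappa>_def)
  have \<kappa>lim: "filterlim \<kappa> (at_right 0) sequentially"
    unfolding \<kappa>_def filterlim_at using LIMSEQ_inverse_real_of_nat by auto
  define \<phi> where "\<phi> n = modulated_Gaussian (\<kappa> n) \<zeta>" for n
  have i\<phi>: "integrable lborel (\<phi> n)" for n
    unfolding \<phi>_def by (rule modulated_Gaussian_integrable[OF \<kappa>])
  have [measurable]: "\<phi> n \<in> borel_measurable borel" for n unfolding \<phi>_def by measurable
  \<comment> \<open>The weight \<open>w\<close> carries the singularity at \<open>s = t\<close>, so that \<open>k\<close> is bounded.\<close>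
  define w where "w s = complex_of_real (indicator {1..t} s * (t - s) powr (- 1/2))" for s
  have iw: "integrable lborel w"
  proof -
    have "has_bochner_integral lborel (\<lambda>s. indicator {t - (t - 1)..t} s * (t - s) powr (- 1/2)) (2 * sqrt (t - 1))"
      by (rule inverse_sqrt_integral_left) (use t in simp)
    then have "integrable lborel (\<lambda>s. indicator {1..t} s * (t - s) powr (- 1/2))"
      by (simp add: has_bochner_integral_iff)
    then show ?thesis unfolding w_def[abs_def] by (rule integrable_of_real)
  qed
  then have [measurable]: "w \<in> borel_measurable borel" by auto
  define k where "k y s = complex_of_real (indicator {1..<t} s * (t - s) powr (1/2)) * free_group (t - s) (N s) y" for y s
  have kbd: "cmod (k y s) \<le> B" for y s
  proof (cases "s \<in> {1..<t}")
    case True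
    then have s: "t - s > 0" "s \<in> {1..t}" by auto
    have "cmod (k y s) = sqrt (t - s) * cmod (free_group (t - s) (N s) y)"
      using True by (simp add: k_def norm_mult powr_half_sqrt)
    also have "\<dots> \<le> sqrt (t - s) * (B / sqrt (4 * pi * (t - s)))"
    proof (rule mult_left_mono)
      have "cmod (free_group (t - s) (N s) y) \<le> (LINT x|lborel. cmod (N s x)) / sqrt (4 * pi * (t - s))"
        by (rule free_group_bound[OF iN[OF s(2)] s(1)])
      also have "\<dots> \<le> B / sqrt (4 * pi * (t - s))"
        using B(2)[OF s(2)] s(1) by (intro divide_right_mono) auto
      finally show "cmod (free_group (t - s) (N s) y) \<le> B / sqrt (4 * pi * (t - s))" .
    qed (use s in simp)
    also have "\<dots> = B / sqrt (4 * pi)" using s by (simp add: real_sqrt_mult)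
    also have "\<dots> \<le> B"
    proof -
      have "1 \<le> sqrt (4 * pi)" using pi_ge_two by simp
      then have "B / sqrt (4 * pi) \<le> B / 1" using B(1) by (intro divide_left_mono) auto
      then show ?thesis by simp
    qed
    finally show ?thesis .
  qed (use B in \<open>simp add: k_def\<close>)
  have km: "(\<lambda>(y, s). k y s) \<in> borel_measurable borel"
  proof -
    have "(\<lambda>p. indicator ({1..<t} \<times> UNIV) p *\<^sub>R (case p of (s, y) \<Rightarrow> free_group (t - s) (N s) y)) \<in> borel_measurable borel"
      by (rule borel_measurable_continuous_on_indicator[OF _ L1_path_free_group_continuous[OF N]])
         (intro borel_Times, auto)
    moreover have "(\<lambda>(y, s). (s, y)) \<in> (borel :: (real \<times> real) measure) \<rightarrow>\<^sub>M borel"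
      unfolding split_beta by (intro borel_measurable_continuous_onI continuous_intros)
    ultimately have 1: "(\<lambda>q. case q of (y, s) \<Rightarrow> indicator ({1..<t} \<times> UNIV) (s, y) *\<^sub>R free_group (t - s) (N s) y) \<in> borel_measurable borel"
      by (auto dest: measurable_compose[rotated] simp: split_beta)
    have 2: "(\<lambda>q :: real \<times> real. complex_of_real ((t - snd q) powr (1/2))) \<in> borel_measurable borel"
      unfolding borel_prod[symmetric] by measurable
    from borel_measurable_times[OF 2 1] show ?thesis
      by (rule measurable_cong[THEN iffD1, rotated]) (auto simp: k_def indicator_def split_beta)
  qed
  then have km' [measurable]: "(\<lambda>(y, s). k y s) \<in> borel_measurable (borel \<Otimes>\<^sub>M borel)"
    by (simp add: borel_prod)
  have wk: "w s * (complex_of_real (indicator {1..<t} s * (t - s) powr (1/2)) * z) = of_real (indicator {1..<t} s) * z" for s z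
  proof (cases "s \<in> {1..<t}")
    case True
    then have "(t - s) powr (- 1/2) * (t - s) powr (1/2) = 1" by (simp flip: powr_add)
    then have "complex_of_real ((t - s) powr (- 1/2)) * complex_of_real ((t - s) powr (1/2)) = 1"
      by (metis of_real_1 of_real_mult)
    then show ?thesis using True by (simp add: w_def flip: mult.assoc)
  qed simp
  have drop: "(LINT s:{1..t}|lborel. h s) = (LINT s|lborel. of_real (indicator {1..<t} s) * h s)"
    for h :: "real \<Rightarrow> complex"
    unfolding set_lebesgue_integral_def
    by (rule integral_discrete_difference[of "{t}"]) (auto simp: indicator_def)
  have H: "(LINT s:{1..t}|lborel. free_group (t - s) (N s) y) = (LINT s|lborel. w s * k y s)" for y
    unfolding drop k_def wk ..
  have Hm [measurable]: "(\<lambda>y. LINT s|lborel. w s * k y s) \<in> borel_measurable borel"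
    by (rule lborel.borel_measurable_lebesgue_integral) measurable
  have step: "(LINT y|lborel. \<phi> n y * g y) = (LINT x|lborel. f x * free_group (t - 1) (\<phi> n) x)
     - \<i> * (LINT s|lborel. w s * (LINT y|lborel. \<phi> n y * k y s))" for n
  proof -
    have [measurable]: "free_group (t - 1) f \<in> borel_measurable borel" by (rule free_group_measurable) simp
    have "(LINT y|lborel. \<phi> n y * g y) = (LINT y|lborel. \<phi> n y * free_group (t - 1) f y - \<i> * (\<phi> n y * (LINT s|lborel. w s * k y s)))"
    proof (rule integral_cong_AE)
      show "AE y in lborel. \<phi> n y * g y = \<phi> n y * free_group (t - 1) f y - \<i> * (\<phi> n y * (LINT s|lborel. w s * k y s))"
        using eq by eventually_elim (simp add: H right_diff_distrib mult.left_commute)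
    qed measurable
    also have "\<dots> = (LINT y|lborel. \<phi> n y * free_group (t - 1) f y) - \<i> * (LINT y|lborel. \<phi> n y * (LINT s|lborel. w s * k y s))"
    proof -
      have bi: "integrable lborel (\<lambda>y. \<phi> n y * h y)"
        if [measurable]: "h \<in> borel_measurable borel" and "\<And>y. cmod (h y) \<le> c" for h c
      proof (rule Bochner_Integration.integrable_bound)
        show "integrable lborel (\<lambda>y. c * cmod (\<phi> n y))" using i\<phi> by simp
        show "AE y in lborel. norm (\<phi> n y * h y) \<le> norm (c * cmod (\<phi> n y))"
        proof (rule AE_I2)
          fix y
          have "cmod (h y) \<le> \<bar>c\<bar>" using that(2)[of y] by linarith
          then show "norm (\<phi> n y * h y) \<le> norm (c * cmod (\<phi> n y))"
            using mult_left_mono[of "cmod (h y)" "\<bar>c\<bar>" "cmod (\<phi> n y)"] by (simp add: norm_mult abs_mult mult.commute)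
        qed
      qed measurable
      have "integrable lborel (\<lambda>y. \<phi> n y * free_group (t - 1) f y)"
        by (rule bi[OF _ free_group_bound[OF f]]) (use t in auto)
      moreover have "integrable lborel (\<lambda>y. \<phi> n y * (LINT s|lborel. w s * k y s))"
      proof (rule bi)
        show "cmod (LINT s|lborel. w s * k y s) \<le> (LINT s|lborel. cmod (w s) * B)" for y
          by (rule norm_integral_le_majorant) (use iw kbd in \<open>auto simp: norm_mult intro!: mult_left_mono\<close>)
      qed measurable
      ultimately show ?thesis by simp
    qed
    also have "(LINT y|lborel. \<phi> n y * free_group (t - 1) f y) = (LINT x|lborel. f x * free_group (t - 1) (\<phi> n) x)"
      by (rule free_group_symmetric[OF f i\<phi>])
    also have "(LINT y|lborel. \<phi> n y * (LINT s|lborel. w s * k y s)) = (LINT s|lborel. w s * (LINT y|lborel. \<phi> n y * k y s))"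
      by (rule kernel_exchange[OF i\<phi> iw km kbd])
    finally show ?thesis .
  qed
  define J where "J n s = (LINT x|lborel. N s x * free_group (t - s) (\<phi> n) x)" for n s
  have inner: "(LINT y|lborel. \<phi> n y * k y s) = of_real (indicator {1..<t} s * (t - s) powr (1/2)) * J n s" for n s
  proof (cases "s \<in> {1..<t}")
    case True
    then have "integrable lborel (N s)" by (intro iN) auto
    from free_group_symmetric[OF this i\<phi>[of n], of "t - s"] show ?thesis
      by (simp add: k_def J_def mult.left_commute[of "\<phi> n _"])
  qed (simp add: k_def)
  have lim1: "(\<lambda>n. LINT y|lborel. \<phi> n y * g y) \<longlonglongrightarrow> (LINT y|lborel. cis (- (\<zeta> * y)) * g y)"
  proof (rule integral_dominated_convergence)
    show "integrable lborel (\<lambda>y. cmod (g y))" using g by simp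
    show "AE y in lborel. norm (\<phi> n y * g y) \<le> cmod (g y)" for n
      unfolding \<phi>_def by (rule AE_I2) (use mult_right_mono[OF modulated_Gaussian_bound[OF \<kappa>] norm_ge_zero] in \<open>simp add: norm_mult\<close>)
    show "AE y in lborel. (\<lambda>n. \<phi> n y * g y) \<longlonglongrightarrow> cis (- (\<zeta> * y)) * g y"
      unfolding \<phi>_def by (intro AE_I2 tendsto_mult modulated_Gaussian_limit \<kappa>lim tendsto_const)
  qed measurable
  have lim2: "(\<lambda>n. LINT x|lborel. f x * free_group (t - 1) (\<phi> n) x) \<longlonglongrightarrow> cis (- ((t - 1) * \<zeta>\<^sup>2)) * fourier f \<zeta>"
    unfolding \<phi>_def by (rule free_group_pairing(2)[OF f _ \<kappa>lim]) (use t in simp)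
  have lim3: "(\<lambda>n. LINT s|lborel. w s * (LINT y|lborel. \<phi> n y * k y s))
     \<longlonglongrightarrow> (LINT s|lborel. of_real (indicator {1..<t} s) * (cis (- ((t - s) * \<zeta>\<^sup>2)) * fourier (N s) \<zeta>))"
  proof (rule integral_dominated_convergence)
    show "integrable lborel (\<lambda>s. cmod (w s) * (sqrt t * B))" using iw by simp
    have [measurable]: "(\<lambda>s. LINT y|lborel. \<phi> n y * k y s) \<in> borel_measurable borel" for n
      by (rule lborel.borel_measurable_lebesgue_integral) measurable
    show "(\<lambda>s. w s * (LINT y|lborel. \<phi> n y * k y s)) \<in> borel_measurable lborel" for n by measurable
    show "AE s in lborel. norm (w s * (LINT y|lborel. \<phi> n y * k y s)) \<le> cmod (w s) * (sqrt t * B)" for n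
    proof (rule AE_I2)
      fix s
      have "cmod (LINT y|lborel. \<phi> n y * k y s) \<le> sqrt t * B"
      proof (cases "s \<in> {1..<t}")
        case True
        then have s: "t - s > 0" "s \<in> {1..t}" by auto
        have "cmod (J n s) \<le> B"
          using free_group_pairing(1)[OF iN[OF s(2)] s(1) \<kappa>, of n \<zeta>] B(2)[OF s(2)]
          unfolding J_def \<phi>_def by linarith
        then have "sqrt (t - s) * cmod (J n s) \<le> sqrt t * B"
          using True by (intro mult_mono) auto
        then show ?thesis using True by (simp add: inner norm_mult powr_half_sqrt)
      qed (use B t in \<open>simp add: inner\<close>)
      then show "norm (w s * (LINT y|lborel. \<phi> n y * k y s)) \<le> cmod (w s) * (sqrt t * B)"
        by (simp add: norm_mult mult_left_mono)
    qed
    show "AE s in lborel. (\<lambda>n. w s * (LINT y|lborel. \<phi> n y * k y s))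
        \<longlonglongrightarrow> of_real (indicator {1..<t} s) * (cis (- ((t - s) * \<zeta>\<^sup>2)) * fourier (N s) \<zeta>)"
    proof (rule AE_I2)
      fix s
      show "(\<lambda>n. w s * (LINT y|lborel. \<phi> n y * k y s))
        \<longlonglongrightarrow> of_real (indicator {1..<t} s) * (cis (- ((t - s) * \<zeta>\<^sup>2)) * fourier (N s) \<zeta>)"
        unfolding inner wk
      proof (cases "s \<in> {1..<t}")
        case True
        then have "integrable lborel (N s)" "t - s > 0" by (auto intro: iN)
        from free_group_pairing(2)[OF this \<kappa>lim, of \<zeta>]
        show "(\<lambda>n. of_real (indicator {1..<t} s) * J n s)
           \<longlonglongrightarrow> of_real (indicator {1..<t} s) * (cis (- ((t - s) * \<zeta>\<^sup>2)) * fourier (N s) \<zeta>)"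
          unfolding J_def \<phi>_def by (rule tendsto_mult_left)
      qed simp
    qed
    show "(\<lambda>s. of_real (indicator {1..<t} s) * (cis (- ((t - s) * \<zeta>\<^sup>2)) * fourier (N s) \<zeta>)) \<in> borel_measurable lborel"
    proof -
      have "continuous_on {1..<t} (\<lambda>s. cis (- ((t - s) * \<zeta>\<^sup>2)) * fourier (N s) \<zeta>)"
        by (intro continuous_intros continuous_on_compose2[OF L1_path_fourier_continuous[OF N],
              of "{1..<t}" "\<lambda>s. (s, \<zeta>)", simplified]) auto
      then have "(\<lambda>s. indicator {1..<t} s *\<^sub>R (cis (- ((t - s) * \<zeta>\<^sup>2)) * fourier (N s) \<zeta>)) \<in> borel_measurable borel"
        by (intro borel_measurable_continuous_on_indicator) auto
      then show ?thesis by (simp add: scaleR_conv_of_real)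
    qed
  qed
  have "(\<lambda>n. LINT y|lborel. \<phi> n y * g y) \<longlonglongrightarrow> cis (- ((t - 1) * \<zeta>\<^sup>2)) * fourier f \<zeta>
     - \<i> * (LINT s|lborel. of_real (indicator {1..<t} s) * (cis (- ((t - s) * \<zeta>\<^sup>2)) * fourier (N s) \<zeta>))"
    unfolding step by (intro tendsto_diff tendsto_mult_left lim2 lim3)
  from LIMSEQ_unique[OF lim1 this] show ?thesis
    unfolding drop fourier_def[of g] .
qed

section \<open>Size of an oscillatory tail\<close>

text \<open>
  With \<open>Q\<close> the localized quintic term, this is the distance of the renormalized profile from its limit, up to
  the factor \<open>\<i>\<close>.
\<close>

definition oscillatory_tail :: "(real \<Rightarrow> real \<Rightarrow> complex) \<Rightarrow> real \<Rightarrow> real \<Rightarrow> complex" where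
  "oscillatory_tail Q T \<zeta> = (LINT s:{T<..}|lborel. cis (s * \<zeta>\<^sup>2) * fourier (Q s) \<zeta>)"

text \<open>
  Writing out both Fourier transforms and integrating in \<open>\<zeta>\<close> first leaves the dispersive kernel, evaluated
  at \<open>y - z\<close>, between \<open>f y\<close> and \<open>cnj (g z)\<close>.
\<close>

lemma dispersive_pairing_bound:
  assumes f: "integrable lborel f" and g: "integrable lborel g" and \<kappa>: "\<kappa> > 0" and \<tau>: "\<tau> \<noteq> 0"
  shows "cmod (LINT \<zeta>|lborel. of_real (exp (- \<kappa> * \<zeta>\<^sup>2)) * cis (\<tau> * \<zeta>\<^sup>2) * fourier f \<zeta> * cnj (fourier g \<zeta>))
    \<le> sqrt pi * \<bar>\<tau>\<bar> powr (- 1/2) * (LINT x|lborel. cmod (f x)) * (LINT x|lborel. cmod (g x))"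
proof -
  have [measurable]: "f \<in> borel_measurable borel" "g \<in> borel_measurable borel" using f g by auto
  define m where "m \<zeta> = of_real (exp (- \<kappa> * \<zeta>\<^sup>2)) * cis (\<tau> * \<zeta>\<^sup>2)" for \<zeta>
  have [measurable]: "m \<in> borel_measurable borel" unfolding m_def[abs_def] by measurable
  have ig: "integrable lborel (\<lambda>\<zeta>. exp (- \<kappa> * \<zeta>\<^sup>2))" by (rule Fourier_Gaussian_real(1)[OF \<kappa>])
  have nm: "cmod (m \<zeta>) = exp (- \<kappa> * \<zeta>\<^sup>2)" for \<zeta> by (simp add: m_def norm_mult)
  have im: "integrable lborel m"
    by (rule Bochner_Integration.integrable_bound[OF ig]) (auto simp: nm)
  define F where "F = (LINT x|lborel. cmod (f x))"
  define G where "G = (LINT x|lborel. cmod (g x))"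
  have FG: "F \<ge> 0" "G \<ge> 0" by (auto simp: F_def G_def)
  have img: "integrable lborel (\<lambda>\<zeta>. m \<zeta> * cnj (fourier g \<zeta>))"
  proof (rule Bochner_Integration.integrable_bound)
    show "integrable lborel (\<lambda>\<zeta>. G * exp (- \<kappa> * \<zeta>\<^sup>2))" using ig by simp
    show "AE \<zeta> in lborel. norm (m \<zeta> * cnj (fourier g \<zeta>)) \<le> norm (G * exp (- \<kappa> * \<zeta>\<^sup>2))"
      by (rule AE_I2) (use fourier_bound[OF g] FG in \<open>simp add: norm_mult nm G_def mult.commute[of _ "exp _"]\<close>)
  qed measurable
  have imc: "integrable lborel (\<lambda>\<zeta>. m \<zeta> * cis (- (\<zeta> * y)))" for y
    by (rule Bochner_Integration.integrable_bound[OF ig]) (auto simp: nm norm_mult)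
  have kc: "(\<lambda>(\<zeta>, y). cis (c * (\<zeta> * y))) \<in> borel_measurable borel" for c :: real
    unfolding split_beta by (intro borel_measurable_continuous_onI continuous_intros)
  define I where "I y = (LINT \<zeta>|lborel. (m \<zeta> * cnj (fourier g \<zeta>)) * cis (- (\<zeta> * y)))" for y
  have "(LINT \<zeta>|lborel. of_real (exp (- \<kappa> * \<zeta>\<^sup>2)) * cis (\<tau> * \<zeta>\<^sup>2) * fourier f \<zeta> * cnj (fourier g \<zeta>))
      = (LINT \<zeta>|lborel. (m \<zeta> * cnj (fourier g \<zeta>)) * (LINT y|lborel. f y * cis (- (\<zeta> * y))))"
    by (simp add: m_def fourier_def[of f] mult_ac)
  also have "\<dots> = (LINT y|lborel. f y * I y)"
    unfolding I_def by (rule kernel_exchange[OF img f, of _ 1]) (use kc[of "-1"] in auto)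
  also have "cmod \<dots> \<le> (LINT y|lborel. cmod (f y) * (sqrt pi * \<bar>\<tau>\<bar> powr (- 1/2) * G))"
  proof (rule norm_integral_le_majorant)
    show "integrable lborel (\<lambda>y. cmod (f y) * (sqrt pi * \<bar>\<tau>\<bar> powr (- 1/2) * G))" using f by simp
    have "cmod (I y) \<le> sqrt pi * \<bar>\<tau>\<bar> powr (- 1/2) * G" for y
    proof -
      have cg: "cnj (fourier g \<zeta>) = (LINT z|lborel. cnj (g z) * cis (\<zeta> * z))" for \<zeta>
        unfolding fourier_def Bochner_Integration.integral_cnj[symmetric]
        by (rule Bochner_Integration.integral_cong[OF refl]) (simp add: cis_cnj mult.commute)
      have "I y = (LINT \<zeta>|lborel. (m \<zeta> * cis (- (\<zeta> * y))) * (LINT z|lborel. cnj (g z) * cis (\<zeta> * z)))"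
        unfolding I_def cg by (simp only: mult_ac)
      also have "\<dots> = (LINT z|lborel. cnj (g z) * (LINT \<zeta>|lborel. (m \<zeta> * cis (- (\<zeta> * y))) * cis (\<zeta> * z)))"
        by (rule kernel_exchange[OF imc _ _, of _ _ 1]) (use kc[of 1] g in auto)
      also have "cmod \<dots> \<le> (LINT z|lborel. cmod (g z) * (sqrt pi * \<bar>\<tau>\<bar> powr (- 1/2)))"
      proof (rule norm_integral_le_majorant)
        show "integrable lborel (\<lambda>z. cmod (g z) * (sqrt pi * \<bar>\<tau>\<bar> powr (- 1/2)))" using g by simp
        have "cmod (LINT \<zeta>|lborel. (m \<zeta> * cis (- (\<zeta> * y))) * cis (\<zeta> * z)) \<le> sqrt pi * \<bar>\<tau>\<bar> powr (- 1/2)" for z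
        proof -
          have "(m \<zeta> * cis (- (\<zeta> * y))) * cis (\<zeta> * z) = of_real (exp (- \<kappa> * \<zeta>\<^sup>2)) * cis (\<tau> * \<zeta>\<^sup>2) * cis (- ((y - z) * \<zeta>))" for \<zeta>
            by (simp add: m_def mult.assoc cis_mult algebra_simps)
          then show ?thesis using Gaussian_dispersive_bound[OF \<kappa> \<tau>, of "y - z"] by simp
        qed
        then show "AE z in lborel. norm (cnj (g z) * (LINT \<zeta>|lborel. (m \<zeta> * cis (- (\<zeta> * y))) * cis (\<zeta> * z)))
            \<le> cmod (g z) * (sqrt pi * \<bar>\<tau>\<bar> powr (- 1/2))"
          by (intro AE_I2) (simp add: norm_mult mult_left_mono)
      qed
      also have "\<dots> = sqrt pi * \<bar>\<tau>\<bar> powr (- 1/2) * G" by (simp add: G_def)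
      finally show ?thesis .
    qed
    then show "AE y in lborel. norm (f y * I y) \<le> cmod (f y) * (sqrt pi * \<bar>\<tau>\<bar> powr (- 1/2) * G)"
      by (intro AE_I2) (simp add: norm_mult mult_left_mono)
  qed
  also have "\<dots> = sqrt pi * \<bar>\<tau>\<bar> powr (- 1/2) * F * G" by (simp add: F_def)
  finally show ?thesis by (simp add: F_def G_def)
qed

lemma weight_integral:
  fixes T :: real
  assumes "T \<ge> 1"
  shows "integrable lborel (\<lambda>s. indicator {T<..} s * s powr (- 5/2))"
    and "(LINT s|lborel. indicator {T<..} s * s powr (- 5/2)) = 2/3 * T powr (- 3/2)"
  using powr_tail_integral_open[of "- 5/2" T] assms by (auto simp: mult.commute)

text \<open>
  Where \<open>|s - r| \<le> T\<close>, the power of \<open>r > T\<close> is bounded by its value at \<open>T\<close> and the singularity is integrated; elsewhere the singular factor is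
  at most \<open>T\<^sup>-\<^sup>1\<^sup>/\<^sup>2\<close>. The three contributions are all of order \<open>T\<^sup>-\<^sup>2\<close>: \<open>4\<close> from the two
  sides of the singularity and \<open>2/3\<close> from the rest.
\<close>

lemma singular_weight_integral:
  fixes T :: real
  assumes T: "T \<ge> 1"
  shows "\<exists>M. integrable lborel M \<and> (LINT r|lborel. M r) = 14/3 * T powr (- 2) \<and>
    (\<forall>r. r \<noteq> s \<longrightarrow> indicator {T<..} r * r powr (- 5/2) * \<bar>s - r\<bar> powr (- 1/2) \<le> M r)"
proof -
  define L where "L r = indicator {s - T..s} r * (s - r) powr (- 1/2)" for r
  define R where "R r = indicator {s..s + T} r * (r - s) powr (- 1/2)" for r
  define V where "V r = indicator {T<..} r * r powr (- 5/2)" for r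
  define M where "M r = T powr (- 5/2) * (L r + R r) + T powr (- 1/2) * V r" for r
  have L: "has_bochner_integral lborel L (2 * sqrt T)" and R: "has_bochner_integral lborel R (2 * sqrt T)"
    unfolding L_def[abs_def] R_def[abs_def]
    by (rule inverse_sqrt_integral_left inverse_sqrt_integral_right, use T in simp)+
  have V: "integrable lborel V" "(LINT r|lborel. V r) = 2/3 * T powr (- 3/2)"
    unfolding V_def[abs_def] using weight_integral[OF T] by auto
  have "integrable lborel M"
    unfolding M_def[abs_def] using L R V by (auto simp: has_bochner_integral_iff)
  moreover have "(LINT r|lborel. M r) = T powr (- 5/2) * (4 * sqrt T) + T powr (- 1/2) * (2/3 * T powr (- 3/2))"
    unfolding M_def[abs_def] using L R V by (simp add: has_bochner_integral_iff)
  moreover have "T powr (- 5/2) * sqrt T = T powr (- 2)" "T powr (- 1/2) * T powr (- 3/2) = T powr (- 2)"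
    using T by (simp_all flip: powr_half_sqrt powr_add)
  moreover have "indicator {T<..} r * r powr (- 5/2) * \<bar>s - r\<bar> powr (- 1/2) \<le> M r" if "r \<noteq> s" for r
  proof (cases "r > T")
    case True
    have nn: "L r \<ge> 0" "R r \<ge> 0" "V r \<ge> 0" by (auto simp: L_def R_def V_def)
    show ?thesis
    proof (cases "\<bar>s - r\<bar> \<le> T")
      case le: True
      have "\<bar>s - r\<bar> powr (- 1/2) \<le> L r + R r"
      proof (cases "r < s")
        case True
        then have "L r = \<bar>s - r\<bar> powr (- 1/2)" using le by (auto simp: L_def)
        then show ?thesis using nn by simp
      next
        case False
        then have "R r = \<bar>s - r\<bar> powr (- 1/2)" using le by (auto simp: R_def)
        then show ?thesis using nn by simp
      qed
      moreover have "r powr (- 5/2) \<le> T powr (- 5/2)" using True T by (intro powr_mono2') auto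
      ultimately have "r powr (- 5/2) * \<bar>s - r\<bar> powr (- 1/2) \<le> T powr (- 5/2) * (L r + R r)"
        by (intro mult_mono) auto
      then show ?thesis using True nn by (simp add: M_def add_increasing2)
    next
      case False
      then have "\<bar>s - r\<bar> powr (- 1/2) \<le> T powr (- 1/2)" using T by (intro powr_mono2') auto
      then have "V r * \<bar>s - r\<bar> powr (- 1/2) \<le> T powr (- 1/2) * V r"
        using nn(3) by (metis mult.commute mult_left_mono)
      then show ?thesis using nn by (simp add: M_def V_def add_increasing)
    qed
  qed (simp add: M_def L_def R_def V_def)
  ultimately show ?thesis
    by (intro exI[of _ M] conjI) (auto simp: mult.left_commute mult.commute)
qed

text \<open>
  The decay rate \<open>s\<^sup>-\<^sup>5\<^sup>/\<^sup>2\<close> is that of the fifth power of a function of size \<open>s\<^sup>-\<^sup>1\<^sup>/\<^sup>2\<close>, multiplied by an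
  integrable potential.
\<close>

locale decaying_L1_path =
  fixes Q :: "real \<Rightarrow> real \<Rightarrow> complex" and b :: real
  assumes path: "L1_path Q"
    and decay: "\<And>s. s \<ge> 1 \<Longrightarrow> (LINT y|lborel. cmod (Q s y)) \<le> b * s powr (- 5/2)"
begin

lemma b_nonneg: "b \<ge> 0"
proof -
  have "0 \<le> (LINT y|lborel. cmod (Q 1 y))" by simp
  also have "\<dots> \<le> b" using decay[of 1] by simp
  finally show ?thesis .
qed

lemma integrand_bound: "s \<ge> 1 \<Longrightarrow> cmod (cis (s * \<zeta>\<^sup>2) * fourier (Q s) \<zeta>) \<le> b * s powr (- 5/2)"
  using fourier_bound[OF L1_path_integrable[OF path], of s \<zeta>] decay[of s] by (simp add: norm_mult)

lemma integrand_continuous: "continuous_on ({1..} \<times> UNIV) (\<lambda>(s, \<zeta>). cis (s * \<zeta>\<^sup>2) * fourier (Q s) \<zeta>)"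
  using L1_path_fourier_continuous[OF path] unfolding split_beta by (intro continuous_intros)

lemma integrand_measurable:
  assumes "T \<ge> 1"
  shows "(\<lambda>s. indicator {T<..} s *\<^sub>R (cis (s * \<zeta>\<^sup>2) * fourier (Q s) \<zeta>)) \<in> borel_measurable borel"
proof -
  have "continuous_on {T<..} (\<lambda>s. case (s, \<zeta>) of (s, \<zeta>) \<Rightarrow> cis (s * \<zeta>\<^sup>2) * fourier (Q s) \<zeta>)"
    by (rule continuous_on_compose2[OF integrand_continuous, of _ "\<lambda>s. (s, \<zeta>)"])
       (use assms in \<open>auto intro!: continuous_intros\<close>)
  then show ?thesis by (intro borel_measurable_continuous_on_indicator) auto
qed

lemma integrand_integrable:
  assumes "T \<ge> 1"
  shows "set_integrable lborel {T<..} (\<lambda>s. cis (s * \<zeta>\<^sup>2) * fourier (Q s) \<zeta>)"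
  unfolding set_integrable_def
proof (rule Bochner_Integration.integrable_bound)
  show "integrable lborel (\<lambda>s. b * (indicator {T<..} s * s powr (- 5/2)))"
    using weight_integral(1)[OF assms] by simp
  show "AE s in lborel. norm (indicator {T<..} s *\<^sub>R (cis (s * \<zeta>\<^sup>2) * fourier (Q s) \<zeta>))
      \<le> norm (b * (indicator {T<..} s * s powr (- 5/2)))"
    using integrand_bound b_nonneg assms by (intro AE_I2) (auto simp: indicator_def abs_mult)
qed (use integrand_measurable[OF assms] in simp)

lemma oscillatory_tail_bound:
  assumes "T \<ge> 1"
  shows "cmod (oscillatory_tail Q T \<zeta>) \<le> 2/3 * b * T powr (- 3/2)"
proof -
  have "cmod (oscillatory_tail Q T \<zeta>) \<le> (LINT s|lborel. b * (indicator {T<..} s * s powr (- 5/2)))"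
    unfolding oscillatory_tail_def set_lebesgue_integral_def
  proof (rule norm_integral_le_majorant)
    show "integrable lborel (\<lambda>s. b * (indicator {T<..} s * s powr (- 5/2)))"
      using weight_integral(1)[OF assms] by simp
    show "AE s in lborel. norm (indicator {T<..} s *\<^sub>R (cis (s * \<zeta>\<^sup>2) * fourier (Q s) \<zeta>))
      \<le> b * (indicator {T<..} s * s powr (- 5/2))"
      using integrand_bound b_nonneg assms by (intro AE_I2) (auto simp: indicator_def)
  qed
  also have "\<dots> = 2/3 * b * T powr (- 3/2)" using weight_integral(2)[OF assms] by simp
  finally show ?thesis .
qed

text \<open>
  The \<open>TT*\<close> argument: one factor of the square is expanded as an integral over \<open>s\<close>, then the other over \<open>r\<close>,
  and each pair of times is estimated by \<open>dispersive_pairing_bound\<close>. The Gaussian weight makes the integral in \<open>\<zeta>\<close> converge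
  absolutely, and the bound is uniform in \<open>\<kappa>\<close>.
\<close>

lemma oscillatory_tail_Gaussian_L2:
  assumes T: "T \<ge> 1" and \<kappa>: "\<kappa> > 0"
  shows "oscillatory_tail Q T \<in> borel_measurable borel"
    and "(LINT \<zeta>|lborel. exp (- \<kappa> * \<zeta>\<^sup>2) * (cmod (oscillatory_tail Q T \<zeta>))\<^sup>2) \<le> 9 * b\<^sup>2 * T powr (- 7/2)"
proof -
  define v where "v s = complex_of_real (indicator {T<..} s * s powr (- 5/2))" for s
  \<comment> \<open>The decay is moved from the integrand to the weight \<open>v\<close>, so that \<open>k\<close> is bounded by \<open>b\<close>.\<close>
  define k where "k \<zeta> s = complex_of_real (indicator {T<..} s * s powr (5/2)) * (cis (s * \<zeta>\<^sup>2) * fourier (Q s) \<zeta>)" for \<zeta> s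
  define G where "G = oscillatory_tail Q T"
  define e where "e \<zeta> = complex_of_real (exp (- \<kappa> * \<zeta>\<^sup>2))" for \<zeta>
  have ie0: "integrable lborel (\<lambda>\<zeta>. exp (- \<kappa> * \<zeta>\<^sup>2))" by (rule Fourier_Gaussian_real(1)[OF \<kappa>])
  have [measurable]: "e \<in> borel_measurable borel" unfolding e_def[abs_def] by measurable
  have iv: "integrable lborel v"
    unfolding v_def[abs_def] by (rule integrable_of_real[OF weight_integral(1)[OF T]])
  then have [measurable]: "v \<in> borel_measurable borel" by auto
  have pw: "s powr (5/2) * s powr (- 5/2) = 1" if "s > T" for s
    using that T by (simp flip: powr_add)
  have kbd: "cmod (k \<zeta> s) \<le> b" for \<zeta> s
  proof (cases "s > T")
    case True
    then have "cmod (k \<zeta> s) \<le> s powr (5/2) * (b * s powr (- 5/2))"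
      using integrand_bound[of s \<zeta>] T by (simp add: k_def norm_mult[of "complex_of_real _"] del: norm_cis norm_mult)
    also have "\<dots> = b" using pw[OF True] by (simp add: mult.left_commute)
    finally show ?thesis .
  qed (use b_nonneg in \<open>simp add: k_def\<close>)
  have km: "(\<lambda>(\<zeta>, s). k \<zeta> s) \<in> borel_measurable borel"
  proof -
    have "(\<lambda>p. indicator ({T<..} \<times> UNIV) p *\<^sub>R (case p of (s, \<zeta>) \<Rightarrow> cis (s * \<zeta>\<^sup>2) * fourier (Q s) \<zeta>)) \<in> borel_measurable borel"
      by (rule borel_measurable_continuous_on_indicator[OF _ continuous_on_subset[OF integrand_continuous]])
         (use T in \<open>auto intro!: borel_Times\<close>)
    moreover have "(\<lambda>(\<zeta>, s). (s, \<zeta>)) \<in> (borel :: (real \<times> real) measure) \<rightarrow>\<^sub>M borel"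
      unfolding split_beta by (intro borel_measurable_continuous_onI continuous_intros)
    ultimately have 1: "(\<lambda>q. case q of (\<zeta>, s) \<Rightarrow> indicator ({T<..} \<times> UNIV) (s, \<zeta>) *\<^sub>R (cis (s * \<zeta>\<^sup>2) * fourier (Q s) \<zeta>)) \<in> borel_measurable borel"
      by (auto dest: measurable_compose[rotated] simp: split_beta)
    have 2: "(\<lambda>q :: real \<times> real. complex_of_real ((snd q) powr (5/2))) \<in> borel_measurable borel"
      unfolding borel_prod[symmetric] by measurable
    from borel_measurable_times[OF 2 1] show ?thesis
      by (rule measurable_cong[THEN iffD1, rotated]) (auto simp: k_def indicator_def split_beta)
  qed
  then have km' [measurable]: "(\<lambda>(\<zeta>, s). k \<zeta> s) \<in> borel_measurable (borel \<Otimes>\<^sub>M borel)"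
    by (simp add: borel_prod)
  have km1 [measurable]: "(\<lambda>\<zeta>. k \<zeta> s) \<in> borel_measurable borel" for s
    using measurable_compose_Pair1 measurable_Pair2[OF km', of s] by simp
  have G: "G \<zeta> = (LINT s|lborel. v s * k \<zeta> s)" for \<zeta>
    unfolding G_def oscillatory_tail_def set_lebesgue_integral_def
  proof (rule Bochner_Integration.integral_cong[OF refl])
    fix s
    have "s > T \<Longrightarrow> complex_of_real (s powr (- 5/2)) * complex_of_real (s powr (5/2)) = 1"
      using pw[of s] by (metis mult.commute of_real_1 of_real_mult)
    then show "indicator {T<..} s *\<^sub>R (cis (s * \<zeta>\<^sup>2) * fourier (Q s) \<zeta>) = v s * k \<zeta> s"
      by (cases "s > T") (simp_all add: v_def k_def flip: mult.assoc)
  qed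
  have Gm [measurable]: "G \<in> borel_measurable borel"
    unfolding G[abs_def] by (rule lborel.borel_measurable_lebesgue_integral) measurable
  then show "oscillatory_tail Q T \<in> borel_measurable borel" by (simp add: G_def)
  define g where "g = 2/3 * b * T powr (- 3/2)"
  have Gbd: "cmod (G \<zeta>) \<le> g" for \<zeta> unfolding G_def g_def by (rule oscillatory_tail_bound[OF T])
  have g: "g \<ge> 0" using b_nonneg by (simp add: g_def)
  have ie: "integrable lborel (\<lambda>\<zeta>. e \<zeta> * h \<zeta>)"
    if [measurable]: "h \<in> borel_measurable borel" and "\<And>\<zeta>. cmod (h \<zeta>) \<le> c" for h c
  proof (rule Bochner_Integration.integrable_bound)
    show "integrable lborel (\<lambda>\<zeta>. c * exp (- \<kappa> * \<zeta>\<^sup>2))" using ie0 by simp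
    show "AE \<zeta> in lborel. norm (e \<zeta> * h \<zeta>) \<le> norm (c * exp (- \<kappa> * \<zeta>\<^sup>2))"
    proof (rule AE_I2)
      fix \<zeta>
      have "cmod (h \<zeta>) \<le> \<bar>c\<bar>" using that(2)[of \<zeta>] by linarith
      then show "norm (e \<zeta> * h \<zeta>) \<le> norm (c * exp (- \<kappa> * \<zeta>\<^sup>2))"
        by (simp add: e_def norm_mult abs_mult mult.commute mult_left_mono)
    qed
  qed measurable
  define S where "S = sqrt pi * b\<^sup>2 * (14/3 * T powr (- 2))"
  have inner: "cmod (LINT \<zeta>|lborel. (e \<zeta> * cnj (G \<zeta>)) * k \<zeta> s) \<le> S" for s
  proof -
    have cG: "cnj (G \<zeta>) = (LINT r|lborel. v r * cnj (k \<zeta> r))" for \<zeta>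
      unfolding G Bochner_Integration.integral_cnj[symmetric]
      by (rule Bochner_Integration.integral_cong[OF refl]) (simp add: v_def)
    have "(LINT \<zeta>|lborel. (e \<zeta> * cnj (G \<zeta>)) * k \<zeta> s)
        = (LINT \<zeta>|lborel. (e \<zeta> * k \<zeta> s) * (LINT r|lborel. v r * cnj (k \<zeta> r)))"
      unfolding cG by (simp only: mult_ac)
    also have "\<dots> = (LINT r|lborel. v r * (LINT \<zeta>|lborel. (e \<zeta> * k \<zeta> s) * cnj (k \<zeta> r)))"
    proof (rule kernel_exchange[OF _ iv])
      show "integrable lborel (\<lambda>\<zeta>. e \<zeta> * k \<zeta> s)" by (rule ie[OF km1 kbd])
      show "(\<lambda>(\<zeta>, r). cnj (k \<zeta> r)) \<in> borel_measurable borel"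
        using measurable_compose[OF km cnj_measurable] by (simp add: split_beta)
      show "cmod (cnj (k \<zeta> r)) \<le> b" for \<zeta> r using kbd by simp
    qed
    also have "cmod \<dots> \<le> S"
    proof -
      obtain M where M: "integrable lborel M" "(LINT r|lborel. M r) = 14/3 * T powr (- 2)"
        "\<And>r. r \<noteq> s \<Longrightarrow> indicator {T<..} r * r powr (- 5/2) * \<bar>s - r\<bar> powr (- 1/2) \<le> M r"
        using singular_weight_integral[OF T, of s] by blast
      have "cmod (LINT r|lborel. v r * (LINT \<zeta>|lborel. (e \<zeta> * k \<zeta> s) * cnj (k \<zeta> r)))
         \<le> (LINT r|lborel. sqrt pi * b\<^sup>2 * M r)"
      proof (rule norm_integral_le_majorant)
        show "integrable lborel (\<lambda>r. sqrt pi * b\<^sup>2 * M r)" using M(1) by simp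
        show "AE r in lborel. norm (v r * (LINT \<zeta>|lborel. (e \<zeta> * k \<zeta> s) * cnj (k \<zeta> r))) \<le> sqrt pi * b\<^sup>2 * M r"
          using AE_lborel_singleton[of s]
        proof eventually_elim
          fix r assume rs: "r \<noteq> s"
          have Mr: "sqrt pi * b\<^sup>2 * (indicator {T<..} r * r powr (- 5/2) * \<bar>s - r\<bar> powr (- 1/2)) \<le> sqrt pi * b\<^sup>2 * M r"
            using M(3)[OF rs] by (intro mult_left_mono) auto
          show "norm (v r * (LINT \<zeta>|lborel. (e \<zeta> * k \<zeta> s) * cnj (k \<zeta> r))) \<le> sqrt pi * b\<^sup>2 * M r"
          proof (cases "s > T \<and> r > T")
            case True
            then have s: "s \<ge> 1" "r \<ge> 1" using T by auto
            have "(e \<zeta> * k \<zeta> s) * cnj (k \<zeta> r) = of_real (s powr (5/2) * r powr (5/2)) *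
               (of_real (exp (- \<kappa> * \<zeta>\<^sup>2)) * cis ((s - r) * \<zeta>\<^sup>2) * fourier (Q s) \<zeta> * cnj (fourier (Q r) \<zeta>))" for \<zeta>
            proof -
              have "cis ((s - r) * \<zeta>\<^sup>2) = cis (s * \<zeta>\<^sup>2) * cnj (cis (r * \<zeta>\<^sup>2))"
                by (simp add: cis_cnj cis_mult left_diff_distrib)
              then show ?thesis using True by (simp add: e_def k_def mult_ac)
            qed
            then have "cmod (LINT \<zeta>|lborel. (e \<zeta> * k \<zeta> s) * cnj (k \<zeta> r)) = s powr (5/2) * r powr (5/2) *
               cmod (LINT \<zeta>|lborel. of_real (exp (- \<kappa> * \<zeta>\<^sup>2)) * cis ((s - r) * \<zeta>\<^sup>2) * fourier (Q s) \<zeta> * cnj (fourier (Q r) \<zeta>))"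
              by (simp add: norm_mult)
            also have "\<dots> \<le> s powr (5/2) * r powr (5/2) *
               (sqrt pi * \<bar>s - r\<bar> powr (- 1/2) * (LINT x|lborel. cmod (Q s x)) * (LINT x|lborel. cmod (Q r x)))"
              by (intro mult_left_mono dispersive_pairing_bound L1_path_integrable[OF path] \<kappa>) (use s rs in auto)
            also have "\<dots> \<le> s powr (5/2) * r powr (5/2) *
               (sqrt pi * \<bar>s - r\<bar> powr (- 1/2) * (b * s powr (- 5/2)) * (b * r powr (- 5/2)))"
              using b_nonneg by (intro mult_left_mono mult_mono decay s) auto
            also have "\<dots> = sqrt pi * \<bar>s - r\<bar> powr (- 1/2) * b\<^sup>2 * (s powr (5/2) * s powr (- 5/2)) * (r powr (5/2) * r powr (- 5/2))"
              by (simp only: power2_eq_square mult_ac)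
            also have "\<dots> = sqrt pi * \<bar>s - r\<bar> powr (- 1/2) * b\<^sup>2" using pw True by simp
            finally have "cmod (v r) * cmod (LINT \<zeta>|lborel. (e \<zeta> * k \<zeta> s) * cnj (k \<zeta> r))
                \<le> r powr (- 5/2) * (sqrt pi * \<bar>s - r\<bar> powr (- 1/2) * b\<^sup>2)"
              using True by (simp add: v_def mult_left_mono)
            also have "\<dots> = sqrt pi * b\<^sup>2 * (indicator {T<..} r * r powr (- 5/2) * \<bar>s - r\<bar> powr (- 1/2))"
              using True by simp
            also note Mr
            finally show ?thesis by (simp only: norm_mult)
          next
            case False
            then have "v r * (LINT \<zeta>|lborel. (e \<zeta> * k \<zeta> s) * cnj (k \<zeta> r)) = 0"
              by (auto simp: v_def k_def)
            moreover have "0 \<le> sqrt pi * b\<^sup>2 * (indicator {T<..} r * r powr (- 5/2) * \<bar>s - r\<bar> powr (- 1/2))"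
              by simp
            ultimately show ?thesis using Mr by (simp only: norm_zero)
          qed
        qed
      qed
      also have "\<dots> = S" using M(2) by (simp add: S_def)
      finally show ?thesis .
    qed
    finally show ?thesis .
  qed
  have "of_real (LINT \<zeta>|lborel. exp (- \<kappa> * \<zeta>\<^sup>2) * (cmod (G \<zeta>))\<^sup>2)
      = (LINT \<zeta>|lborel. complex_of_real (exp (- \<kappa> * \<zeta>\<^sup>2) * (cmod (G \<zeta>))\<^sup>2))"
    by (rule integral_complex_of_real[symmetric])
  also have "\<dots> = (LINT \<zeta>|lborel. (e \<zeta> * cnj (G \<zeta>)) * (LINT s|lborel. v s * k \<zeta> s))"
    unfolding G[symmetric] by (simp only: of_real_mult complex_norm_square e_def mult_ac)
  also have "\<dots> = (LINT s|lborel. v s * (LINT \<zeta>|lborel. (e \<zeta> * cnj (G \<zeta>)) * k \<zeta> s))"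
  proof (rule kernel_exchange[OF _ iv km kbd])
    show "integrable lborel (\<lambda>\<zeta>. e \<zeta> * cnj (G \<zeta>))" by (rule ie[of _ g]) (use Gbd in auto)
  qed
  finally have eq: "of_real (LINT \<zeta>|lborel. exp (- \<kappa> * \<zeta>\<^sup>2) * (cmod (G \<zeta>))\<^sup>2)
      = (LINT s|lborel. v s * (LINT \<zeta>|lborel. (e \<zeta> * cnj (G \<zeta>)) * k \<zeta> s))" .
  have "(LINT \<zeta>|lborel. exp (- \<kappa> * \<zeta>\<^sup>2) * (cmod (G \<zeta>))\<^sup>2)
      \<le> cmod (of_real (LINT \<zeta>|lborel. exp (- \<kappa> * \<zeta>\<^sup>2) * (cmod (G \<zeta>))\<^sup>2))" by simp
  also have "\<dots> \<le> (LINT s|lborel. S * (indicator {T<..} s * s powr (- 5/2)))"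
    unfolding eq
  proof (rule norm_integral_le_majorant)
    show "integrable lborel (\<lambda>s. S * (indicator {T<..} s * s powr (- 5/2)))"
      using weight_integral(1)[OF T] by simp
    show "AE s in lborel. norm (v s * (LINT \<zeta>|lborel. (e \<zeta> * cnj (G \<zeta>)) * k \<zeta> s)) \<le> S * (indicator {T<..} s * s powr (- 5/2))"
    proof (rule AE_I2)
      fix s
      have "cmod (v s) * cmod (LINT \<zeta>|lborel. (e \<zeta> * cnj (G \<zeta>)) * k \<zeta> s) \<le> cmod (v s) * S"
        by (rule mult_left_mono[OF inner]) simp
      moreover have "cmod (v s) = indicator {T<..} s * s powr (- 5/2)" by (cases "s > T") (auto simp: v_def)
      ultimately show "norm (v s * (LINT \<zeta>|lborel. (e \<zeta> * cnj (G \<zeta>)) * k \<zeta> s)) \<le> S * (indicator {T<..} s * s powr (- 5/2))"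
        by (simp only: norm_mult mult.commute)
    qed
  qed
  also have "\<dots> = (28/9 * sqrt pi) * b\<^sup>2 * (T powr (- 2) * T powr (- 3/2))"
    using weight_integral(2)[OF T] by (simp add: S_def)
  also have "T powr (- 2) * T powr (- 3/2) = T powr (- 7/2)" by (simp flip: powr_add)
  also have "(28/9 * sqrt pi) * b\<^sup>2 * T powr (- 7/2) \<le> 9 * b\<^sup>2 * T powr (- 7/2)"
  proof (intro mult_right_mono)
    have "sqrt pi \<le> sqrt 4" using pi_less_4 by (intro real_sqrt_le_mono) simp
    then show "28/9 * sqrt pi \<le> 9" by simp
  qed auto
  finally show "(LINT \<zeta>|lborel. exp (- \<kappa> * \<zeta>\<^sup>2) * (cmod (oscillatory_tail Q T \<zeta>))\<^sup>2) \<le> 9 * b\<^sup>2 * T powr (- 7/2)"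
    by (simp add: G_def)
qed

text \<open>
  Dominated convergence as the Gaussian weight tends to \<open>1\<close>.
\<close>

lemma oscillatory_tail_L2:
  assumes T: "T \<ge> 1" and L2: "oscillatory_tail Q T \<in> L2"
  shows "L2_norm (oscillatory_tail Q T) \<le> 3 * b * T powr (- 7/4)"
proof -
  define G where "G = oscillatory_tail Q T"
  have iG: "integrable lborel (\<lambda>\<zeta>. (cmod (G \<zeta>))\<^sup>2)" using L2 by (simp add: L2_def G_def)
  have [measurable]: "G \<in> borel_measurable borel" using L2 by (simp add: L2_def G_def)
  have "(\<lambda>n. LINT \<zeta>|lborel. exp (- inverse (real (Suc n)) * \<zeta>\<^sup>2) * (cmod (G \<zeta>))\<^sup>2) \<longlonglongrightarrow> (LINT \<zeta>|lborel. exp (- 0 * \<zeta>\<^sup>2) * (cmod (G \<zeta>))\<^sup>2)"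
  proof (rule integral_dominated_convergence[OF _ _ iG])
    show "AE \<zeta> in lborel. (\<lambda>n. exp (- inverse (real (Suc n)) * \<zeta>\<^sup>2) * (cmod (G \<zeta>))\<^sup>2) \<longlonglongrightarrow> exp (- 0 * \<zeta>\<^sup>2) * (cmod (G \<zeta>))\<^sup>2"
      by (intro AE_I2 tendsto_intros LIMSEQ_inverse_real_of_nat)
    show "AE \<zeta> in lborel. norm (exp (- inverse (real (Suc n)) * \<zeta>\<^sup>2) * (cmod (G \<zeta>))\<^sup>2) \<le> (cmod (G \<zeta>))\<^sup>2" for n
      by (intro AE_I2) (simp add: abs_mult mult_left_le_one_le)
  qed measurable
  then have "(LINT \<zeta>|lborel. exp (- 0 * \<zeta>\<^sup>2) * (cmod (G \<zeta>))\<^sup>2) \<le> 9 * b\<^sup>2 * T powr (- 7/2)"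
    by (rule LIMSEQ_le_const2) (use oscillatory_tail_Gaussian_L2(2)[OF T] in \<open>auto simp: G_def\<close>)
  moreover have "(T powr (- 7/4))\<^sup>2 = T powr (- 7/2)"
    by (simp add: power2_eq_square flip: powr_add)
  ultimately have "(LINT \<zeta>|lborel. (cmod (G \<zeta>))\<^sup>2) \<le> (3 * b * T powr (- 7/4))\<^sup>2"
    by (simp add: power_mult_distrib)
  then have "sqrt (LINT \<zeta>|lborel. (cmod (G \<zeta>))\<^sup>2) \<le> sqrt ((3 * b * T powr (- 7/4))\<^sup>2)"
    by (rule real_sqrt_le_mono)
  also have "\<dots> = 3 * b * T powr (- 7/4)" using b_nonneg by (subst real_sqrt_abs) simp
  finally show ?thesis by (simp add: L2_norm_def G_def)
qed

end

section \<open>The renormalized profile of a decaying solution\<close>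

lemma power_nonlinearity_bound:
  assumes "cmod z \<le> M"
  shows "cmod (of_real (cmod z ^ k) * z) \<le> M ^ Suc k"
  using power_mono[OF assms, of "Suc k"] by (simp add: norm_mult norm_power mult.commute)

lemma power_nonlinearity_Lipschitz:
  fixes z w :: complex
  assumes z: "cmod z \<le> M" and w: "cmod w \<le> M"
  shows "cmod (of_real (cmod z ^ k) * z - of_real (cmod w ^ k) * w) \<le> (real k + 1) * M ^ k * cmod (z - w)"
proof (induction k)
  case (Suc k)
  have M: "M \<ge> 0" using z norm_ge_zero[of z] by linarith
  define a b where "a = of_real (cmod z ^ k) * z" and "b = of_real (cmod w ^ k) * w"
  have "of_real (cmod z ^ Suc k) * z - of_real (cmod w ^ Suc k) * w
      = of_real (cmod z) * (a - b) + of_real (cmod z - cmod w) * b"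
    by (simp add: a_def b_def algebra_simps)
  also have "cmod \<dots> \<le> cmod z * cmod (a - b) + \<bar>cmod z - cmod w\<bar> * cmod b"
    by (rule order_trans[OF norm_triangle_ineq]) (simp add: norm_mult flip: of_real_diff)
  also have "\<dots> \<le> M * ((real k + 1) * M ^ k * cmod (z - w)) + cmod (z - w) * M ^ Suc k"
    using Suc.IH power_nonlinearity_bound[OF w, of k] norm_triangle_ineq3[of z w] z M
    by (intro add_mono mult_mono) (auto simp: a_def b_def)
  also have "\<dots> = (real (Suc k) + 1) * M ^ Suc k * cmod (z - w)"
    by (simp add: algebra_simps)
  finally show ?case .
qed simp

lemma Sigma_path_L1_path:
  assumes "continuous_in_Sigma u"
  shows "L1_path u"
proof -
  have S: "u t \<in> L2" "(\<lambda>x. of_real x * u t x) \<in> L2" if "t \<ge> 1" for t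
    using assms that by (auto simp: continuous_in_Sigma_def Sigma_space_def H1_def)
  define J where "J = sqrt (LINT x|lborel. japanese x powr (- 2))"
  have J: "J \<ge> 0" by (simp add: J_def)
  have bd: "(LINT y|lborel. cmod (u s y - u t y)) \<le> J * Sigma_norm (\<lambda>y. u s y - u t y)"
    if "s \<ge> 1" "t \<ge> 1" for s t
  proof -
    have 1: "(\<lambda>y. u s y - u t y) \<in> L2" by (intro L2_diff S that)
    have 2: "(\<lambda>x. of_real x * (u s x - u t x)) \<in> L2"
      using L2_diff[OF S(2)[OF that(1)] S(2)[OF that(2)]] by (simp add: right_diff_distrib)
    have "L2_norm (\<lambda>y. u s y - u t y) \<le> H1_norm (\<lambda>y. u s y - u t y)"
      unfolding H1_norm_def by (rule real_le_rsqrt) simp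
    then have "J * (L2_norm (\<lambda>y. u s y - u t y) + L2_norm (\<lambda>x. of_real x * (u s x - u t x))) \<le> J * Sigma_norm (\<lambda>y. u s y - u t y)"
      using J by (intro mult_left_mono) (auto simp: Sigma_norm_def)
    then show ?thesis using weighted_L2_imp_L1(2)[OF 1 2] unfolding J_def by linarith
  qed
  show ?thesis
    unfolding L1_path_def
  proof (intro conjI allI impI)
    fix t :: real assume t: "t \<ge> 1"
    show "integrable lborel (u t)" using weighted_L2_imp_L1(1) S t by blast
    have "((\<lambda>s. J * Sigma_norm (\<lambda>y. u s y - u t y)) \<longlongrightarrow> J * 0) (at t within {1..})"
      using assms t by (intro tendsto_intros) (auto simp: continuous_in_Sigma_def)
    then have "((\<lambda>s. J * Sigma_norm (\<lambda>y. u s y - u t y)) \<longlongrightarrow> 0) (at t within {1..})" by simp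
    moreover have "\<forall>\<^sub>F s in at t within {1..}. norm (LINT y|lborel. cmod (u s y - u t y)) \<le> J * Sigma_norm (\<lambda>y. u s y - u t y)"
      unfolding eventually_at using bd t by (intro exI[of _ 1]) auto
    ultimately show "((\<lambda>r. LINT y|lborel. cmod (u r y - u t y)) \<longlongrightarrow> 0) (at t within {1..})"
      by (rule Lim_null_comparison[rotated])
  qed
qed

text \<open>
  Covers the cubic term (\<open>c = 1\<close>, \<open>k = 2\<close>) and the localized quintic term (\<open>k = 4\<close>) at once. On bounded functions the
  power is Lipschitz, and the potential is Lipschitz in time because its derivative is bounded.
\<close>

lemma L1_path_power_nonlinearity:
  fixes c :: "real \<Rightarrow> real \<Rightarrow> real"
  assumes u: "L1_path u" and M: "\<And>s. s \<ge> 1 \<Longrightarrow> AE y in lborel. cmod (u s y) \<le> M"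
    and cm: "\<And>s. c s \<in> borel_measurable borel" and cb: "\<And>s y. \<bar>c s y\<bar> \<le> B"
    and cl: "\<And>s r y. \<bar>c s y - c r y\<bar> \<le> L * \<bar>s - r\<bar>"
  shows "L1_path (\<lambda>s y. of_real (c s y * cmod (u s y) ^ k) * u s y)"
proof -
  have iu: "integrable lborel (u s)" if "s \<ge> 1" for s using L1_path_integrable[OF u that] .
  have B: "B \<ge> 0" using cb[of 0 0] by linarith
  define F where "F s y = of_real (cmod (u s y) ^ k) * u s y" for s y
  define Q where "Q s y = of_real (c s y) * F s y" for s y
  have M0: "M \<ge> 0"
  proof -
    have "AE y::real in lborel. M \<ge> 0"
      using M[of 1] by (auto elim!: eventually_mono intro: order_trans[OF norm_ge_zero])
    then show ?thesis by (auto simp: ae_filter_eq_bot_iff)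
  qed
  have Fb: "AE y in lborel. cmod (F s y) \<le> M ^ k * cmod (u s y)" if "s \<ge> 1" for s
    using M[OF that] by eventually_elim (simp add: F_def norm_mult norm_power mult_right_mono power_mono)
  have iQ: "integrable lborel (Q s)" if "s \<ge> 1" for s
  proof (rule Bochner_Integration.integrable_bound)
    show "integrable lborel (\<lambda>y. B * (M ^ k * cmod (u s y)))" using iu[OF that] by simp
    have [measurable]: "u s \<in> borel_measurable borel" "c s \<in> borel_measurable borel" using iu[OF that] cm by auto
    show "Q s \<in> borel_measurable lborel" unfolding Q_def[abs_def] F_def by measurable
    show "AE y in lborel. norm (Q s y) \<le> norm (B * (M ^ k * cmod (u s y)))"
      using Fb[OF that]
    proof eventually_elim
      case (elim y)
      then have "\<bar>c s y\<bar> * cmod (F s y) \<le> B * (M ^ k * cmod (u s y))"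
        by (intro mult_mono cb B) auto
      then show ?case by (simp add: Q_def norm_mult)
    qed
  qed
  have "((\<lambda>r. LINT y|lborel. cmod (Q r y - Q s y)) \<longlongrightarrow> 0) (at s within {1..})" if s: "s \<ge> 1" for s
  proof -
    define I where "I = (LINT y|lborel. cmod (u s y))"
    have "((\<lambda>r. B * ((real k + 1) * M ^ k) * (LINT y|lborel. cmod (u r y - u s y)) + L * \<bar>r - s\<bar> * (M ^ k * I))
      \<longlongrightarrow> B * ((real k + 1) * M ^ k) * 0 + L * \<bar>s - s\<bar> * (M ^ k * I)) (at s within {1..})"
      using u s by (intro tendsto_intros) (auto simp: L1_path_def)
    then have "((\<lambda>r. B * ((real k + 1) * M ^ k) * (LINT y|lborel. cmod (u r y - u s y)) + L * \<bar>r - s\<bar> * (M ^ k * I))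
      \<longlongrightarrow> 0) (at s within {1..})" by simp
    moreover have "norm (LINT y|lborel. cmod (Q r y - Q s y))
       \<le> B * ((real k + 1) * M ^ k) * (LINT y|lborel. cmod (u r y - u s y)) + L * \<bar>r - s\<bar> * (M ^ k * I)" if r: "r \<ge> 1" for r
    proof -
      have "norm (LINT y|lborel. cmod (Q r y - Q s y))
        \<le> (LINT y|lborel. B * ((real k + 1) * M ^ k) * cmod (u r y - u s y) + L * \<bar>r - s\<bar> * (M ^ k * cmod (u s y)))"
      proof (rule norm_integral_le_majorant)
        show "integrable lborel (\<lambda>y. B * ((real k + 1) * M ^ k) * cmod (u r y - u s y) + L * \<bar>r - s\<bar> * (M ^ k * cmod (u s y)))"
          using iu[OF r] iu[OF s] by simp
        show "AE y in lborel. norm (cmod (Q r y - Q s y))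
           \<le> B * ((real k + 1) * M ^ k) * cmod (u r y - u s y) + L * \<bar>r - s\<bar> * (M ^ k * cmod (u s y))"
          using M[OF r] M[OF s] Fb[OF s]
        proof eventually_elim
          case (elim y)
          have "Q r y - Q s y = of_real (c r y) * (F r y - F s y) + of_real (c r y - c s y) * F s y"
            by (simp add: Q_def algebra_simps)
          also have "cmod \<dots> \<le> \<bar>c r y\<bar> * cmod (F r y - F s y) + \<bar>c r y - c s y\<bar> * cmod (F s y)"
            by (rule order_trans[OF norm_triangle_ineq]) (simp add: norm_mult flip: of_real_diff)
          also have "\<dots> \<le> B * ((real k + 1) * M ^ k * cmod (u r y - u s y)) + L * \<bar>r - s\<bar> * (M ^ k * cmod (u s y))"
            using power_nonlinearity_Lipschitz[OF elim(1,2), of k] elim(3) B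
            by (intro add_mono mult_mono cb cl) (auto simp: F_def intro: order_trans[OF abs_ge_zero cl])
          finally show ?case by (simp add: mult.assoc)
        qed
      qed
      also have "\<dots> = B * ((real k + 1) * M ^ k) * (LINT y|lborel. cmod (u r y - u s y)) + L * \<bar>r - s\<bar> * (M ^ k * I)"
        using iu[OF r] iu[OF s] by (simp add: I_def)
      finally show ?thesis .
    qed
    then have "\<forall>\<^sub>F r in at s within {1..}. norm (LINT y|lborel. cmod (Q r y - Q s y))
       \<le> B * ((real k + 1) * M ^ k) * (LINT y|lborel. cmod (u r y - u s y)) + L * \<bar>r - s\<bar> * (M ^ k * I)"
      unfolding eventually_at by (intro exI[of _ 1]) auto
    ultimately show ?thesis by (rule Lim_null_comparison[rotated])
  qed
  then have "L1_path Q" using iQ by (simp add: L1_path_def)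
  moreover have "Q = (\<lambda>s y. of_real (c s y * cmod (u s y) ^ k) * u s y)"
    by (auto simp: Q_def F_def fun_eq_iff)
  ultimately show ?thesis by simp
qed

lemma L1_path_linear_combination:
  assumes M: "L1_path M" and N: "L1_path N"
  shows "L1_path (\<lambda>s y. a * M s y - N s y)"
proof -
  have i: "integrable lborel (M s)" "integrable lborel (N s)" if "s \<ge> 1" for s
    using L1_path_integrable assms that by auto
  have "((\<lambda>r. LINT y|lborel. cmod ((a * M r y - N r y) - (a * M s y - N s y))) \<longlongrightarrow> 0) (at s within {1..})" if s: "s \<ge> 1" for s
  proof -
    have "((\<lambda>r. cmod a * (LINT y|lborel. cmod (M r y - M s y)) + (LINT y|lborel. cmod (N r y - N s y))) \<longlongrightarrow> cmod a * 0 + 0) (at s within {1..})"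
      using M N s by (intro tendsto_intros) (auto simp: L1_path_def)
    then have "((\<lambda>r. cmod a * (LINT y|lborel. cmod (M r y - M s y)) + (LINT y|lborel. cmod (N r y - N s y))) \<longlongrightarrow> 0) (at s within {1..})"
      by simp
    moreover have "norm (LINT y|lborel. cmod ((a * M r y - N r y) - (a * M s y - N s y)))
      \<le> cmod a * (LINT y|lborel. cmod (M r y - M s y)) + (LINT y|lborel. cmod (N r y - N s y))" if r: "r \<ge> 1" for r
    proof -
      have "norm (LINT y|lborel. cmod ((a * M r y - N r y) - (a * M s y - N s y)))
        \<le> (LINT y|lborel. cmod a * cmod (M r y - M s y) + cmod (N r y - N s y))"
      proof (rule norm_integral_le_majorant)
        show "integrable lborel (\<lambda>y. cmod a * cmod (M r y - M s y) + cmod (N r y - N s y))"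
          using i[OF r] i[OF s] by simp
        have "cmod ((a * M r y - N r y) - (a * M s y - N s y)) \<le> cmod a * cmod (M r y - M s y) + cmod (N r y - N s y)" for y
        proof -
          have "(a * M r y - N r y) - (a * M s y - N s y) = a * (M r y - M s y) - (N r y - N s y)"
            by (simp add: algebra_simps)
          then show ?thesis by (metis norm_mult norm_triangle_ineq4)
        qed
        then show "AE y in lborel. norm (cmod ((a * M r y - N r y) - (a * M s y - N s y))) \<le> cmod a * cmod (M r y - M s y) + cmod (N r y - N s y)"
          by simp
      qed
      then show ?thesis using i[OF r] i[OF s] by simp
    qed
    then have "\<forall>\<^sub>F r in at s within {1..}. norm (LINT y|lborel. cmod ((a * M r y - N r y) - (a * M s y - N s y)))
      \<le> cmod a * (LINT y|lborel. cmod (M r y - M s y)) + (LINT y|lborel. cmod (N r y - N s y))"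
      unfolding eventually_at by (intro exI[of _ 1]) auto
    ultimately show ?thesis by (rule Lim_null_comparison[rotated])
  qed
  then show ?thesis using i by (auto simp: L1_path_def)
qed

text \<open>
  The exponent \<open>p > 2\<close> is used for the first moment of the potential; it controls the replacement of \<open>u\<close> by its value on
  the ray \<open>y = - \<gamma> s\<close>.
\<close>

lemma admissible_potential_properties:
  assumes "admissible_potential W"
  shows "continuous_on UNIV W"
    and "\<exists>B. \<forall>x. \<bar>W x\<bar> \<le> B"
    and "\<exists>L. \<forall>x y. \<bar>W x - W y\<bar> \<le> L * \<bar>x - y\<bar>"
    and "integrable lborel W"
    and "integrable lborel (\<lambda>x. \<bar>x\<bar> * \<bar>W x\<bar>)"
proof -
  obtain p K where p: "p > 2" and K: "\<And>j. K j > 0"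
    "\<And>j x. \<bar>(deriv ^^ j) W x\<bar> \<le> K j * japanese x powr (- p - real j)"
    and sm: "\<And>j x. (deriv ^^ j) W differentiable (at x)"
    using assms unfolding admissible_potential_def smooth_def by blast
  have dW: "(W has_real_derivative deriv W x) (at x)" for x
    using sm[of 0 x] by (simp add: DERIV_deriv_iff_real_differentiable)
  then show cont: "continuous_on UNIV W"
    by (auto intro: DERIV_isCont continuous_at_imp_continuous_on)
  then have [measurable]: "W \<in> borel_measurable borel" by (rule borel_measurable_continuous_onI)
  have le1: "japanese x powr (- q) \<le> 1" if "q \<ge> 0" for x q
    using powr_mono2'[of "- q" 1 "japanese x"] japanese_ge_1[of x] that by simp
  have W0: "\<bar>W x\<bar> \<le> K 0 * japanese x powr (- p)" for x using K(2)[of 0 x] by simp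
  also have "\<dots> x \<le> K 0 * 1" for x using K(1)[of 0] p by (intro mult_left_mono le1) auto
  finally have "\<bar>W x\<bar> \<le> K 0" for x by simp
  then show "\<exists>B. \<forall>x. \<bar>W x\<bar> \<le> B" by blast
  have dW1: "\<bar>deriv W x\<bar> \<le> K 1" for x
  proof -
    have "\<bar>deriv W x\<bar> \<le> K 1 * japanese x powr (- (p + 1))" using K(2)[of 1 x] by simp
    also have "\<dots> \<le> K 1 * 1" using K(1)[of 1] p by (intro mult_left_mono le1) auto
    finally show ?thesis by simp
  qed
  have "\<bar>W x - W y\<bar> \<le> K 1 * \<bar>x - y\<bar>" for x y
    using field_differentiable_bound[of UNIV W "deriv W" "K 1" x y] dW dW1
    by (auto intro: DERIV_subset)
  then show "\<exists>L. \<forall>x y. \<bar>W x - W y\<bar> \<le> L * \<bar>x - y\<bar>" by blast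
  have ip: "integrable lborel (\<lambda>x. K 0 * japanese x powr (- p))"
    using japanese_powr_integrable[of p] p by simp
  show "integrable lborel W"
    by (rule Bochner_Integration.integrable_bound[OF ip]) (use W0 in \<open>auto intro!: AE_I2 order_trans[OF _ abs_ge_self]\<close>)
  have ip1: "integrable lborel (\<lambda>x. K 0 * japanese x powr (- (p - 1)))"
    using japanese_powr_integrable[of "p - 1"] p by simp
  have "\<bar>x\<bar> * \<bar>W x\<bar> \<le> K 0 * japanese x powr (- (p - 1))" for x
  proof -
    have "\<bar>x\<bar> * \<bar>W x\<bar> \<le> japanese x * (K 0 * japanese x powr (- p))"
      using japanese_ge_abs[of x] W0[of x] by (intro mult_mono) (auto intro: order_trans[OF abs_ge_zero])
    also have "\<dots> = K 0 * japanese x powr (1 + - p)"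
      unfolding powr_add using japanese_ge_1[of x] by simp
    finally show ?thesis by simp
  qed
  then show "integrable lborel (\<lambda>x. \<bar>x\<bar> * \<bar>W x\<bar>)"
    by (intro Bochner_Integration.integrable_bound[OF ip1]) (auto intro!: AE_I2 order_trans[OF _ abs_ge_self])
qed

definition quintic :: "real \<Rightarrow> (real \<Rightarrow> real) \<Rightarrow> (real \<Rightarrow> real \<Rightarrow> complex) \<Rightarrow> real \<Rightarrow> real \<Rightarrow> complex" where
  "quintic \<gamma> W u s y = of_real (W (y + \<gamma> * s) * cmod (u s y) ^ 4) * u s y"

text \<open>
  What the upper bounds use of the small-data theory: the solution and its dispersive decay, with
  \<open>m = C \<epsilon>\<close>.
\<close>

locale decaying_solution =
  fixes \<beta> \<gamma> m :: real and W :: "real \<Rightarrow> real" and u :: "real \<Rightarrow> real \<Rightarrow> complex"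
  assumes W: "admissible_potential W"
    and sol: "global_solution \<beta> \<gamma> W u"
    and m: "m \<ge> 0"
    and sup_decay: "\<And>t. t \<ge> 1 \<Longrightarrow> AE y in lborel. cmod (u t y) \<le> m * t powr (- 1/2)"
begin

lemma u_path: "L1_path u"
  using sol by (intro Sigma_path_L1_path) (simp add: global_solution_def)

lemma sup_bound:
  assumes s: "s \<ge> 1"
  shows "AE y in lborel. cmod (u s y) \<le> m"
  using sup_decay[OF s]
proof eventually_elim
  case (elim y)
  have "m * s powr (- 1/2) \<le> m * 1"
    using powr_mono2'[of "- 1/2" 1 s] s m by (intro mult_left_mono) auto
  then show ?case using elim by linarith
qed

lemma cubic_path: "L1_path (\<lambda>s. cubic (u s))"
proof -
  have "L1_path (\<lambda>s y. of_real (1 * cmod (u s y) ^ 2) * u s y)"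
    by (rule L1_path_power_nonlinearity[OF u_path sup_bound, of _ 1 0]) auto
  then show ?thesis by (simp add: cubic_def[abs_def])
qed

lemma quintic_path: "L1_path (quintic \<gamma> W u)"
proof -
  obtain B where B: "\<And>x. \<bar>W x\<bar> \<le> B" using admissible_potential_properties(2)[OF W] by blast
  obtain L where L: "\<And>x y. \<bar>W x - W y\<bar> \<le> L * \<bar>x - y\<bar>" using admissible_potential_properties(3)[OF W] by blast
  have [measurable]: "W \<in> borel_measurable borel"
    by (rule borel_measurable_continuous_onI[OF admissible_potential_properties(1)[OF W]])
  have "L1_path (\<lambda>s y. of_real (W (y + \<gamma> * s) * cmod (u s y) ^ 4) * u s y)"
  proof (rule L1_path_power_nonlinearity[OF u_path sup_bound])
    show "\<bar>W (y + \<gamma> * s)\<bar> \<le> B" for s y by (rule B)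
    show "\<bar>W (y + \<gamma> * s) - W (y + \<gamma> * r)\<bar> \<le> (L * \<bar>\<gamma>\<bar>) * \<bar>s - r\<bar>" for s r y
      using L[of "y + \<gamma> * s" "y + \<gamma> * r"] by (simp add: abs_mult mult.assoc flip: right_diff_distrib)
  qed auto
  then show ?thesis by (simp add: quintic_def[abs_def])
qed

lemma quintic_decay:
  assumes s: "s \<ge> 1"
  shows "(LINT y|lborel. cmod (quintic \<gamma> W u s y)) \<le> ((LINT x|lborel. \<bar>W x\<bar>) * m ^ 5) * s powr (- 5/2)"
proof -
  have iW: "integrable lborel (\<lambda>x. \<bar>W x\<bar>)" using admissible_potential_properties(4)[OF W] by simp
  have iWs: "integrable lborel (\<lambda>y. \<bar>W (y + \<gamma> * s)\<bar>)"
    using lborel_integrable_real_affine_iff[of 1 "\<lambda>x. \<bar>W x\<bar>" "\<gamma> * s"] iW by (simp add: add.commute)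
  have "norm (LINT y|lborel. cmod (quintic \<gamma> W u s y)) \<le> (LINT y|lborel. \<bar>W (y + \<gamma> * s)\<bar> * (m * s powr (- 1/2)) ^ 5)"
  proof (rule norm_integral_le_majorant)
    show "integrable lborel (\<lambda>y. \<bar>W (y + \<gamma> * s)\<bar> * (m * s powr (- 1/2)) ^ 5)" using iWs by simp
    show "AE y in lborel. norm (cmod (quintic \<gamma> W u s y)) \<le> \<bar>W (y + \<gamma> * s)\<bar> * (m * s powr (- 1/2)) ^ 5"
      using sup_decay[OF s]
    proof eventually_elim
      case (elim y)
      have "cmod (quintic \<gamma> W u s y) = \<bar>W (y + \<gamma> * s)\<bar> * cmod (u s y) ^ 5"
        by (simp add: quintic_def norm_mult norm_power eval_nat_numeral mult_ac)
      also have "\<dots> \<le> \<bar>W (y + \<gamma> * s)\<bar> * (m * s powr (- 1/2)) ^ 5"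
        using elim by (intro mult_left_mono power_mono) auto
      finally show ?case by simp
    qed
  qed
  also have "\<dots> = (LINT x|lborel. \<bar>W x\<bar>) * (m * s powr (- 1/2)) ^ 5"
    using lborel_integral_real_affine[of 1 "\<lambda>x. \<bar>W x\<bar>" "\<gamma> * s"] by (simp add: add.commute)
  also have "(m * s powr (- 1/2)) ^ 5 = m ^ 5 * s powr (- 5/2)"
    using s by (simp add: power_mult_distrib powr_power)
  finally show ?thesis by (simp add: mult.assoc)
qed

sublocale decaying_L1_path "quintic \<gamma> W u" "(LINT x|lborel. \<bar>W x\<bar>) * m ^ 5"
  by unfold_locales (rule quintic_path, rule quintic_decay)

text \<open>
  Duhamel's formula multiplied by \<open>cis (t \<zeta>\<^sup>2)\<close>: the integral that the renormalization adds cancels the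
  cubic part of the nonlinearity.
\<close>

lemma cubic_profile_eq:
  assumes t: "t \<ge> 1"
  shows "cubic_profile \<beta> u t \<zeta> = cis (\<zeta>\<^sup>2) * fourier (u 1) \<zeta>
     + \<i> * (LINT s:{1..t}|lborel. cis (s * \<zeta>\<^sup>2) * fourier (quintic \<gamma> W u s) \<zeta>)"
proof -
  define N where "N s = nonlinearity \<beta> \<gamma> W s (u s)" for s
  have N: "N s = (\<lambda>y. of_real \<beta> * cubic (u s) y - quintic \<gamma> W u s y)" for s
    by (simp add: N_def nonlinearity_def quintic_def fun_eq_iff)
  have Np: "L1_path N" unfolding N[abs_def] by (rule L1_path_linear_combination[OF cubic_path quintic_path])
  have Nf: "fourier (N s) \<zeta> = of_real \<beta> * fourier (cubic (u s)) \<zeta> - fourier (quintic \<gamma> W u s) \<zeta>" if "s \<ge> 1" for s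
  proof -
    have c: "integrable lborel (\<lambda>y. cis (- (\<zeta> * y)) * f y)" if "integrable lborel f" for f
      by (rule Bochner_Integration.integrable_bound[OF that]) (use that in \<open>auto simp: norm_mult intro!: borel_measurable_times\<close>)
    have 1: "integrable lborel (\<lambda>y. of_real \<beta> * (cis (- (\<zeta> * y)) * cubic (u s) y))"
      using c[OF L1_path_integrable[OF cubic_path that]] by simp
    have 2: "integrable lborel (\<lambda>y. cis (- (\<zeta> * y)) * quintic \<gamma> W u s y)"
      by (rule c[OF L1_path_integrable[OF quintic_path that]])
    have "fourier (N s) \<zeta> = (LINT y|lborel. of_real \<beta> * (cis (- (\<zeta> * y)) * cubic (u s) y) - cis (- (\<zeta> * y)) * quintic \<gamma> W u s y)"
      by (simp add: fourier_def N algebra_simps)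
    also have "\<dots> = of_real \<beta> * fourier (cubic (u s)) \<zeta> - fourier (quintic \<gamma> W u s) \<zeta>"
      unfolding Bochner_Integration.integral_diff[OF 1 2] by (simp add: fourier_def)
    finally show ?thesis .
  qed
  have ci: "set_integrable lborel {1..t} (\<lambda>s. cis (s * \<zeta>\<^sup>2) * fourier (M s) \<zeta>)" if "L1_path M" for M
    by (intro borel_integrable_atLeastAtMost' continuous_intros
          continuous_on_compose2[OF L1_path_fourier_continuous[OF that], of "{1..t}" "\<lambda>s. (s, \<zeta>)", simplified]) auto
  have "fourier (u t) \<zeta> = cis (- ((t - 1) * \<zeta>\<^sup>2)) * fourier (u 1) \<zeta>
      - \<i> * (LINT s:{1..t}|lborel. cis (- ((t - s) * \<zeta>\<^sup>2)) * fourier (N s) \<zeta>)"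
  proof (rule fourier_Duhamel[OF Np _ _ t])
    show "AE y in lborel. u t y = free_group (t - 1) (u 1) y - \<i> * (LINT s:{1..t}|lborel. free_group (t - s) (N s) y)"
      using sol t unfolding global_solution_def mild_solution_def N_def by blast
  qed (use L1_path_integrable[OF u_path] t in auto)
  then have "cis (t * \<zeta>\<^sup>2) * fourier (u t) \<zeta> = cis (t * \<zeta>\<^sup>2) * cis (- ((t - 1) * \<zeta>\<^sup>2)) * fourier (u 1) \<zeta>
      - \<i> * (cis (t * \<zeta>\<^sup>2) * (LINT s:{1..t}|lborel. cis (- ((t - s) * \<zeta>\<^sup>2)) * fourier (N s) \<zeta>))"
    by (simp add: right_diff_distrib mult_ac)
  also have "cis (t * \<zeta>\<^sup>2) * cis (- ((t - 1) * \<zeta>\<^sup>2)) = cis (\<zeta>\<^sup>2)"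
    by (simp add: cis_mult left_diff_distrib)
  also have "cis (t * \<zeta>\<^sup>2) * (LINT s:{1..t}|lborel. cis (- ((t - s) * \<zeta>\<^sup>2)) * fourier (N s) \<zeta>)
     = (LINT s:{1..t}|lborel. cis (t * \<zeta>\<^sup>2) * (cis (- ((t - s) * \<zeta>\<^sup>2)) * fourier (N s) \<zeta>))"
    by simp
  also have "\<dots> = (LINT s:{1..t}|lborel. of_real \<beta> * (cis (s * \<zeta>\<^sup>2) * fourier (cubic (u s)) \<zeta>) - cis (s * \<zeta>\<^sup>2) * fourier (quintic \<gamma> W u s) \<zeta>)"
  proof (rule set_lebesgue_integral_cong)
    show "\<forall>s. s \<in> {1..t} \<longrightarrow> cis (t * \<zeta>\<^sup>2) * (cis (- ((t - s) * \<zeta>\<^sup>2)) * fourier (N s) \<zeta>)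
      = of_real \<beta> * (cis (s * \<zeta>\<^sup>2) * fourier (cubic (u s)) \<zeta>) - cis (s * \<zeta>\<^sup>2) * fourier (quintic \<gamma> W u s) \<zeta>"
    proof (intro allI impI)
      fix s assume "s \<in> {1..t}"
      have "cis (t * \<zeta>\<^sup>2) * cis (- ((t - s) * \<zeta>\<^sup>2)) = cis (s * \<zeta>\<^sup>2)" by (simp add: cis_mult left_diff_distrib)
      then have e: "cis (t * \<zeta>\<^sup>2) * (cis (- ((t - s) * \<zeta>\<^sup>2)) * fourier (N s) \<zeta>) = cis (s * \<zeta>\<^sup>2) * fourier (N s) \<zeta>"
        by (simp only: mult.assoc[symmetric])
      then show "cis (t * \<zeta>\<^sup>2) * (cis (- ((t - s) * \<zeta>\<^sup>2)) * fourier (N s) \<zeta>)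
        = of_real \<beta> * (cis (s * \<zeta>\<^sup>2) * fourier (cubic (u s)) \<zeta>) - cis (s * \<zeta>\<^sup>2) * fourier (quintic \<gamma> W u s) \<zeta>"
        unfolding e using Nf[of s] \<open>s \<in> {1..t}\<close> by (simp add: right_diff_distrib mult.left_commute)
    qed
  qed simp
  also have "\<dots> = of_real \<beta> * (LINT s:{1..t}|lborel. cis (s * \<zeta>\<^sup>2) * fourier (cubic (u s)) \<zeta>)
      - (LINT s:{1..t}|lborel. cis (s * \<zeta>\<^sup>2) * fourier (quintic \<gamma> W u s) \<zeta>)"
    using ci[OF cubic_path] ci[OF quintic_path] by (subst set_integral_diff) auto
  finally show ?thesis by (simp add: cubic_profile_def right_diff_distrib mult_ac)
qed

lemma cubic_profile_limit_eq:
  assumes lim: "cubic_profile_limit \<beta> u P" and T: "T \<ge> 1"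
  shows "P \<zeta> - cubic_profile \<beta> u T \<zeta> = \<i> * oscillatory_tail (quintic \<gamma> W u) T \<zeta>"
proof -
  define q where "q s = cis (s * \<zeta>\<^sup>2) * fourier (quintic \<gamma> W u s) \<zeta>" for s
  have iT: "set_integrable lborel {T<..} q" unfolding q_def[abs_def] by (rule integrand_integrable[OF T])
  have lim1: "((\<lambda>S. cubic_profile \<beta> u S \<zeta>) \<longlongrightarrow> P \<zeta>) at_top"
    using lim by (auto simp: cubic_profile_limit_def intro: tendsto_uniform_limitI)
  have lim2: "((\<lambda>S. cubic_profile \<beta> u T \<zeta> + \<i> * (LINT s:{T<..S}|lborel. q s)) \<longlongrightarrow>
      cubic_profile \<beta> u T \<zeta> + \<i> * oscillatory_tail (quintic \<gamma> W u) T \<zeta>) at_top"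
  proof (intro tendsto_intros)
    have "((\<lambda>S. LINT s|lborel. indicator {T<..S} s *\<^sub>R q s) \<longlongrightarrow> (LINT s|lborel. indicator {T<..} s *\<^sub>R q s)) at_top"
    proof (rule integral_dominated_convergence_at_top)
      show "integrable lborel (\<lambda>s. cmod (indicator {T<..} s *\<^sub>R q s))"
        using iT unfolding set_integrable_def by (rule integrable_norm)
      show "(\<lambda>s. indicator {T<..} s *\<^sub>R q s) \<in> borel_measurable lborel"
        using iT unfolding set_integrable_def by auto
      then show "(\<lambda>s. indicator {T<..S} s *\<^sub>R q s) \<in> borel_measurable lborel" for S
      proof -
        assume [measurable]: "(\<lambda>s. indicator {T<..} s *\<^sub>R q s) \<in> borel_measurable lborel"
        have "(\<lambda>s. indicator {T<..S} s *\<^sub>R (indicator {T<..} s *\<^sub>R q s)) \<in> borel_measurable lborel" by measurable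
        also have "(\<lambda>s. indicator {T<..S} s *\<^sub>R (indicator {T<..} s *\<^sub>R q s)) = (\<lambda>s. indicator {T<..S} s *\<^sub>R q s)"
          by (auto simp: indicator_def)
        finally show ?thesis .
      qed
      show "AE s in lborel. ((\<lambda>S. indicator {T<..S} s *\<^sub>R q s) \<longlongrightarrow> indicator {T<..} s *\<^sub>R q s) at_top"
      proof (rule AE_I2)
        fix s
        have "\<forall>\<^sub>F S in at_top. indicator {T<..S} s *\<^sub>R q s = indicator {T<..} s *\<^sub>R q s"
          using eventually_ge_at_top[of s] by eventually_elim (auto simp: indicator_def)
        then show "((\<lambda>S. indicator {T<..S} s *\<^sub>R q s) \<longlongrightarrow> indicator {T<..} s *\<^sub>R q s) at_top"
          by (rule tendsto_eventually)
      qed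
      show "\<forall>\<^sub>F S in at_top. AE s in lborel. norm (indicator {T<..S} s *\<^sub>R q s) \<le> cmod (indicator {T<..} s *\<^sub>R q s)"
        by (intro always_eventually allI AE_I2) (auto simp: indicator_def)
    qed
    then show "((\<lambda>S. LINT s:{T<..S}|lborel. q s) \<longlongrightarrow> oscillatory_tail (quintic \<gamma> W u) T \<zeta>) at_top"
      by (simp add: oscillatory_tail_def set_lebesgue_integral_def q_def)
  qed
  have ev: "\<forall>\<^sub>F S in at_top. cubic_profile \<beta> u T \<zeta> + \<i> * (LINT s:{T<..S}|lborel. q s) = cubic_profile \<beta> u S \<zeta>"
    using eventually_ge_at_top[of T]
  proof eventually_elim
    case (elim S)
    have i1: "set_integrable lborel {1..S} q"
      unfolding q_def
      by (intro borel_integrable_atLeastAtMost' continuous_intros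
          continuous_on_compose2[OF L1_path_fourier_continuous[OF quintic_path], of "{1..S}" "\<lambda>s. (s, \<zeta>)", simplified]) auto
    have "{1..S} = {1..T} \<union> {T<..S}" using T elim by auto
    then have "(LINT s:{1..S}|lborel. q s) = (LINT s:{1..T}|lborel. q s) + (LINT s:{T<..S}|lborel. q s)"
      using i1 by (auto intro!: set_integral_Un intro: set_integrable_subset)
    then show ?case
      using cubic_profile_eq[OF T] cubic_profile_eq[of S] T elim by (simp add: q_def distrib_left)
  qed
  have "P \<zeta> = cubic_profile \<beta> u T \<zeta> + \<i> * oscillatory_tail (quintic \<gamma> W u) T \<zeta>"
    by (rule tendsto_unique[OF trivial_limit_at_top_linorder lim1 Lim_transform_eventually[OF lim2 ev]])
  then show ?thesis by simp
qed

end

section \<open>Hoelder continuity of the scattering profile\<close>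

lemma cis_diff_le: "cmod (cis a - cis b) \<le> \<bar>a - b\<bar>"
proof -
  have "cis a - cis b = cis b * (cis (a - b) - 1)" by (simp add: right_diff_distrib cis_mult)
  moreover have "cmod (cis (a - b) - 1) \<le> \<bar>a - b\<bar>"
    using iexp_approx1[of "a - b" 0] by (simp add: cis_conv_exp)
  ultimately show ?thesis by (simp add: norm_mult)
qed

lemma cis_diff_Holder:
  assumes "0 < \<theta>" "\<theta> \<le> 1"
  shows "cmod (cis a - cis b) \<le> 2 * \<bar>a - b\<bar> powr \<theta>"
proof (cases "\<bar>a - b\<bar> \<le> 1")
  case True
  have "\<bar>a - b\<bar> \<le> \<bar>a - b\<bar> powr \<theta>"
    using powr_mono'[of \<theta> 1 "\<bar>a - b\<bar>"] True assms by simp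
  then show ?thesis using cis_diff_le[of a b] powr_ge_zero[of "\<bar>a - b\<bar>" \<theta>] by linarith
next
  case False
  have "cmod (cis a - cis b) \<le> 2" using norm_triangle_ineq4[of "cis a" "cis b"] by simp
  moreover have "1 \<le> \<bar>a - b\<bar> powr \<theta>" using False assms by (intro ge_one_powr_ge_zero) auto
  ultimately show ?thesis by linarith
qed

text \<open>
  The Fourier transform of \<open>exp (- \<kappa> \<zeta>\<^sup>2)\<close>, an approximate identity of total mass \<open>2 \<pi>\<close> as \<open>\<kappa> \<rightarrow> 0\<close>.
\<close>

definition Gaussian_kernel :: "real \<Rightarrow> real \<Rightarrow> real" where
  "Gaussian_kernel \<kappa> w = sqrt (pi / \<kappa>) * exp (- w\<^sup>2 / (4 * \<kappa>))"

lemma Gaussian_kernel_nonneg: "\<kappa> > 0 \<Longrightarrow> Gaussian_kernel \<kappa> w \<ge> 0"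
  by (simp add: Gaussian_kernel_def)

lemma Gaussian_kernel_measurable [measurable]: "Gaussian_kernel \<kappa> \<in> borel_measurable borel"
  unfolding Gaussian_kernel_def[abs_def] by measurable

lemma Gaussian_kernel_Fourier:
  assumes "\<kappa> > 0"
  shows "(LINT \<zeta>|lborel. of_real (exp (- \<kappa> * \<zeta>\<^sup>2)) * cis (\<zeta> * w)) = of_real (Gaussian_kernel \<kappa> w)"
  using Fourier_Gaussian_real(2)[OF assms, of w] by (simp add: Gaussian_kernel_def mult.commute)

lemma Gaussian_kernel_integral:
  assumes \<kappa>: "\<kappa> > 0"
  shows "integrable lborel (\<lambda>y. Gaussian_kernel \<kappa> (y - x))"
    and "(LINT y|lborel. Gaussian_kernel \<kappa> (y - x)) = 2 * pi"
proof -
  define a where "a = 1 / (4 * \<kappa>)"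
  have a: "a > 0" using \<kappa> by (simp add: a_def)
  have "complex_of_real (LINT y|lborel. exp (- a * y\<^sup>2)) = (LINT y|lborel. complex_of_real (exp (- a * y\<^sup>2)))"
    by (rule integral_complex_of_real[symmetric])
  also have "\<dots> = of_real (sqrt (pi / a))" using Fourier_Gaussian_real(2)[OF a, of 0] by simp
  finally have v: "(LINT y|lborel. exp (- a * y\<^sup>2)) = sqrt (pi / a)" by (simp only: of_real_eq_iff)
  have K: "Gaussian_kernel \<kappa> y = sqrt (pi / \<kappa>) * exp (- a * y\<^sup>2)" for y
    by (simp add: Gaussian_kernel_def a_def)
  have i: "integrable lborel (Gaussian_kernel \<kappa>)"
    unfolding K[abs_def] using Fourier_Gaussian_real(1)[OF a] by simp
  have "(LINT y|lborel. Gaussian_kernel \<kappa> y) = sqrt (pi / \<kappa>) * sqrt (pi / a)"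
    unfolding K v[symmetric] by simp
  also have "\<dots> = sqrt ((2 * pi)\<^sup>2)"
    using \<kappa> by (simp add: a_def power2_eq_square flip: real_sqrt_mult)
  also have "\<dots> = 2 * pi" unfolding real_sqrt_abs by simp
  finally have I: "(LINT y|lborel. Gaussian_kernel \<kappa> y) = 2 * pi" .
  show "integrable lborel (\<lambda>y. Gaussian_kernel \<kappa> (y - x))"
    using lborel_integrable_real_affine_iff[of 1 "Gaussian_kernel \<kappa>" "- x"] i by simp
  show "(LINT y|lborel. Gaussian_kernel \<kappa> (y - x)) = 2 * pi"
    using lborel_integral_real_affine[of 1 "Gaussian_kernel \<kappa>" "- x"] I by simp
qed

lemma fourier_Gaussian_pairing:
  assumes f: "integrable lborel f" and \<kappa>: "\<kappa> > 0"
  shows "(LINT \<zeta>|lborel. of_real (exp (- \<kappa> * \<zeta>\<^sup>2)) * cis (\<zeta> * x) * fourier f \<zeta>)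
       = (LINT y|lborel. f y * of_real (Gaussian_kernel \<kappa> (y - x)))"
proof -
  define e where "e \<zeta> = of_real (exp (- \<kappa> * \<zeta>\<^sup>2)) * cis (\<zeta> * x)" for \<zeta>
  have ie: "integrable lborel e"
    by (rule Bochner_Integration.integrable_bound[OF Fourier_Gaussian_real(1)[OF \<kappa>]]) (auto simp: e_def[abs_def] norm_mult)
  have kc: "(\<lambda>(\<zeta>, y). cis (- (\<zeta> * y))) \<in> borel_measurable borel"
    unfolding split_beta by (intro borel_measurable_continuous_onI continuous_intros)
  have "(LINT \<zeta>|lborel. e \<zeta> * fourier f \<zeta>) = (LINT \<zeta>|lborel. e \<zeta> * (LINT y|lborel. f y * cis (- (\<zeta> * y))))"
    by (simp add: fourier_def mult.commute)
  also have "\<dots> = (LINT y|lborel. f y * (LINT \<zeta>|lborel. e \<zeta> * cis (- (\<zeta> * y))))"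
    by (rule kernel_exchange[OF ie f kc, of 1]) simp
  also have "(\<lambda>y. LINT \<zeta>|lborel. e \<zeta> * cis (- (\<zeta> * y))) = (\<lambda>y. of_real (Gaussian_kernel \<kappa> (y - x)))"
  proof
    fix y
    have "e \<zeta> * cis (- (\<zeta> * y)) = of_real (exp (- \<kappa> * \<zeta>\<^sup>2)) * cis (\<zeta> * (x - y))" for \<zeta>
      by (simp add: e_def mult.assoc cis_mult right_diff_distrib)
    then show "(LINT \<zeta>|lborel. e \<zeta> * cis (- (\<zeta> * y))) = of_real (Gaussian_kernel \<kappa> (y - x))"
      using Gaussian_kernel_Fourier[OF \<kappa>, of "x - y"] by (simp add: Gaussian_kernel_def power2_commute)
  qed
  finally show ?thesis by (simp add: e_def)
qed

text \<open>
  A qualitative form of Plancherel's theorem: with a Gaussian weight, the square integral of the Fourier transform is a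
  double integral of \<open>f\<close> against the Gaussian kernel, and this is at most \<open>2 \<pi> c \<parallel>f\<parallel>\<^sub>1\<close>. Fatou's lemma removes the
  weight.
\<close>

lemma fourier_bounded_L1_in_L2:
  assumes f: "integrable lborel f" and c: "\<And>y. cmod (f y) \<le> c"
  shows "fourier f \<in> L2"
proof -
  have [measurable]: "f \<in> borel_measurable borel" using f by auto
  define F where "F = (LINT y|lborel. cmod (f y))"
  have F: "F \<ge> 0" by (simp add: F_def)
  have c0: "c \<ge> 0" using c[of 0] norm_ge_zero order_trans by blast
  have ig: "integrable lborel (\<lambda>\<zeta>. exp (- \<kappa> * \<zeta>\<^sup>2) * (cmod (fourier f \<zeta>))\<^sup>2)" if \<kappa>: "\<kappa> > 0" for \<kappa>
  proof (rule Bochner_Integration.integrable_bound)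
    show "integrable lborel (\<lambda>\<zeta>. exp (- \<kappa> * \<zeta>\<^sup>2) * F\<^sup>2)" using Fourier_Gaussian_real(1)[OF \<kappa>] by simp
    show "AE \<zeta> in lborel. norm (exp (- \<kappa> * \<zeta>\<^sup>2) * (cmod (fourier f \<zeta>))\<^sup>2) \<le> norm (exp (- \<kappa> * \<zeta>\<^sup>2) * F\<^sup>2)"
      using fourier_bound[OF f] by (intro AE_I2) (auto simp: F_def abs_mult intro!: mult_left_mono power_mono)
  qed measurable
  have bd: "(LINT \<zeta>|lborel. exp (- \<kappa> * \<zeta>\<^sup>2) * (cmod (fourier f \<zeta>))\<^sup>2) \<le> F * (c * (2 * pi))" if \<kappa>: "\<kappa> > 0" for \<kappa>
  proof -
    define e where "e \<zeta> = complex_of_real (exp (- \<kappa> * \<zeta>\<^sup>2))" for \<zeta>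
    have [measurable]: "e \<in> borel_measurable borel" unfolding e_def[abs_def] by measurable
    have kc: "(\<lambda>(\<zeta>, y). cis (\<zeta> * y)) \<in> borel_measurable borel"
      unfolding split_beta by (intro borel_measurable_continuous_onI continuous_intros)
    have cf: "cnj (fourier f \<zeta>) = (LINT y|lborel. cnj (f y) * cis (\<zeta> * y))" for \<zeta>
      unfolding fourier_def Bochner_Integration.integral_cnj[symmetric]
      by (rule Bochner_Integration.integral_cong[OF refl]) (simp add: cis_cnj mult.commute)
    have ief: "integrable lborel (\<lambda>\<zeta>. e \<zeta> * fourier f \<zeta>)"
    proof (rule Bochner_Integration.integrable_bound)
      show "integrable lborel (\<lambda>\<zeta>. exp (- \<kappa> * \<zeta>\<^sup>2) * F)" using Fourier_Gaussian_real(1)[OF \<kappa>] by simp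
      show "AE \<zeta> in lborel. norm (e \<zeta> * fourier f \<zeta>) \<le> norm (exp (- \<kappa> * \<zeta>\<^sup>2) * F)"
        using fourier_bound[OF f] by (intro AE_I2) (simp add: F_def e_def norm_mult abs_mult)
    qed measurable
    have "complex_of_real (LINT \<zeta>|lborel. exp (- \<kappa> * \<zeta>\<^sup>2) * (cmod (fourier f \<zeta>))\<^sup>2)
        = (LINT \<zeta>|lborel. complex_of_real (exp (- \<kappa> * \<zeta>\<^sup>2) * (cmod (fourier f \<zeta>))\<^sup>2))"
      by (rule integral_complex_of_real[symmetric])
    also have "\<dots> = (LINT \<zeta>|lborel. (e \<zeta> * fourier f \<zeta>) * (LINT y|lborel. cnj (f y) * cis (\<zeta> * y)))"
      unfolding cf[symmetric] by (simp only: of_real_mult complex_norm_square e_def mult_ac)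
    also have "\<dots> = (LINT y|lborel. cnj (f y) * (LINT \<zeta>|lborel. (e \<zeta> * fourier f \<zeta>) * cis (\<zeta> * y)))"
      by (rule kernel_exchange[OF ief _ kc, of _ 1]) (use f in auto)
    also have "\<dots> = (LINT y|lborel. cnj (f y) * (LINT z|lborel. f z * of_real (Gaussian_kernel \<kappa> (z - y))))"
      using fourier_Gaussian_pairing[OF f \<kappa>] by (simp add: e_def mult_ac)
    finally have eq: "complex_of_real (LINT \<zeta>|lborel. exp (- \<kappa> * \<zeta>\<^sup>2) * (cmod (fourier f \<zeta>))\<^sup>2) = \<dots>" .
    have "(LINT \<zeta>|lborel. exp (- \<kappa> * \<zeta>\<^sup>2) * (cmod (fourier f \<zeta>))\<^sup>2)
       \<le> cmod (complex_of_real (LINT \<zeta>|lborel. exp (- \<kappa> * \<zeta>\<^sup>2) * (cmod (fourier f \<zeta>))\<^sup>2))" by simp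
    also have "\<dots> \<le> (LINT y|lborel. cmod (f y) * (c * (2 * pi)))"
      unfolding eq
    proof (rule norm_integral_le_majorant)
      show "integrable lborel (\<lambda>y. cmod (f y) * (c * (2 * pi)))" using f by simp
      have "cmod (LINT z|lborel. f z * of_real (Gaussian_kernel \<kappa> (z - y))) \<le> c * (2 * pi)" for y
      proof -
        have "cmod (LINT z|lborel. f z * of_real (Gaussian_kernel \<kappa> (z - y))) \<le> (LINT z|lborel. c * Gaussian_kernel \<kappa> (z - y))"
        proof (rule norm_integral_le_majorant)
          show "integrable lborel (\<lambda>z. c * Gaussian_kernel \<kappa> (z - y))"
            using Gaussian_kernel_integral(1)[OF \<kappa>] by simp
          show "AE z in lborel. norm (f z * of_real (Gaussian_kernel \<kappa> (z - y))) \<le> c * Gaussian_kernel \<kappa> (z - y)"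
            using c Gaussian_kernel_nonneg[OF \<kappa>] by (intro AE_I2) (simp add: norm_mult mult_right_mono)
        qed
        then show ?thesis using Gaussian_kernel_integral(2)[OF \<kappa>] by simp
      qed
      then show "AE y in lborel. norm (cnj (f y) * (LINT z|lborel. f z * of_real (Gaussian_kernel \<kappa> (z - y)))) \<le> cmod (f y) * (c * (2 * pi))"
        by (intro AE_I2) (simp only: norm_mult complex_mod_cnj, intro mult_left_mono, auto)
    qed
    also have "\<dots> = F * (c * (2 * pi))" by (simp add: F_def)
    finally show ?thesis .
  qed
  define \<kappa> where "\<kappa> n = inverse (real (Suc n))" for n
  have \<kappa>: "\<kappa> n > 0" for n by (simp add: \<kappa>_def)
  have \<kappa>0: "\<kappa> \<longlonglongrightarrow> 0" unfolding \<kappa>_def by (rule LIMSEQ_inverse_real_of_nat)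
  have "(\<integral>\<^sup>+\<zeta>. ennreal ((cmod (fourier f \<zeta>))\<^sup>2) \<partial>lborel)
      = (\<integral>\<^sup>+\<zeta>. liminf (\<lambda>n. ennreal (exp (- \<kappa> n * \<zeta>\<^sup>2) * (cmod (fourier f \<zeta>))\<^sup>2)) \<partial>lborel)"
  proof (rule nn_integral_cong)
    fix \<zeta>
    have "(\<lambda>n. exp (- \<kappa> n * \<zeta>\<^sup>2) * (cmod (fourier f \<zeta>))\<^sup>2) \<longlonglongrightarrow> exp (- 0 * \<zeta>\<^sup>2) * (cmod (fourier f \<zeta>))\<^sup>2"
      by (intro tendsto_intros \<kappa>0)
    then have "(\<lambda>n. ennreal (exp (- \<kappa> n * \<zeta>\<^sup>2) * (cmod (fourier f \<zeta>))\<^sup>2)) \<longlonglongrightarrow> ennreal ((cmod (fourier f \<zeta>))\<^sup>2)"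
      by (intro tendsto_ennrealI) simp
    then show "ennreal ((cmod (fourier f \<zeta>))\<^sup>2) = liminf (\<lambda>n. ennreal (exp (- \<kappa> n * \<zeta>\<^sup>2) * (cmod (fourier f \<zeta>))\<^sup>2))"
      by (intro lim_imp_Liminf[symmetric]) auto
  qed
  also have "\<dots> \<le> liminf (\<lambda>n. \<integral>\<^sup>+\<zeta>. ennreal (exp (- \<kappa> n * \<zeta>\<^sup>2) * (cmod (fourier f \<zeta>))\<^sup>2) \<partial>lborel)"
    by (rule nn_integral_liminf) measurable
  also have "\<dots> \<le> ennreal (F * (c * (2 * pi)))"
  proof (rule Liminf_le)
    show "\<forall>\<^sub>F n in sequentially. (\<integral>\<^sup>+\<zeta>. ennreal (exp (- \<kappa> n * \<zeta>\<^sup>2) * (cmod (fourier f \<zeta>))\<^sup>2) \<partial>lborel) \<le> ennreal (F * (c * (2 * pi)))"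
      using bd[OF \<kappa>] ig[OF \<kappa>] by (intro always_eventually allI) (simp add: nn_integral_eq_integral ennreal_leI)
  qed simp
  finally have "(\<integral>\<^sup>+\<zeta>. ennreal ((cmod (fourier f \<zeta>))\<^sup>2) \<partial>lborel) < \<infinity>"
    by (rule order_le_less_trans) simp
  then have "integrable lborel (\<lambda>\<zeta>. (cmod (fourier f \<zeta>))\<^sup>2)"
    by (intro integrableI_bounded) auto
  then show ?thesis by (simp add: L2_def)
qed

text \<open>
  Both sides are tested with a Gaussian centred at \<open>x\<close>. The truncations in the definition of the Plancherel
  transform are bounded and integrable, so they pair with it by Fubini's theorem and the pairing passes to the limit by Cauchy--Schwarz.
  As the Gaussian sharpens, continuity of \<open>A\<close> gives the value at every point, without exceptional null set.
\<close>

lemma L2_fourier_inversion: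
  assumes FT: "has_L2_fourier A g" and g: "integrable lborel g"
    and cont: "continuous_on UNIV A" and bd: "\<And>x. cmod (A x) \<le> a"
  shows "2 * of_real pi * A x = (LINT \<zeta>|lborel. g \<zeta> * cis (\<zeta> * x))"
proof -
  have gL2: "g \<in> L2" and lim: "((\<lambda>R. L2_norm (\<lambda>\<zeta>. fourier (\<lambda>y. indicator {-R..R} y * A y) \<zeta> - g \<zeta>)) \<longlongrightarrow> 0) at_top"
    using FT by (auto simp: has_L2_fourier_def)
  have [measurable]: "A \<in> borel_measurable borel" "g \<in> borel_measurable borel"
    using borel_measurable_continuous_onI[OF cont] g by auto
  have a0: "a \<ge> 0" using bd[of 0] norm_ge_zero order_trans by blast
  define AR where "AR R y = indicator {-R..R} y * A y" for R y
  have iA: "integrable lborel (AR R)" for R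
  proof (rule Bochner_Integration.integrable_bound)
    show "integrable lborel (\<lambda>y. a * indicator {-R..R} y)"
      by (intro integrable_mult_right integrable_real_indicator) (auto simp: emeasure_lborel_Icc_eq)
    show "AE y in lborel. norm (AR R y) \<le> norm (a * indicator {-R..R} y)"
      using bd a0 by (intro AE_I2) (auto simp: AR_def indicator_def)
  qed (simp add: AR_def[abs_def])
  \<comment> \<open>The norm of a function outside of \<open>L2\<close> is a default value, so membership has to be known before
    the convergence in \<open>FT\<close> says anything.\<close>
  have AL2: "fourier (AR R) \<in> L2" for R
    by (rule fourier_bounded_L1_in_L2[OF iA, of _ a]) (use bd a0 in \<open>auto simp: AR_def indicator_def\<close>)
  have reg: "(LINT \<zeta>|lborel. of_real (exp (- \<kappa> * \<zeta>\<^sup>2)) * cis (\<zeta> * x) * g \<zeta>)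
     = (LINT y|lborel. A y * of_real (Gaussian_kernel \<kappa> (y - x)))" if \<kappa>: "\<kappa> > 0" for \<kappa>
  proof -
    define e where "e \<zeta> = of_real (exp (- \<kappa> * \<zeta>\<^sup>2)) * cis (\<zeta> * x)" for \<zeta>
    have [measurable]: "e \<in> borel_measurable borel" unfolding e_def[abs_def] by measurable
    have ne: "(cmod (e \<zeta>))\<^sup>2 = exp (- (2 * \<kappa>) * \<zeta>\<^sup>2)" for \<zeta>
      by (simp add: e_def norm_mult power2_eq_square flip: exp_add)
    have ie: "integrable lborel (\<lambda>\<zeta>. (cmod (e \<zeta>))\<^sup>2)"
      unfolding ne by (rule Fourier_Gaussian_real(1)) (use \<kappa> in simp)
    have egi: "integrable lborel (\<lambda>\<zeta>. e \<zeta> * h \<zeta>)" if "h \<in> L2" for h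
      by (rule Cauchy_Schwarz_integral(1)[OF _ _ ie]) (use that in \<open>auto simp: L2_def\<close>)
    have "((\<lambda>R. (LINT \<zeta>|lborel. e \<zeta> * fourier (AR R) \<zeta>) - (LINT \<zeta>|lborel. e \<zeta> * g \<zeta>)) \<longlongrightarrow> 0) at_top"
    proof (rule Lim_null_comparison)
      show "((\<lambda>R. L2_norm e * L2_norm (\<lambda>\<zeta>. fourier (AR R) \<zeta> - g \<zeta>)) \<longlongrightarrow> 0) at_top"
        using tendsto_mult_left[OF lim, of "L2_norm e"] by (simp add: AR_def[abs_def])
      have "norm ((LINT \<zeta>|lborel. e \<zeta> * fourier (AR R) \<zeta>) - (LINT \<zeta>|lborel. e \<zeta> * g \<zeta>))
          \<le> L2_norm e * L2_norm (\<lambda>\<zeta>. fourier (AR R) \<zeta> - g \<zeta>)" for R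
      proof -
        have d: "(\<lambda>\<zeta>. fourier (AR R) \<zeta> - g \<zeta>) \<in> L2" by (rule L2_diff[OF AL2 gL2])
        have "(LINT \<zeta>|lborel. e \<zeta> * fourier (AR R) \<zeta>) - (LINT \<zeta>|lborel. e \<zeta> * g \<zeta>)
            = (LINT \<zeta>|lborel. e \<zeta> * (fourier (AR R) \<zeta> - g \<zeta>))"
          using egi[OF AL2] egi[OF gL2] by (simp add: right_diff_distrib)
        also have "cmod \<dots> \<le> (LINT \<zeta>|lborel. cmod (e \<zeta> * (fourier (AR R) \<zeta> - g \<zeta>)))"
          by (rule integral_norm_bound)
        also have "\<dots> \<le> L2_norm e * L2_norm (\<lambda>\<zeta>. fourier (AR R) \<zeta> - g \<zeta>)"
          unfolding L2_norm_def by (rule Cauchy_Schwarz_integral(2)[OF _ _ ie]) (use d in \<open>auto simp: L2_def\<close>)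
        finally show ?thesis .
      qed
      then show "\<forall>\<^sub>F R in at_top. norm ((LINT \<zeta>|lborel. e \<zeta> * fourier (AR R) \<zeta>) - (LINT \<zeta>|lborel. e \<zeta> * g \<zeta>))
          \<le> L2_norm e * L2_norm (\<lambda>\<zeta>. fourier (AR R) \<zeta> - g \<zeta>)" by simp
    qed
    then have l1: "((\<lambda>R. LINT \<zeta>|lborel. e \<zeta> * fourier (AR R) \<zeta>) \<longlongrightarrow> (LINT \<zeta>|lborel. e \<zeta> * g \<zeta>)) at_top"
      by (rule LIM_zero_cancel)
    have l2: "((\<lambda>R. LINT y|lborel. AR R y * of_real (Gaussian_kernel \<kappa> (y - x))) \<longlongrightarrow>
        (LINT y|lborel. A y * of_real (Gaussian_kernel \<kappa> (y - x)))) at_top"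
    proof (rule integral_dominated_convergence_at_top)
      show "integrable lborel (\<lambda>y. a * Gaussian_kernel \<kappa> (y - x))"
        using Gaussian_kernel_integral(1)[OF \<kappa>] by simp
      show "\<forall>\<^sub>F R in at_top. AE y in lborel. norm (AR R y * of_real (Gaussian_kernel \<kappa> (y - x))) \<le> a * Gaussian_kernel \<kappa> (y - x)"
        using bd a0 Gaussian_kernel_nonneg[OF \<kappa>]
        by (intro always_eventually allI AE_I2) (auto simp: AR_def indicator_def norm_mult intro!: mult_right_mono)
      show "AE y in lborel. ((\<lambda>R. AR R y * of_real (Gaussian_kernel \<kappa> (y - x))) \<longlongrightarrow> A y * of_real (Gaussian_kernel \<kappa> (y - x))) at_top"
      proof (rule AE_I2)
        fix y
        have "\<forall>\<^sub>F R in at_top. AR R y * of_real (Gaussian_kernel \<kappa> (y - x)) = A y * of_real (Gaussian_kernel \<kappa> (y - x))"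
          using eventually_ge_at_top[of "\<bar>y\<bar>"] by eventually_elim (auto simp: AR_def indicator_def)
        then show "((\<lambda>R. AR R y * of_real (Gaussian_kernel \<kappa> (y - x))) \<longlongrightarrow> A y * of_real (Gaussian_kernel \<kappa> (y - x))) at_top"
          by (rule tendsto_eventually)
      qed
    qed (simp_all add: AR_def[abs_def])
    have "(LINT \<zeta>|lborel. e \<zeta> * fourier (AR R) \<zeta>) = (LINT y|lborel. AR R y * of_real (Gaussian_kernel \<kappa> (y - x)))" for R
      using fourier_Gaussian_pairing[OF iA \<kappa>, of x R] by (simp add: e_def)
    then show ?thesis
      using tendsto_unique[OF trivial_limit_at_top_linorder l1] l2 by (simp add: e_def)
  qed
  \<comment> \<open>A sequence of squares, so that the substitution \<open>y = x + 2 sqrt \<kappa> w\<close> has a rational scale.\<close>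
  define \<kappa> where "\<kappa> n = (inverse (real (Suc n)))\<^sup>2" for n
  have \<kappa>: "\<kappa> n > 0" for n by (simp add: \<kappa>_def)
  have \<kappa>0: "\<kappa> \<longlonglongrightarrow> 0"
    unfolding \<kappa>_def using tendsto_power[OF LIMSEQ_inverse_real_of_nat, of 2] by simp
  have "(\<lambda>n. LINT \<zeta>|lborel. of_real (exp (- \<kappa> n * \<zeta>\<^sup>2)) * cis (\<zeta> * x) * g \<zeta>)
     \<longlonglongrightarrow> (LINT \<zeta>|lborel. of_real (exp (- 0 * \<zeta>\<^sup>2)) * cis (\<zeta> * x) * g \<zeta>)"
  proof (rule integral_dominated_convergence)
    show "integrable lborel (\<lambda>\<zeta>. cmod (g \<zeta>))" using g by simp
    show "AE \<zeta> in lborel. (\<lambda>n. of_real (exp (- \<kappa> n * \<zeta>\<^sup>2)) * cis (\<zeta> * x) * g \<zeta>) \<longlonglongrightarrow> of_real (exp (- 0 * \<zeta>\<^sup>2)) * cis (\<zeta> * x) * g \<zeta>"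
      by (intro AE_I2 tendsto_intros \<kappa>0)
    show "AE \<zeta> in lborel. norm (of_real (exp (- \<kappa> n * \<zeta>\<^sup>2)) * cis (\<zeta> * x) * g \<zeta>) \<le> cmod (g \<zeta>)" for n
      by (intro AE_I2) (use \<kappa>[of n] in \<open>simp add: norm_mult mult_left_le_one_le\<close>)
  qed measurable
  then have lhs: "(\<lambda>n. LINT \<zeta>|lborel. of_real (exp (- \<kappa> n * \<zeta>\<^sup>2)) * cis (\<zeta> * x) * g \<zeta>)
     \<longlonglongrightarrow> (LINT \<zeta>|lborel. g \<zeta> * cis (\<zeta> * x))"
    by (simp add: mult.commute)
  define r where "r n = 2 * inverse (real (Suc n))" for n
  have r: "r n > 0" for n by (simp add: r_def)
  have r0: "r \<longlonglongrightarrow> 0"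
    unfolding r_def using tendsto_mult_left[OF LIMSEQ_inverse_real_of_nat, of 2] by simp
  have sub: "(LINT y|lborel. A y * of_real (Gaussian_kernel (\<kappa> n) (y - x)))
      = (LINT w|lborel. of_real (2 * sqrt pi * exp (- w\<^sup>2)) * A (x + r n * w))" for n
  proof -
    have K: "r n * Gaussian_kernel (\<kappa> n) (r n * w) = 2 * sqrt pi * exp (- w\<^sup>2)" for w
    proof -
      have "sqrt (pi / \<kappa> n) = sqrt pi * real (Suc n)"
        by (simp add: \<kappa>_def real_sqrt_divide del: of_nat_Suc) (simp add: field_simps)
      moreover have "(r n * w)\<^sup>2 / (4 * \<kappa> n) = w\<^sup>2"
        by (simp add: r_def \<kappa>_def power_mult_distrib del: of_nat_Suc)
      ultimately show ?thesis by (simp add: Gaussian_kernel_def r_def del: of_nat_Suc)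
    qed
    have "(LINT y|lborel. A y * of_real (Gaussian_kernel (\<kappa> n) (y - x)))
       = r n *\<^sub>R (LINT w|lborel. A (x + r n * w) * of_real (Gaussian_kernel (\<kappa> n) (x + r n * w - x)))"
      using lborel_integral_real_affine[of "r n" "\<lambda>y. A y * of_real (Gaussian_kernel (\<kappa> n) (y - x))" x] r[of n] by simp
    also have "\<dots> = (LINT w|lborel. of_real (r n * Gaussian_kernel (\<kappa> n) (r n * w)) * A (x + r n * w))"
      unfolding integral_scaleR_right[symmetric] by (simp add: scaleR_conv_of_real mult_ac)
    finally show ?thesis unfolding K .
  qed
  have ge: "integrable lborel (\<lambda>w::real. exp (- w\<^sup>2))" using Fourier_Gaussian_real(1)[of 1] by simp
  have "(\<lambda>n. LINT w|lborel. of_real (2 * sqrt pi * exp (- w\<^sup>2)) * A (x + r n * w))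
      \<longlonglongrightarrow> (LINT w|lborel. of_real (2 * sqrt pi * exp (- w\<^sup>2)) * A (x + 0 * w))"
  proof (rule integral_dominated_convergence)
    show "integrable lborel (\<lambda>w::real. 2 * sqrt pi * exp (- w\<^sup>2) * a)" using ge by simp
    show "AE w in lborel. (\<lambda>n. of_real (2 * sqrt pi * exp (- w\<^sup>2)) * A (x + r n * w)) \<longlonglongrightarrow> of_real (2 * sqrt pi * exp (- w\<^sup>2)) * A (x + 0 * w)"
    proof (intro AE_I2 tendsto_mult_left)
      fix w
      have "(\<lambda>n. x + r n * w) \<longlonglongrightarrow> x + 0 * w" by (intro tendsto_intros r0)
      then show "(\<lambda>n. A (x + r n * w)) \<longlonglongrightarrow> A (x + 0 * w)"
        by (rule continuous_on_tendsto_compose[OF cont]) auto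
    qed
    show "AE w in lborel. norm (of_real (2 * sqrt pi * exp (- w\<^sup>2)) * A (x + r n * w)) \<le> 2 * sqrt pi * exp (- w\<^sup>2) * a" for n
      using bd by (intro AE_I2) (simp add: norm_mult)
  qed measurable
  also have "(LINT w|lborel. of_real (2 * sqrt pi * exp (- w\<^sup>2)) * A (x + 0 * w)) = 2 * of_real pi * A x"
  proof -
    have "(LINT w|lborel. complex_of_real (exp (- w\<^sup>2))) = of_real (sqrt pi)"
      using Fourier_Gaussian_real(2)[of 1 0] by simp
    moreover have "complex_of_real (sqrt pi) * complex_of_real (sqrt pi) = of_real pi"
      by (simp flip: of_real_mult)
    ultimately show ?thesis by (simp add: mult.assoc)
  qed
  finally have rhs: "(\<lambda>n. LINT y|lborel. A y * of_real (Gaussian_kernel (\<kappa> n) (y - x))) \<longlonglongrightarrow> 2 * of_real pi * A x"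
    by (simp only: sub)
  show ?thesis
    using LIMSEQ_unique[OF rhs] lhs by (simp only: reg[OF \<kappa>])
qed

text \<open>
  By Cauchy--Schwarz, \<open>\<langle>\<zeta>\<rangle>\<^sup>1\<^sup>/\<^sup>4 g\<close> is integrable as soon as \<open>s - 1/4 > 1/2\<close>; then the inversion formula is
  estimated with the Hoelder continuity of the plane waves.
\<close>

lemma Hs_imp_Holder:
  assumes A: "A \<in> Hs s" and s: "s > 3/4"
    and cont: "continuous_on UNIV A" and bd: "\<And>x. cmod (A x) \<le> a"
  shows "\<exists>L\<ge>0. \<forall>x y. cmod (A x - A y) \<le> L * \<bar>x - y\<bar> powr (1/4)"
proof -
  obtain g where FT: "has_L2_fourier A g" and wg: "(\<lambda>\<zeta>. of_real (japanese \<zeta> powr s) * g \<zeta>) \<in> L2"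
    using A by (auto simp: Hs_def)
  have [measurable]: "g \<in> borel_measurable borel" using FT by (auto simp: has_L2_fourier_def L2_def)
  define j where "j \<zeta> = complex_of_real (japanese \<zeta> powr (1/4 - s))" for \<zeta>
  have [measurable]: "j \<in> borel_measurable borel" unfolding j_def[abs_def] by measurable
  have j2: "(cmod (j \<zeta>))\<^sup>2 = japanese \<zeta> powr (- (2 * s - 1/2))" for \<zeta>
    by (simp add: j_def power2_eq_square flip: powr_add)
  have ij: "integrable lborel (\<lambda>\<zeta>. (cmod (j \<zeta>))\<^sup>2)"
    unfolding j2 by (rule japanese_powr_integrable) (use s in simp)
  have "integrable lborel (\<lambda>\<zeta>. of_real (japanese \<zeta> powr s) * g \<zeta> * j \<zeta>)"
    by (rule Cauchy_Schwarz_integral(1)[OF _ _ _ ij]) (use wg in \<open>auto simp: L2_def\<close>)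
  also have "(\<lambda>\<zeta>. of_real (japanese \<zeta> powr s) * g \<zeta> * j \<zeta>) = (\<lambda>\<zeta>. of_real (japanese \<zeta> powr (1/4)) * g \<zeta>)"
  proof
    fix \<zeta>
    have "japanese \<zeta> powr s * japanese \<zeta> powr (1/4 - s) = japanese \<zeta> powr (1/4)" by (simp flip: powr_add)
    then have "complex_of_real (japanese \<zeta> powr s) * of_real (japanese \<zeta> powr (1/4 - s)) = of_real (japanese \<zeta> powr (1/4))"
      by (simp only: of_real_mult[symmetric])
    then show "of_real (japanese \<zeta> powr s) * g \<zeta> * j \<zeta> = of_real (japanese \<zeta> powr (1/4)) * g \<zeta>"
      by (simp only: j_def mult_ac)
  qed
  finally have ig4: "integrable lborel (\<lambda>\<zeta>. of_real (japanese \<zeta> powr (1/4)) * g \<zeta>)" .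
  then have iw: "integrable lborel (\<lambda>\<zeta>. japanese \<zeta> powr (1/4) * cmod (g \<zeta>))"
    using integrable_norm[OF ig4] by (simp add: norm_mult)
  have ig: "integrable lborel g"
  proof (rule Bochner_Integration.integrable_bound[OF iw])
    show "AE \<zeta> in lborel. norm (g \<zeta>) \<le> norm (japanese \<zeta> powr (1/4) * cmod (g \<zeta>))"
    proof (rule AE_I2)
      fix \<zeta>
      have "1 \<le> japanese \<zeta> powr (1/4)" using japanese_ge_1 by (intro ge_one_powr_ge_zero) auto
      then show "norm (g \<zeta>) \<le> norm (japanese \<zeta> powr (1/4) * cmod (g \<zeta>))"
        using mult_right_mono[of 1 "japanese \<zeta> powr (1/4)" "cmod (g \<zeta>)"] by simp
    qed
  qed measurable
  define L where "L = (LINT \<zeta>|lborel. japanese \<zeta> powr (1/4) * cmod (g \<zeta>)) / pi"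
  have "cmod (A x - A y) \<le> L * \<bar>x - y\<bar> powr (1/4)" for x y
  proof -
    have ic: "integrable lborel (\<lambda>\<zeta>. g \<zeta> * cis (\<zeta> * x))" for x
      by (rule Bochner_Integration.integrable_bound[OF ig]) (auto simp: norm_mult)
    have "2 * of_real pi * (A x - A y) = (LINT \<zeta>|lborel. g \<zeta> * cis (\<zeta> * x)) - (LINT \<zeta>|lborel. g \<zeta> * cis (\<zeta> * y))"
      using L2_fourier_inversion[OF FT ig cont bd] by (simp add: right_diff_distrib)
    also have "\<dots> = (LINT \<zeta>|lborel. g \<zeta> * (cis (\<zeta> * x) - cis (\<zeta> * y)))"
      using ic by (simp add: right_diff_distrib)
    also have "cmod \<dots> \<le> (LINT \<zeta>|lborel. (japanese \<zeta> powr (1/4) * cmod (g \<zeta>)) * (2 * \<bar>x - y\<bar> powr (1/4)))"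
    proof (rule norm_integral_le_majorant)
      show "integrable lborel (\<lambda>\<zeta>. (japanese \<zeta> powr (1/4) * cmod (g \<zeta>)) * (2 * \<bar>x - y\<bar> powr (1/4)))"
        using iw by simp
      show "AE \<zeta> in lborel. norm (g \<zeta> * (cis (\<zeta> * x) - cis (\<zeta> * y))) \<le> (japanese \<zeta> powr (1/4) * cmod (g \<zeta>)) * (2 * \<bar>x - y\<bar> powr (1/4))"
      proof (rule AE_I2)
        fix \<zeta>
        have "cmod (cis (\<zeta> * x) - cis (\<zeta> * y)) \<le> 2 * \<bar>\<zeta> * x - \<zeta> * y\<bar> powr (1/4)"
          by (rule cis_diff_Holder) auto
        also have "\<bar>\<zeta> * x - \<zeta> * y\<bar> = \<bar>\<zeta>\<bar> * \<bar>x - y\<bar>" by (simp add: abs_mult flip: right_diff_distrib)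
        also have "(\<bar>\<zeta>\<bar> * \<bar>x - y\<bar>) powr (1/4) = \<bar>\<zeta>\<bar> powr (1/4) * \<bar>x - y\<bar> powr (1/4)" by (rule powr_mult)
        also have "2 * (\<bar>\<zeta>\<bar> powr (1/4) * \<bar>x - y\<bar> powr (1/4)) \<le> 2 * (japanese \<zeta> powr (1/4) * \<bar>x - y\<bar> powr (1/4))"
          using japanese_ge_abs[of \<zeta>] by (intro mult_left_mono mult_right_mono powr_mono2) auto
        finally have "cmod (g \<zeta>) * cmod (cis (\<zeta> * x) - cis (\<zeta> * y)) \<le> cmod (g \<zeta>) * (2 * (japanese \<zeta> powr (1/4) * \<bar>x - y\<bar> powr (1/4)))"
          by (rule mult_left_mono) simp
        then show "norm (g \<zeta> * (cis (\<zeta> * x) - cis (\<zeta> * y))) \<le> (japanese \<zeta> powr (1/4) * cmod (g \<zeta>)) * (2 * \<bar>x - y\<bar> powr (1/4))"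
          by (simp add: norm_mult mult_ac)
      qed
    qed
    also have "\<dots> = 2 * pi * (L * \<bar>x - y\<bar> powr (1/4))" by (simp add: L_def)
    finally show ?thesis by (simp add: norm_mult)
  qed
  moreover have "L \<ge> 0" by (simp add: L_def)
  ultimately show ?thesis by blast
qed

section \<open>Leading order of the tail\<close>

text \<open>
  The antiderivative is explicit because \<open>s\<^sup>-\<^sup>5\<^sup>/\<^sup>2 cis (- \<mu> ln s)\<close> is a power with complex exponent. The value is never \<open>0\<close>: the
  logarithmic phase does not produce cancellation.
\<close>

lemma log_oscillation_integral:
  fixes T \<mu> :: real
  assumes T: "T \<ge> 1"
  shows "(LINT s:{T<..}|lborel. of_real (s powr (- 5/2)) * cis (- (\<mu> * ln s)))
     = of_real (T powr (- 3/2)) * cis (- (\<mu> * ln T)) / Complex (3/2) \<mu>"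
proof -
  define f where "f s = of_real (s powr (- 5/2)) * cis (- (\<mu> * ln s))" for s
  define F where "F s = - (of_real (s powr (- 3/2)) * cis (- (\<mu> * ln s)) / Complex (3/2) \<mu>)" for s
  have nz: "Complex (3/2) \<mu> \<noteq> 0" by (simp add: complex_eq_iff)
  have dF: "(F has_vector_derivative f s) (at s within X)" if "s > 0" for s X
  proof -
    have p: "s powr (- 3/2 - 1) = s powr (- 5/2)" "s powr (- 3/2) * inverse s = s powr (- 5/2)"
      using that powr_add[of s "- 3/2" "- 1"] by (simp_all add: powr_minus)
    have 1: "((\<lambda>s. s powr (- 3/2)) has_real_derivative (- 3/2) * s powr (- 5/2)) (at s within X)"
      using that by (auto intro!: derivative_eq_intros simp: p)
    have 2: "((\<lambda>s. - (\<mu> * ln s)) has_real_derivative - (\<mu> * inverse s)) (at s within X)"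
      using that by (auto intro!: derivative_eq_intros simp: field_simps)
    have 3: "((\<lambda>s. cis (- (\<mu> * ln s))) has_vector_derivative (- (\<mu> * inverse s)) *\<^sub>R (\<i> * cis (- (\<mu> * ln s)))) (at s within X)"
    proof -
      have "(cis has_vector_derivative (\<i> * cis z)) (at z)" for z
        unfolding has_vector_derivative_def by (auto intro!: derivative_eq_intros simp: scaleR_conv_of_real)
      then show ?thesis
        using vector_diff_chain_within[OF 2[unfolded has_real_derivative_iff_has_vector_derivative], of cis "\<i> * cis (- (\<mu> * ln s))"]
        by (auto simp: o_def intro: has_vector_derivative_at_within)
    qed
    have "((\<lambda>s. of_real (s powr (- 3/2)) * cis (- (\<mu> * ln s))) has_vector_derivative
       (of_real (s powr (- 3/2)) * ((- (\<mu> * inverse s)) *\<^sub>R (\<i> * cis (- (\<mu> * ln s)))) + of_real ((- 3/2) * s powr (- 5/2)) * cis (- (\<mu> * ln s)))) (at s within X)"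
      by (intro has_vector_derivative_mult has_vector_derivative_of_real 3)
         (use 1 in \<open>simp add: has_real_derivative_iff_has_vector_derivative\<close>)
    also have "of_real (s powr (- 3/2)) * ((- (\<mu> * inverse s)) *\<^sub>R (\<i> * cis (- (\<mu> * ln s)))) + of_real ((- 3/2) * s powr (- 5/2)) * cis (- (\<mu> * ln s))
        = - Complex (3/2) \<mu> * f s"
    proof -
      have "of_real (s powr (- 3/2)) * ((- (\<mu> * inverse s)) *\<^sub>R (\<i> * cis (- (\<mu> * ln s))))
         = of_real (s powr (- 3/2) * inverse s) * (- (\<i> * of_real \<mu>) * cis (- (\<mu> * ln s)))"
        by (simp add: scaleR_conv_of_real mult_ac)
      also have "\<dots> = - (\<i> * of_real \<mu>) * f s" unfolding p(2) f_def by (simp add: mult_ac)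
      finally show ?thesis by (simp add: f_def Complex_eq algebra_simps)
    qed
    finally have "((\<lambda>s. of_real (s powr (- 3/2)) * cis (- (\<mu> * ln s))) has_vector_derivative - Complex (3/2) \<mu> * f s) (at s within X)" .
    from has_vector_derivative_mult_right[OF this, of "- (1 / Complex (3/2) \<mu>)"] show ?thesis
      using nz by (simp add: F_def[abs_def])
  qed
  have cf: "continuous_on {T..} f"
    unfolding f_def using T by (intro continuous_intros) auto
  have fm: "(\<lambda>s. indicator X s *\<^sub>R f s) \<in> borel_measurable lborel" if "X \<in> sets borel" for X
    using that unfolding f_def by measurable
  have lim1: "((\<lambda>S. LINT s|lborel. indicator {T..S} s *\<^sub>R f s) \<longlongrightarrow> (LINT s|lborel. indicator {T..} s *\<^sub>R f s)) at_top"
  proof (rule integral_dominated_convergence_at_top)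
    show "integrable lborel (\<lambda>s. indicator {T..} s * s powr (- 5/2))"
      using powr_tail_integral[of "- 5/2" T] T by (simp add: has_bochner_integral_iff)
    show "AE s in lborel. ((\<lambda>S. indicator {T..S} s *\<^sub>R f s) \<longlongrightarrow> indicator {T..} s *\<^sub>R f s) at_top"
    proof (rule AE_I2)
      fix s
      have "\<forall>\<^sub>F S in at_top. indicator {T..S} s *\<^sub>R f s = indicator {T..} s *\<^sub>R f s"
        using eventually_ge_at_top[of s] by eventually_elim (auto simp: indicator_def)
      then show "((\<lambda>S. indicator {T..S} s *\<^sub>R f s) \<longlongrightarrow> indicator {T..} s *\<^sub>R f s) at_top" by (rule tendsto_eventually)
    qed
    show "\<forall>\<^sub>F S in at_top. AE s in lborel. norm (indicator {T..S} s *\<^sub>R f s) \<le> indicator {T..} s * s powr (- 5/2)"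
      by (intro always_eventually allI AE_I2) (auto simp: indicator_def f_def norm_mult)
  qed (use fm in simp_all)
  have ev: "\<forall>\<^sub>F S in at_top. (LINT s|lborel. indicator {T..S} s *\<^sub>R f s) = F S - F T"
    using eventually_ge_at_top[of T]
  proof eventually_elim
    case (elim S)
    show ?case
      by (rule integral_FTC_Icc[OF elim]) (use dF T continuous_on_subset[OF cf] in auto)
  qed
  have lim2: "((\<lambda>S. F S - F T) \<longlongrightarrow> 0 - F T) at_top"
  proof (intro tendsto_diff tendsto_const)
    show "(F \<longlongrightarrow> 0) at_top"
    proof (rule Lim_null_comparison)
      have "((\<lambda>S::real. S powr (- 3/2)) \<longlongrightarrow> 0) at_top" by (rule tendsto_neg_powr) (auto intro: filterlim_ident)
      then show "((\<lambda>S. S powr (- 3/2) / cmod (Complex (3/2) \<mu>)) \<longlongrightarrow> 0) at_top"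
        by (rule tendsto_divide_zero)
      show "\<forall>\<^sub>F S in at_top. norm (F S) \<le> S powr (- 3/2) / cmod (Complex (3/2) \<mu>)"
        by (simp add: F_def norm_mult norm_divide)
    qed
  qed
  have "(LINT s|lborel. indicator {T..} s *\<^sub>R f s) = 0 - F T"
    by (rule tendsto_unique[OF trivial_limit_at_top_linorder Lim_transform_eventually[OF lim1 ev] lim2])
  moreover have "(LINT s|lborel. indicator {T<..} s *\<^sub>R f s) = (LINT s|lborel. indicator {T..} s *\<^sub>R f s)"
    by (rule integral_discrete_difference[of "{T}"]) (auto simp: indicator_def)
  ultimately show ?thesis by (simp add: set_lebesgue_integral_def f_def F_def)
qed

text \<open>
  What the lower bounds use in addition. For \<open>\<delta> < 1/16\<close> the rate \<open>3/4 - 2 \<delta>\<close> of modified scattering exceeds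
  \<open>5/8\<close>, and since this is more than \<open>1/2\<close>, the remainder is negligible against the leading term.
\<close>

locale scattering_solution = decaying_solution +
  fixes A :: "real \<Rightarrow> complex" and a c' L :: real
  assumes asymptotics: "\<And>t. t \<ge> 1 \<Longrightarrow> AE y in lborel. cmod (u t y - asymptotic_form \<beta> A t y) \<le> c' * t powr (- 5/8)"
    and c': "c' \<ge> 0"
    and A_bound: "\<And>x. cmod (A x) \<le> a"
    and A_Holder: "\<And>x y. cmod (A x - A y) \<le> L * \<bar>x - y\<bar> powr (1/4)"
    and L: "L \<ge> 0"
begin

abbreviation "A0 \<equiv> A (- \<gamma>)"
abbreviation "M0 \<equiv> (LINT x|lborel. W x)"

text \<open>
  The modified scattering profile with its logarithmic phase correction, without the free factor
  \<open>t\<^sup>-\<^sup>1\<^sup>/\<^sup>2 cis (y\<^sup>2 / (4 t))\<close>.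
\<close>

definition phased :: "real \<Rightarrow> real \<Rightarrow> complex" where
  "phased s x = A x * cis (- \<beta> * (cmod (A x))\<^sup>2 * ln s)"

lemma phased_norm: "cmod (phased s x) = cmod (A x)"
  by (simp add: phased_def norm_mult)

lemma a_nonneg: "a \<ge> 0"
  using A_bound[of 0] norm_ge_zero order_trans by blast

text \<open>
  The phases differ by at most \<open>ln s\<close> times the difference of the squared moduli. The Hoelder bound yields
  \<open>s\<^sup>-\<^sup>1\<^sup>/\<^sup>4\<close> at distance \<open>x / s\<close>, and half of this gain absorbs the logarithm through \<open>ln s \<le> 8 s\<^sup>1\<^sup>/\<^sup>8\<close>.
\<close>

lemma phased_close:
  assumes s: "s \<ge> 1"
  shows "cmod (phased s (x / s - \<gamma>) - phased s (- \<gamma>)) \<le> L * (1 + 16 * a\<^sup>2 * \<bar>\<beta>\<bar>) * (1 + \<bar>x\<bar>) * s powr (- 1/8)"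
proof -
  define z w where "z = A (x / s - \<gamma>)" and "w = A0"
  define h where "h = cmod (z - w)"
  have zw: "cmod z \<le> a" "cmod w \<le> a" by (auto simp: z_def w_def A_bound)
  have ln: "0 \<le> ln s" "ln s \<le> 8 * s powr (1/8)"
    using s ln_powr_bound[of s "1/8"] by auto
  have s8: "s powr (1/8) \<ge> 1" using s by (intro ge_one_powr_ge_zero) auto
  have sq: "\<bar>(cmod z)\<^sup>2 - (cmod w)\<^sup>2\<bar> \<le> 2 * a * h"
  proof -
    have "(cmod z)\<^sup>2 - (cmod w)\<^sup>2 = (cmod z + cmod w) * (cmod z - cmod w)"
      by (simp add: power2_eq_square algebra_simps)
    then have "\<bar>(cmod z)\<^sup>2 - (cmod w)\<^sup>2\<bar> = (cmod z + cmod w) * \<bar>cmod z - cmod w\<bar>" by (simp add: abs_mult)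
    also have "\<dots> \<le> (2 * a) * h" unfolding h_def
      using zw a_nonneg norm_triangle_ineq3[of z w] by (intro mult_mono) auto
    finally show ?thesis by simp
  qed
  have "phased s (x / s - \<gamma>) - phased s (- \<gamma>)
     = (z - w) * cis (- \<beta> * (cmod z)\<^sup>2 * ln s) + w * (cis (- \<beta> * (cmod z)\<^sup>2 * ln s) - cis (- \<beta> * (cmod w)\<^sup>2 * ln s))"
    by (simp add: phased_def z_def w_def algebra_simps)
  also have "cmod \<dots> \<le> h + cmod w * cmod (cis (- \<beta> * (cmod z)\<^sup>2 * ln s) - cis (- \<beta> * (cmod w)\<^sup>2 * ln s))"
    by (rule order_trans[OF norm_triangle_ineq]) (simp add: norm_mult h_def)
  also have "\<dots> \<le> h + a * (\<bar>\<beta>\<bar> * (2 * a * h) * (8 * s powr (1/8)))"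
  proof (intro add_left_mono mult_mono zw a_nonneg)
    have "cmod (cis (- \<beta> * (cmod z)\<^sup>2 * ln s) - cis (- \<beta> * (cmod w)\<^sup>2 * ln s)) \<le> \<bar>- \<beta> * (cmod z)\<^sup>2 * ln s - - \<beta> * (cmod w)\<^sup>2 * ln s\<bar>"
      by (rule cis_diff_le)
    also have "- \<beta> * (cmod z)\<^sup>2 * ln s - - \<beta> * (cmod w)\<^sup>2 * ln s = - \<beta> * ((cmod z)\<^sup>2 - (cmod w)\<^sup>2) * ln s"
      by (simp add: algebra_simps)
    also have "\<bar>- \<beta> * ((cmod z)\<^sup>2 - (cmod w)\<^sup>2) * ln s\<bar> = \<bar>\<beta>\<bar> * \<bar>(cmod z)\<^sup>2 - (cmod w)\<^sup>2\<bar> * ln s"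
      using ln by (simp add: abs_mult)
    also have "\<dots> \<le> \<bar>\<beta>\<bar> * (2 * a * h) * (8 * s powr (1/8))"
      using sq ln a_nonneg by (intro mult_mono mult_left_mono) (auto simp: h_def)
    finally show "cmod (cis (- \<beta> * (cmod z)\<^sup>2 * ln s) - cis (- \<beta> * (cmod w)\<^sup>2 * ln s)) \<le> \<bar>\<beta>\<bar> * (2 * a * h) * (8 * s powr (1/8))" .
  qed auto
  also have "\<dots> \<le> (1 + 16 * a\<^sup>2 * \<bar>\<beta>\<bar>) * (h * s powr (1/8))"
    using mult_left_mono[OF s8, of h] by (simp add: h_def power2_eq_square algebra_simps)
  also have "\<dots> \<le> (1 + 16 * a\<^sup>2 * \<bar>\<beta>\<bar>) * ((L * ((1 + \<bar>x\<bar>) * s powr (- 1/4))) * s powr (1/8))"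
  proof (intro mult_left_mono mult_right_mono)
    have "h \<le> L * \<bar>(x / s - \<gamma>) - (- \<gamma>)\<bar> powr (1/4)" unfolding h_def z_def w_def by (rule A_Holder)
    also have "\<bar>(x / s - \<gamma>) - (- \<gamma>)\<bar> = \<bar>x\<bar> / s" using s by simp
    also have "(\<bar>x\<bar> / s) powr (1/4) = \<bar>x\<bar> powr (1/4) * s powr (- 1/4)"
      using s by (simp add: powr_divide powr_minus_divide)
    also have "\<dots> \<le> (1 + \<bar>x\<bar>) * s powr (- 1/4)"
    proof (rule mult_right_mono)
      have "\<bar>x\<bar> powr (1/4) \<le> (1 + \<bar>x\<bar>) powr (1/4)" by (intro powr_mono2) auto
      also have "\<dots> \<le> (1 + \<bar>x\<bar>) powr 1" by (intro powr_mono) auto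
      finally show "\<bar>x\<bar> powr (1/4) \<le> 1 + \<bar>x\<bar>" by simp
    qed simp
    finally show "h \<le> L * ((1 + \<bar>x\<bar>) * s powr (- 1/4))" using L by (simp add: mult_left_mono)
  qed auto
  also have "\<dots> = L * (1 + 16 * a\<^sup>2 * \<bar>\<beta>\<bar>) * (1 + \<bar>x\<bar>) * (s powr (- 1/4) * s powr (1/8))"
    by (simp only: mult_ac)
  also have "s powr (- 1/4) * s powr (1/8) = s powr (- 1/8)" by (simp flip: powr_add)
  finally show ?thesis .
qed

text \<open>
  The term \<open>x\<^sup>2 / (4 s)\<close> is estimated by its square root, since only the first moment of the potential is at hand.
\<close>

lemma phase_close:
  assumes s: "s \<ge> 1"
  shows "cmod (cis (s * \<eta>\<^sup>2 - \<eta> * x + x\<^sup>2 / (4 * s)) - 1) \<le> (s powr (- 1/8) + s * \<eta>\<^sup>2 + \<bar>\<eta>\<bar>) * (1 + \<bar>x\<bar>)"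
proof -
  have t: "cmod (cis (p + q) - 1) \<le> cmod (cis p - 1) + cmod (cis q - 1)" for p q
  proof -
    have split: "cis (p + q) - 1 = cis q * (cis p - 1) + (cis q - 1)" by (simp add: cis_mult[symmetric] algebra_simps)
    show ?thesis
      unfolding split using norm_triangle_ineq[of "cis q * (cis p - 1)" "cis q - 1"] by (simp only: norm_mult norm_cis mult_1)
  qed
  have "cmod (cis (s * \<eta>\<^sup>2 + - (\<eta> * x)) - 1) \<le> s * \<eta>\<^sup>2 + \<bar>\<eta>\<bar> * \<bar>x\<bar>"
    using t[of "s * \<eta>\<^sup>2" "- (\<eta> * x)"] cis_diff_le[of "s * \<eta>\<^sup>2" 0] cis_diff_le[of "- (\<eta> * x)" 0] s by (simp add: abs_mult)
  moreover have "cmod (cis (x\<^sup>2 / (4 * s)) - 1) \<le> \<bar>x\<bar> * s powr (- 1/8)"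
  proof -
    have "cmod (cis (x\<^sup>2 / (4 * s)) - 1) \<le> 2 * \<bar>x\<^sup>2 / (4 * s)\<bar> powr (1/2)"
      using cis_diff_Holder[of "1/2" "x\<^sup>2 / (4 * s)" 0] by simp
    also have "\<dots> = \<bar>x\<bar> * s powr (- 1/2)"
      using s by (simp add: powr_half_sqrt real_sqrt_divide real_sqrt_mult powr_minus_divide)
    also have "\<dots> \<le> \<bar>x\<bar> * s powr (- 1/8)" using s by (intro mult_left_mono powr_mono) auto
    finally show ?thesis .
  qed
  ultimately have "cmod (cis (s * \<eta>\<^sup>2 + - (\<eta> * x) + x\<^sup>2 / (4 * s)) - 1) \<le> s * \<eta>\<^sup>2 + \<bar>\<eta>\<bar> * \<bar>x\<bar> + \<bar>x\<bar> * s powr (- 1/8)"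
    using t[of "s * \<eta>\<^sup>2 + - (\<eta> * x)" "x\<^sup>2 / (4 * s)"] by linarith
  also have "\<dots> \<le> (s powr (- 1/8) + s * \<eta>\<^sup>2 + \<bar>\<eta>\<bar>) * (1 + \<bar>x\<bar>)"
    using s by (simp add: algebra_simps)
  finally show ?thesis by simp
qed

text \<open>
  With \<open>x = y + \<gamma> s\<close>, the three phases from the profile, the Fourier transform and the free asymptotics
  add up to \<open>s \<eta>\<^sup>2 - \<eta> x + x\<^sup>2 / (4 s)\<close>, which is small when \<open>x\<close> is bounded, \<open>\<eta>\<close> is small and \<open>s\<close> is large. The remaining amplitude
  is compared with its value on the ray \<open>x = 0\<close>.
\<close>

lemma integrand_asymptotics:
  "\<exists>c1\<ge>0. \<forall>s\<ge>1. \<forall>\<eta>.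
     cmod (cis (s * (\<eta> - \<gamma>/2)\<^sup>2) * fourier (quintic \<gamma> W u s) (\<eta> - \<gamma>/2)
       - of_real (s powr (- 5/2)) * (of_real (M0 * cmod A0 ^ 4) * phased s (- \<gamma>)))
     \<le> c1 * (s powr (- 5/2) * (s powr (- 1/8) + s * \<eta>\<^sup>2 + \<bar>\<eta>\<bar>))"
proof -
  define n where "n = max m a"
  have n: "n \<ge> 0" using m by (simp add: n_def)
  define c0 where "c0 = n ^ 5 + 5 * n ^ 4 * (c' + L * (1 + 16 * a\<^sup>2 * \<bar>\<beta>\<bar>))"
  have c0: "c0 \<ge> 0" using n c' L by (simp add: c0_def)
  define J where "J = (LINT x|lborel. \<bar>W x\<bar> * (1 + \<bar>x\<bar>))"
  have iW: "integrable lborel W" by (rule admissible_potential_properties(4)[OF W])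
  have iJ: "integrable lborel (\<lambda>x. \<bar>W x\<bar> * (1 + \<bar>x\<bar>))"
    using iW admissible_potential_properties(5)[OF W] by (simp add: distrib_left mult.commute)
  have J: "J \<ge> 0" by (simp add: J_def)
  have main: "cmod (cis (s * (\<eta> - \<gamma>/2)\<^sup>2) * fourier (quintic \<gamma> W u s) (\<eta> - \<gamma>/2)
       - of_real (s powr (- 5/2)) * (of_real (M0 * cmod A0 ^ 4) * phased s (- \<gamma>)))
     \<le> (c0 * J) * (s powr (- 5/2) * (s powr (- 1/8) + s * \<eta>\<^sup>2 + \<bar>\<eta>\<bar>))" if s: "s \<ge> 1" for s \<eta>
  proof -
    define \<zeta> where "\<zeta> = \<eta> - \<gamma>/2"
    define r where "r = s powr (- 1/8) + s * \<eta>\<^sup>2 + \<bar>\<eta>\<bar>"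
    have r: "r \<ge> 0" using s by (simp add: r_def)
    define X where "X y = y + \<gamma> * s" for y
    define V0 where "V0 = phased s (- \<gamma>)"
    define V where "V y = phased s (X y / s - \<gamma>)" for y
    define v where "v y = of_real (s powr (1/2)) * (cis (- (y\<^sup>2 / (4 * s))) * u s y)" for y
    define E where "E y = s * \<eta>\<^sup>2 - \<eta> * X y + (X y)\<^sup>2 / (4 * s)" for y
    have sh: "s powr (1/2) * s powr (- 1/2) = 1" using s by (simp flip: powr_add)
    have u_v: "u s y = of_real (s powr (- 1/2)) * (cis (y\<^sup>2 / (4 * s)) * v y)" for y
    proof -
      have "of_real (s powr (- 1/2)) * (cis (y\<^sup>2 / (4 * s)) * v y)
         = of_real (s powr (1/2) * s powr (- 1/2)) * ((cis (y\<^sup>2 / (4 * s)) * cis (- (y\<^sup>2 / (4 * s)))) * u s y)"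
        by (simp add: v_def mult_ac)
      then show ?thesis unfolding sh by (simp add: cis_mult)
    qed
    have nu: "cmod (u s y) = s powr (- 1/2) * cmod (v y)" for y
      by (subst u_v) (simp add: norm_mult)
    have s5: "(s powr (- 1/2)) ^ 4 * s powr (- 1/2) = s powr (- 5/2)"
      using s by (simp add: powr_power flip: powr_add)
    have Q: "cis (s * \<zeta>\<^sup>2) * (cis (- (\<zeta> * y)) * quintic \<gamma> W u s y)
        = of_real (s powr (- 5/2)) * (of_real (W (X y)) * (cis (E y) * (of_real (cmod (v y) ^ 4) * v y)))" for y
    proof -
      \<comment> \<open>All terms of order \<open>s\<close> in \<open>\<gamma>\<close> cancel; this is why the window is centred at \<open>- \<gamma>/2\<close>.\<close>
      have ph: "s * \<zeta>\<^sup>2 + - (\<zeta> * y) + y\<^sup>2 / (4 * s) = E y"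
        using s by (simp add: \<zeta>_def E_def X_def field_simps power2_eq_square)
      have "cis (s * \<zeta>\<^sup>2) * (cis (- (\<zeta> * y)) * quintic \<gamma> W u s y)
          = of_real (W (X y) * ((s powr (- 1/2)) ^ 4 * cmod (v y) ^ 4)) * (cis (s * \<zeta>\<^sup>2) * cis (- (\<zeta> * y)) * u s y)"
        by (simp add: quintic_def nu X_def power_mult_distrib mult_ac)
      also have "\<dots> = of_real ((s powr (- 1/2)) ^ 4 * s powr (- 1/2)) * (of_real (W (X y)) *
          ((cis (s * \<zeta>\<^sup>2) * cis (- (\<zeta> * y)) * cis (y\<^sup>2 / (4 * s))) * (of_real (cmod (v y) ^ 4) * v y)))"
        by (subst u_v) (simp add: mult_ac)
      finally show ?thesis unfolding s5 cis_mult ph .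
    qed
    have iQ: "integrable lborel (\<lambda>y. cis (s * \<zeta>\<^sup>2) * (cis (- (\<zeta> * y)) * quintic \<gamma> W u s y))"
      by (rule Bochner_Integration.integrable_bound[OF L1_path_integrable[OF quintic_path s]])
         (use L1_path_integrable[OF quintic_path s] in \<open>auto simp: norm_mult intro!: borel_measurable_times\<close>)
    have iWX: "integrable lborel (\<lambda>y. W (X y))"
      using lborel_integrable_real_affine_iff[of 1 W "\<gamma> * s"] iW by (simp add: X_def add.commute)
    have iJX: "integrable lborel (\<lambda>y. \<bar>W (X y)\<bar> * (1 + \<bar>X y\<bar>))"
      using lborel_integrable_real_affine_iff[of 1 "\<lambda>x. \<bar>W x\<bar> * (1 + \<bar>x\<bar>)" "\<gamma> * s"] iJ by (simp add: X_def add.commute)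
    have JX: "(LINT y|lborel. \<bar>W (X y)\<bar> * (1 + \<bar>X y\<bar>)) = J"
      using lborel_integral_real_affine[of 1 "\<lambda>x. \<bar>W x\<bar> * (1 + \<bar>x\<bar>)" "\<gamma> * s"] by (simp add: X_def J_def add.commute)
    have MX: "M0 = (LINT y|lborel. W (X y))"
      using lborel_integral_real_affine[of 1 W "\<gamma> * s"] by (simp add: X_def add.commute)
    have 1: "cis (s * \<zeta>\<^sup>2) * fourier (quintic \<gamma> W u s) \<zeta> = (LINT y|lborel. cis (s * \<zeta>\<^sup>2) * (cis (- (\<zeta> * y)) * quintic \<gamma> W u s y))"
      by (simp add: fourier_def)
    have "complex_of_real M0 = (LINT y|lborel. complex_of_real (W (X y)))"
      unfolding MX by (rule integral_complex_of_real[symmetric])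
    then have 2: "of_real (s powr (- 5/2)) * (of_real (M0 * cmod A0 ^ 4) * V0)
       = (LINT y|lborel. of_real (s powr (- 5/2)) * (of_real (W (X y)) * (of_real (cmod V0 ^ 4) * V0)))"
      using iWX by (simp add: V0_def phased_norm mult_ac)
    have i2: "integrable lborel (\<lambda>y. of_real (s powr (- 5/2)) * (of_real (W (X y)) * (of_real (cmod V0 ^ 4) * V0)))"
      using iWX by simp
    have diff: "cis (s * \<zeta>\<^sup>2) * fourier (quintic \<gamma> W u s) \<zeta> - of_real (s powr (- 5/2)) * (of_real (M0 * cmod A0 ^ 4) * V0)
      = (LINT y|lborel. cis (s * \<zeta>\<^sup>2) * (cis (- (\<zeta> * y)) * quintic \<gamma> W u s y)
          - of_real (s powr (- 5/2)) * (of_real (W (X y)) * (of_real (cmod V0 ^ 4) * V0)))"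
      unfolding 1 2 using iQ i2 by (rule Bochner_Integration.integral_diff[symmetric])
    have le: "cmod (LINT y|lborel. cis (s * \<zeta>\<^sup>2) * (cis (- (\<zeta> * y)) * quintic \<gamma> W u s y)
          - of_real (s powr (- 5/2)) * (of_real (W (X y)) * (of_real (cmod V0 ^ 4) * V0)))
      \<le> (LINT y|lborel. (s powr (- 5/2) * (c0 * r)) * (\<bar>W (X y)\<bar> * (1 + \<bar>X y\<bar>)))"
    proof (rule norm_integral_le_majorant)
      show "integrable lborel (\<lambda>y. (s powr (- 5/2) * (c0 * r)) * (\<bar>W (X y)\<bar> * (1 + \<bar>X y\<bar>)))" using iJX by simp
      show "AE y in lborel. norm (cis (s * \<zeta>\<^sup>2) * (cis (- (\<zeta> * y)) * quintic \<gamma> W u s y)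
          - of_real (s powr (- 5/2)) * (of_real (W (X y)) * (of_real (cmod V0 ^ 4) * V0)))
        \<le> (s powr (- 5/2) * (c0 * r)) * (\<bar>W (X y)\<bar> * (1 + \<bar>X y\<bar>))"
        using sup_decay[OF s] asymptotics[OF s]
      proof eventually_elim
        case (elim y)
        have vm: "cmod (v y) \<le> n"
        proof -
          have "s powr (- 1/2) * cmod (v y) \<le> s powr (- 1/2) * m" using elim(1) by (simp add: nu mult.commute)
          then have "cmod (v y) \<le> m" using s by simp
          then show ?thesis by (simp add: n_def)
        qed
        have V0m: "cmod V0 \<le> n" using A_bound[of "- \<gamma>"] by (simp add: V0_def phased_norm n_def)
        have "cmod (v y - V y) \<le> c' * s powr (- 1/8)"
        proof -
          have "asymptotic_form \<beta> A s y = of_real (s powr (- 1/2)) * (cis (y\<^sup>2 / (4 * s)) * V y)"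
            using s by (simp add: asymptotic_form_def V_def phased_def X_def add_divide_distrib mult_ac)
          then have "u s y - asymptotic_form \<beta> A s y = of_real (s powr (- 1/2)) * (cis (y\<^sup>2 / (4 * s)) * (v y - V y))"
            by (simp add: u_v[of y] right_diff_distrib)
          then have "s powr (- 1/2) * cmod (v y - V y) \<le> c' * s powr (- 5/8)"
            using elim(2) by (simp add: norm_mult)
          then have "s powr (1/2) * (s powr (- 1/2) * cmod (v y - V y)) \<le> s powr (1/2) * (c' * s powr (- 5/8))"
            by (rule mult_left_mono) simp
          moreover have "s powr (1/2) * (c' * s powr (- 5/8)) = c' * s powr (- 1/8)"
            by (simp add: mult.left_commute flip: powr_add)
          ultimately show ?thesis using sh by (simp only: mult.assoc[symmetric] mult_1)
        qed
        moreover have "cmod (V y - V0) \<le> L * (1 + 16 * a\<^sup>2 * \<bar>\<beta>\<bar>) * (1 + \<bar>X y\<bar>) * s powr (- 1/8)"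
          unfolding V_def V0_def by (rule phased_close[OF s])
        moreover have "c' * s powr (- 1/8) \<le> c' * (1 + \<bar>X y\<bar>) * s powr (- 1/8)"
          using c' by (intro mult_right_mono) (auto simp: algebra_simps)
        ultimately have vV: "cmod (v y - V0) \<le> (c' + L * (1 + 16 * a\<^sup>2 * \<bar>\<beta>\<bar>)) * (1 + \<bar>X y\<bar>) * s powr (- 1/8)"
          using norm_triangle_ineq[of "v y - V y" "V y - V0"] by (simp add: distrib_right)
        define b w where "b = of_real (cmod (v y) ^ 4) * v y" and "w = of_real (cmod V0 ^ 4) * V0"
        have split: "cis (E y) * b - w = (cis (E y) - 1) * b + (b - w)" by (simp add: algebra_simps)
        have "cmod (cis (E y) * b - w) \<le> cmod (cis (E y) - 1) * cmod b + cmod (b - w)"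
          unfolding split norm_mult[symmetric] by (rule norm_triangle_ineq)
        also have "\<dots> \<le> (r * (1 + \<bar>X y\<bar>)) * n ^ 5 + (5 * n ^ 4) * ((c' + L * (1 + 16 * a\<^sup>2 * \<bar>\<beta>\<bar>)) * (1 + \<bar>X y\<bar>) * s powr (- 1/8))"
        proof (rule add_mono)
          have "cmod b \<le> n ^ 5" using power_nonlinearity_bound[OF vm, of 4] by (simp add: b_def)
          then show "cmod (cis (E y) - 1) * cmod b \<le> (r * (1 + \<bar>X y\<bar>)) * n ^ 5"
            unfolding E_def r_def using r[unfolded r_def] by (intro mult_mono phase_close[OF s]) auto
          have "cmod (b - w) \<le> (5 * n ^ 4) * cmod (v y - V0)"
            using power_nonlinearity_Lipschitz[OF vm V0m, of 4] by (simp add: b_def w_def)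
          also have "\<dots> \<le> (5 * n ^ 4) * ((c' + L * (1 + 16 * a\<^sup>2 * \<bar>\<beta>\<bar>)) * (1 + \<bar>X y\<bar>) * s powr (- 1/8))"
            using n by (intro mult_left_mono vV) auto
          finally show "cmod (b - w) \<le> (5 * n ^ 4) * ((c' + L * (1 + 16 * a\<^sup>2 * \<bar>\<beta>\<bar>)) * (1 + \<bar>X y\<bar>) * s powr (- 1/8))" .
        qed
        also have "\<dots> \<le> (r * (1 + \<bar>X y\<bar>)) * n ^ 5 + (5 * n ^ 4) * ((c' + L * (1 + 16 * a\<^sup>2 * \<bar>\<beta>\<bar>)) * (1 + \<bar>X y\<bar>) * r)"
        proof (intro add_left_mono mult_left_mono)
          show "s powr (- 1/8) \<le> r" using s by (simp add: r_def)
        qed (use c' L n in auto)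
        also have "\<dots> = (c0 * r) * (1 + \<bar>X y\<bar>)" by (simp add: c0_def algebra_simps)
        finally have core: "cmod (cis (E y) * b - w) \<le> (c0 * r) * (1 + \<bar>X y\<bar>)" .
        have "cis (s * \<zeta>\<^sup>2) * (cis (- (\<zeta> * y)) * quintic \<gamma> W u s y)
          - of_real (s powr (- 5/2)) * (of_real (W (X y)) * (of_real (cmod V0 ^ 4) * V0))
          = of_real (s powr (- 5/2)) * (of_real (W (X y)) * (cis (E y) * b - w))"
          unfolding Q b_def w_def by (simp add: right_diff_distrib)
        also have "cmod \<dots> = s powr (- 5/2) * (\<bar>W (X y)\<bar> * cmod (cis (E y) * b - w))" by (simp only: norm_mult norm_of_real abs_of_nonneg powr_ge_zero)
        also have "\<dots> \<le> s powr (- 5/2) * (\<bar>W (X y)\<bar> * ((c0 * r) * (1 + \<bar>X y\<bar>)))"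
          by (intro mult_left_mono core) auto
        finally show ?case by (simp only: mult_ac)
      qed
    qed
    have J': "(LINT y|lborel. (s powr (- 5/2) * (c0 * r)) * (\<bar>W (X y)\<bar> * (1 + \<bar>X y\<bar>))) = (s powr (- 5/2) * (c0 * r)) * J"
      by (simp only: Bochner_Integration.integral_mult_right_zero JX)
    have "cmod (cis (s * \<zeta>\<^sup>2) * fourier (quintic \<gamma> W u s) \<zeta> - of_real (s powr (- 5/2)) * (of_real (M0 * cmod A0 ^ 4) * V0))
      \<le> (s powr (- 5/2) * (c0 * r)) * J"
      using le unfolding J' diff .
    then show ?thesis by (simp only: r_def \<zeta>_def V0_def mult_ac)
  qed
  show ?thesis
    by (intro exI[of _ "c0 * J"] conjI allI impI main) (use c0 J in auto)
qed

end

context scattering_solution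
begin

text \<open>
  The previous expansion integrated over \<open>s > T\<close>. Only the term \<open>s \<eta>\<^sup>2\<close> loses a power of \<open>s\<close>, and it still
  integrates to \<open>2 \<eta>\<^sup>2 T\<^sup>-\<^sup>1\<^sup>/\<^sup>2\<close>.
\<close>

lemma oscillatory_tail_asymptotics:
  "\<exists>c1\<ge>0. \<forall>T\<ge>1. \<forall>\<eta>.
     cmod (oscillatory_tail (quintic \<gamma> W u) T (\<eta> - \<gamma>/2)
       - of_real (M0 * cmod A0 ^ 4) * A0 * (of_real (T powr (- 3/2)) * cis (- (\<beta> * (cmod A0)\<^sup>2 * ln T)) / Complex (3/2) (\<beta> * (cmod A0)\<^sup>2)))
     \<le> c1 * T powr (- 3/2) * (T powr (- 1/8) + T * \<eta>\<^sup>2 + \<bar>\<eta>\<bar>)"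
proof -
  obtain c1 where c1: "c1 \<ge> 0" and B: "\<And>s \<eta>. s \<ge> 1 \<Longrightarrow>
     cmod (cis (s * (\<eta> - \<gamma>/2)\<^sup>2) * fourier (quintic \<gamma> W u s) (\<eta> - \<gamma>/2)
       - of_real (s powr (- 5/2)) * (of_real (M0 * cmod A0 ^ 4) * phased s (- \<gamma>)))
     \<le> c1 * (s powr (- 5/2) * (s powr (- 1/8) + s * \<eta>\<^sup>2 + \<bar>\<eta>\<bar>))"
    using integrand_asymptotics by blast
  define \<mu> where "\<mu> = \<beta> * (cmod A0)\<^sup>2"
  have main: "cmod (oscillatory_tail (quintic \<gamma> W u) T (\<eta> - \<gamma>/2)
       - of_real (M0 * cmod A0 ^ 4) * A0 * (of_real (T powr (- 3/2)) * cis (- (\<mu> * ln T)) / Complex (3/2) \<mu>))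
     \<le> (2 * c1) * T powr (- 3/2) * (T powr (- 1/8) + T * \<eta>\<^sup>2 + \<bar>\<eta>\<bar>)" if T: "T \<ge> 1" for T \<eta>
  proof -
    define q where "q s = cis (s * (\<eta> - \<gamma>/2)\<^sup>2) * fourier (quintic \<gamma> W u s) (\<eta> - \<gamma>/2)" for s
    define p where "p s = of_real (s powr (- 5/2)) * cis (- (\<mu> * ln s))" for s
    define N where "N = of_real (M0 * cmod A0 ^ 4) * A0"
    define w5 where "w5 s = indicator {T<..} s * s powr (- 5/2)" for s
    define w3 where "w3 s = indicator {T<..} s * s powr (- 3/2)" for s
    have T0: "T > 0" using T by simp
    have w5: "integrable lborel w5" "(LINT s|lborel. w5 s) = 2/3 * T powr (- 3/2)"
      unfolding w5_def[abs_def] using weight_integral[OF T] by auto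
    have w3: "integrable lborel w3" "(LINT s|lborel. w3 s) = 2 * T powr (- 1/2)"
      unfolding w3_def[abs_def] using powr_tail_integral_open[OF _ T0, of "- 3/2"] by auto
    have iq: "integrable lborel (\<lambda>s. indicator {T<..} s *\<^sub>R q s)"
      using integrand_integrable[OF T] by (simp add: set_integrable_def q_def)
    have pm: "(\<lambda>s. indicator {T<..} s *\<^sub>R p s) \<in> borel_measurable lborel"
      unfolding p_def by measurable
    have ip: "integrable lborel (\<lambda>s. N * (indicator {T<..} s *\<^sub>R p s))"
    proof (rule integrable_mult_right, rule Bochner_Integration.integrable_bound[OF w5(1) pm])
      show "AE s in lborel. norm (indicator {T<..} s *\<^sub>R p s) \<le> norm (w5 s)"
        by (intro AE_I2) (simp add: w5_def p_def norm_mult indicator_def)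
    qed
    have "oscillatory_tail (quintic \<gamma> W u) T (\<eta> - \<gamma>/2)
       - N * (of_real (T powr (- 3/2)) * cis (- (\<mu> * ln T)) / Complex (3/2) \<mu>)
       = (LINT s|lborel. indicator {T<..} s *\<^sub>R q s) - (LINT s|lborel. N * (indicator {T<..} s *\<^sub>R p s))"
      unfolding Bochner_Integration.integral_mult_right_zero
      by (simp only: oscillatory_tail_def q_def p_def log_oscillation_integral[OF T, of \<mu>] flip: set_lebesgue_integral_def)
    also have "\<dots> = (LINT s|lborel. indicator {T<..} s *\<^sub>R q s - N * (indicator {T<..} s *\<^sub>R p s))"
      using iq ip by (rule Bochner_Integration.integral_diff[symmetric])
    also have "cmod \<dots> \<le> (LINT s|lborel. c1 * ((T powr (- 1/8) + \<bar>\<eta>\<bar>) * w5 s + \<eta>\<^sup>2 * w3 s))"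
    proof (rule norm_integral_le_majorant)
      show "integrable lborel (\<lambda>s. c1 * ((T powr (- 1/8) + \<bar>\<eta>\<bar>) * w5 s + \<eta>\<^sup>2 * w3 s))"
        using w5 w3 by simp
      show "AE s in lborel. norm (indicator {T<..} s *\<^sub>R q s - N * (indicator {T<..} s *\<^sub>R p s))
         \<le> c1 * ((T powr (- 1/8) + \<bar>\<eta>\<bar>) * w5 s + \<eta>\<^sup>2 * w3 s)"
      proof (rule AE_I2)
        fix s
        show "norm (indicator {T<..} s *\<^sub>R q s - N * (indicator {T<..} s *\<^sub>R p s))
         \<le> c1 * ((T powr (- 1/8) + \<bar>\<eta>\<bar>) * w5 s + \<eta>\<^sup>2 * w3 s)"
        proof (cases "s > T")
          case True
          then have s: "s \<ge> 1" using T by simp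
          have Np: "of_real (s powr (- 5/2)) * (of_real (M0 * cmod A0 ^ 4) * phased s (- \<gamma>)) = N * p s"
            by (simp add: N_def p_def phased_def \<mu>_def mult_ac)
          have "cmod (q s - N * p s) \<le> c1 * (s powr (- 5/2) * (s powr (- 1/8) + s * \<eta>\<^sup>2 + \<bar>\<eta>\<bar>))"
            using B[OF s, of \<eta>] unfolding Np q_def .
          also have "\<dots> \<le> c1 * (s powr (- 5/2) * (T powr (- 1/8) + s * \<eta>\<^sup>2 + \<bar>\<eta>\<bar>))"
            using c1 True T by (intro mult_left_mono add_right_mono powr_mono2') auto
          also have "\<dots> = c1 * ((T powr (- 1/8) + \<bar>\<eta>\<bar>) * s powr (- 5/2) + \<eta>\<^sup>2 * (s powr (- 5/2) * s powr 1))"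
            using s by (simp add: algebra_simps)
          also have "s powr (- 5/2) * s powr 1 = s powr (- 3/2)" by (simp only: powr_add[symmetric]) simp
          finally show ?thesis using True by (simp add: w5_def w3_def)
        qed (simp add: w5_def w3_def)
      qed
    qed
    also have "\<dots> = c1 * ((T powr (- 1/8) + \<bar>\<eta>\<bar>) * (2/3 * T powr (- 3/2)) + \<eta>\<^sup>2 * (2 * T powr (- 1/2)))"
      using w5 w3 by simp
    also have "T powr (- 1/2) = T powr (- 3/2) * T"
      using T powr_add[of T "- 3/2" 1] by simp
    also have "c1 * ((T powr (- 1/8) + \<bar>\<eta>\<bar>) * (2/3 * T powr (- 3/2)) + \<eta>\<^sup>2 * (2 * (T powr (- 3/2) * T)))
       \<le> c1 * ((T powr (- 1/8) + \<bar>\<eta>\<bar>) * (2 * T powr (- 3/2)) + \<eta>\<^sup>2 * (2 * (T powr (- 3/2) * T)))"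
      using c1 by (intro mult_left_mono add_right_mono mult_right_mono) auto
    also have "\<dots> = (2 * c1) * T powr (- 3/2) * (T powr (- 1/8) + T * \<eta>\<^sup>2 + \<bar>\<eta>\<bar>)"
      by (simp add: algebra_simps)
    finally show ?thesis by (simp only: N_def)
  qed
  show ?thesis
    by (intro exI[of _ "2 * c1"] conjI allI impI main[unfolded \<mu>_def]) (use c1 in auto)
qed

text \<open>
  On the window \<open>T \<eta>\<^sup>2 \<le> c\<^sup>2\<close> the relative error is small once \<open>c\<close> is small and \<open>T\<close> is large, so half of the leading term survives.
\<close>

lemma oscillatory_tail_lower_bound:
  assumes ne: "of_real M0 * A0 \<noteq> 0"
  obtains k c T0 where "k > 0" "c > 0" "T0 \<ge> 1"
    "\<And>T \<zeta>. T \<ge> T0 \<Longrightarrow> \<bar>\<zeta> + \<gamma>/2\<bar> \<le> c * T powr (- 1/2) \<Longrightarrow>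
       k * T powr (- 3/2) \<le> cmod (oscillatory_tail (quintic \<gamma> W u) T \<zeta>)"
proof -
  define \<mu> where "\<mu> = \<beta> * (cmod A0)\<^sup>2"
  obtain c1 where c1: "c1 \<ge> 0" and B: "\<And>T \<eta>. T \<ge> 1 \<Longrightarrow>
     cmod (oscillatory_tail (quintic \<gamma> W u) T (\<eta> - \<gamma>/2)
       - of_real (M0 * cmod A0 ^ 4) * A0 * (of_real (T powr (- 3/2)) * cis (- (\<mu> * ln T)) / Complex (3/2) \<mu>))
     \<le> c1 * T powr (- 3/2) * (T powr (- 1/8) + T * \<eta>\<^sup>2 + \<bar>\<eta>\<bar>)"
    using oscillatory_tail_asymptotics unfolding \<mu>_def by blast
  define k where "k = \<bar>M0\<bar> * cmod A0 ^ 5 / cmod (Complex (3/2) \<mu>)"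
  have "Complex (3/2) \<mu> \<noteq> 0" by (simp add: complex_eq_iff)
  then have k: "k > 0" using ne by (simp add: k_def)
  \<comment> \<open>Each of the three error terms will be at most \<open>d\<close>.\<close>
  define d where "d = k / (8 * (c1 + 1))"
  have d: "d > 0" "c1 * (4 * d) \<le> k / 2" using k c1 by (auto simp: d_def field_simps)
  define c where "c = min 1 d"
  define T0 where "T0 = max 1 (d powr (- 8))"
  have "k / 2 * T powr (- 3/2) \<le> cmod (oscillatory_tail (quintic \<gamma> W u) T \<zeta>)"
    if T: "T \<ge> T0" and \<zeta>: "\<bar>\<zeta> + \<gamma>/2\<bar> \<le> c * T powr (- 1/2)" for T \<zeta>
  proof -
    have T1: "T \<ge> 1" using T by (simp add: T0_def)
    define \<eta> where "\<eta> = \<zeta> + \<gamma>/2"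
    have \<zeta>\<eta>: "\<zeta> = \<eta> - \<gamma>/2" by (simp add: \<eta>_def)
    have c01: "0 \<le> c" "c \<le> 1" "c \<le> d" using d by (auto simp: c_def)
    have \<eta>: "\<bar>\<eta>\<bar> \<le> c * T powr (- 1/2)" using \<zeta> by (simp add: \<eta>_def)
    have T8: "T powr (- 1/8) \<le> d"
    proof -
      have "T powr (- 1/8) \<le> (d powr (- 8)) powr (- 1/8)"
        using T d by (intro powr_mono2') (auto simp: T0_def)
      also have "\<dots> = d" using d by (simp add: powr_powr)
      finally show ?thesis .
    qed
    have "T powr (- 1/2) \<le> 1" using powr_mono2'[of "- 1/2" 1 T] T1 by simp
    then have e1: "\<bar>\<eta>\<bar> \<le> d" using \<eta> c01 mult_left_mono[of "T powr (- 1/2)" 1 c] by linarith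
    have e2: "T * \<eta>\<^sup>2 \<le> d"
    proof -
      have "\<eta>\<^sup>2 \<le> (c * T powr (- 1/2))\<^sup>2" using power_mono[OF \<eta>, of 2] by simp
      also have "\<dots> = c * c * (T powr (- 1/2) * T powr (- 1/2))" by (simp only: power2_eq_square mult_ac)
      also have "T powr (- 1/2) * T powr (- 1/2) = inverse T"
        using T1 by (simp only: powr_add[symmetric]) (simp add: powr_minus)
      finally have "T * \<eta>\<^sup>2 \<le> T * (c * c * inverse T)" using T1 by (intro mult_left_mono) auto
      also have "\<dots> = c * c" using T1 by simp
      also have "\<dots> \<le> d" using c01 mult_mono[of c 1 c d] by simp
      finally show ?thesis .
    qed
    define Mn where "Mn = of_real (M0 * cmod A0 ^ 4) * A0 * (of_real (T powr (- 3/2)) * cis (- (\<mu> * ln T)) / Complex (3/2) \<mu>)"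
    have "cmod Mn = k * T powr (- 3/2)"
      by (simp add: Mn_def k_def norm_mult norm_divide norm_power eval_nat_numeral)
    moreover have "cmod (oscillatory_tail (quintic \<gamma> W u) T \<zeta> - Mn) \<le> k / 2 * T powr (- 3/2)"
    proof -
      have "cmod (oscillatory_tail (quintic \<gamma> W u) T \<zeta> - Mn) \<le> c1 * T powr (- 3/2) * (T powr (- 1/8) + T * \<eta>\<^sup>2 + \<bar>\<eta>\<bar>)"
        using B[OF T1, of \<eta>] unfolding Mn_def \<zeta>\<eta> .
      also have "\<dots> \<le> c1 * T powr (- 3/2) * (4 * d)"
        using T8 e1 e2 d c1 by (intro mult_left_mono) auto
      also have "\<dots> = (c1 * (4 * d)) * T powr (- 3/2)" by simp
      also have "\<dots> \<le> k / 2 * T powr (- 3/2)" using d by (intro mult_right_mono) auto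
      finally show ?thesis .
    qed
    moreover have "cmod Mn \<le> cmod (oscillatory_tail (quintic \<gamma> W u) T \<zeta>) + cmod (oscillatory_tail (quintic \<gamma> W u) T \<zeta> - Mn)"
      using norm_triangle_sub[of Mn "oscillatory_tail (quintic \<gamma> W u) T \<zeta>"] by (simp add: norm_minus_commute)
    ultimately show ?thesis by (simp add: field_simps)
  qed
  moreover have "k / 2 > 0" "c > 0" "T0 \<ge> 1" using k d by (auto simp: c_def T0_def)
  ultimately show thesis using that by blast
qed

end

text \<open>
  The order \<open>7/8\<close> lies below \<open>1 - 2 \<delta>\<close> because \<open>\<delta> < 1/16\<close>, and above the \<open>3/4\<close> that the Hoelder bound requires.
\<close>

lemma scattering_solution_from_threshold:
  assumes W: "admissible_potential W" and thr: "small_data_threshold \<beta> W \<epsilon>\<^sub>0 C\<^sub>\<delta> C"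
    and \<epsilon>: "0 < \<epsilon>" "\<epsilon> \<le> \<epsilon>\<^sub>0" and sol: "global_solution \<beta> \<gamma> W u" and small: "Sigma_norm (u 1) \<le> \<epsilon>"
    and sc: "scattering_profile \<beta> C (C\<^sub>\<delta> * \<bar>\<beta>\<bar> * \<epsilon>\<^sup>2) \<epsilon> u A" and cont: "continuous_on UNIV A"
  obtains a c' L where "scattering_solution \<beta> \<gamma> (C * \<epsilon>) W u A a c' L"
proof -
  define \<delta> where "\<delta> = C\<^sub>\<delta> * \<bar>\<beta>\<bar> * \<epsilon>\<^sup>2"
  have u1: "u 1 \<in> Sigma_space" using sol by (simp add: global_solution_def continuous_in_Sigma_def)
  have C: "C > 0" using thr by (simp add: small_data_threshold_def)
  have thr': "\<delta> < 1/16 \<and> small_data_bounds C \<delta> \<epsilon> u \<and>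
      (\<forall>A. scattering_profile \<beta> C \<delta> \<epsilon> u A \<longrightarrow> (\<forall>s < 1 - 2 * \<delta>. A \<in> Hs s))"
    using thr \<epsilon> u1 small sol unfolding small_data_threshold_def Let_def \<delta>_def by blast
  then have \<delta>: "\<delta> < 1/16" and sdb: "small_data_bounds C \<delta> \<epsilon> u" and "\<forall>s < 1 - 2 * \<delta>. A \<in> Hs s"
    using sc unfolding \<delta>_def by auto
  then have Hs: "A \<in> Hs (7/8)" by simp
  define a where "a = Linf_norm A"
  have ALinf: "A \<in> Linf" using sc by (simp add: scattering_profile_def)
  have Ab: "cmod (A x) \<le> a" for x unfolding a_def by (rule Linf_norm_ge[OF ALinf cont])
  obtain L where L: "L \<ge> 0" "\<And>x y. cmod (A x - A y) \<le> L * \<bar>x - y\<bar> powr (1/4)"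
    using Hs_imp_Holder[OF Hs _ cont Ab] by auto
  have "scattering_solution \<beta> \<gamma> (C * \<epsilon>) W u A a (C * \<epsilon>) L"
  proof unfold_locales
    fix t :: real assume t: "t \<ge> 1"
    have "u t \<in> Linf" "Linf_norm (u t) \<le> C * \<epsilon> * t powr (- 1/2)"
      using sdb t by (auto simp: small_data_bounds_def)
    then show "AE y in lborel. cmod (u t y) \<le> C * \<epsilon> * t powr (- 1/2)"
      using Linf_AE[of "u t"] by (auto elim!: eventually_mono)
    have 1: "(\<lambda>y. u t y - asymptotic_form \<beta> A t y) \<in> Linf"
      and 2: "Linf_norm (\<lambda>y. u t y - asymptotic_form \<beta> A t y) \<le> C * \<epsilon> * t powr (- 3/4 + 2 * \<delta>)"
      using sc t by (auto simp: scattering_profile_def \<delta>_def)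
    have "C * \<epsilon> * t powr (- 3/4 + 2 * \<delta>) \<le> C * \<epsilon> * t powr (- 5/8)"
      using C \<epsilon> t \<delta> by (intro mult_left_mono powr_mono) auto
    then show "AE y in lborel. cmod (u t y - asymptotic_form \<beta> A t y) \<le> C * \<epsilon> * t powr (- 5/8)"
      using Linf_AE[OF 1] 2 by (auto elim!: eventually_mono)
  qed (use W sol Ab L C \<epsilon> in auto)
  then show thesis using that by blast
qed

section \<open>Optimality of the rates\<close>

lemma powr_rate_le:
  fixes c k p a T0 :: real
  assumes c: "c > 0" and le: "\<And>T. T \<ge> T0 \<Longrightarrow> c * T powr (- p) \<le> k * T powr (- a)"
  shows "a \<le> p"
proof (rule ccontr)
  assume "\<not> a \<le> p"
  then have ap: "a - p > 0" by simp
  define R where "R = (\<bar>k\<bar> / c + 1) powr (1 / (a - p))"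
  define T where "T = max (max T0 1) R"
  have T: "T \<ge> T0" "T \<ge> 1" "T \<ge> R" by (auto simp: T_def)
  have "\<bar>k\<bar> / c + 1 = R powr (a - p)" using ap c by (simp add: R_def powr_powr add_nonneg_pos)
  also have "\<dots> \<le> T powr (a - p)" using T ap by (intro powr_mono2) (auto simp: R_def)
  finally have 1: "\<bar>k\<bar> / c + 1 \<le> T powr (a - p)" .
  have "c * T powr (- p) * T powr a \<le> k * T powr (- a) * T powr a"
    using le[OF T(1)] by (rule mult_right_mono) simp
  then have "c * T powr (a - p) \<le> k"
    using T by (simp add: mult.assoc flip: powr_add)
  then have "T powr (a - p) \<le> k / c" using c by (simp add: field_simps)
  also have "\<dots> \<le> \<bar>k\<bar> / c" using c by (intro divide_right_mono) auto
  finally show False using 1 by simp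
qed

text \<open>
  The interval has measure \<open>2 r > 0\<close>, so the pointwise bound on it is visible to the integral and to the essential
  supremum.
\<close>

lemma norm_lower_bounds_from_interval:
  fixes f :: "real \<Rightarrow> complex"
  assumes lb: "\<And>\<zeta>. \<bar>\<zeta> - x\<bar> \<le> r \<Longrightarrow> l \<le> cmod (f \<zeta>)" and r: "r > 0" and l: "l \<ge> 0"
  shows "f \<in> L2 \<Longrightarrow> sqrt (2 * r) * l \<le> L2_norm f"
    and "f \<in> Linf \<Longrightarrow> l \<le> Linf_norm f"
proof -
  assume f: "f \<in> L2"
  have ii: "integrable lborel (\<lambda>\<zeta>. l\<^sup>2 * indicator {x - r..x + r} \<zeta>)"
    by (intro integrable_mult_right integrable_real_indicator) (auto simp: emeasure_lborel_Icc_eq)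
  have "l\<^sup>2 * (2 * r) = (LINT \<zeta>|lborel. l\<^sup>2 * indicator {x - r..x + r} \<zeta>)"
    using r by simp
  also have "\<dots> \<le> (LINT \<zeta>|lborel. (cmod (f \<zeta>))\<^sup>2)"
  proof (rule integral_mono[OF ii])
    show "integrable lborel (\<lambda>\<zeta>. (cmod (f \<zeta>))\<^sup>2)" using f by (simp add: L2_def)
    show "l\<^sup>2 * indicator {x - r..x + r} \<zeta> \<le> (cmod (f \<zeta>))\<^sup>2" for \<zeta>
      using lb[of \<zeta>] l by (cases "\<zeta> \<in> {x - r..x + r}") (auto intro!: power_mono)
  qed
  finally have "sqrt (l\<^sup>2 * (2 * r)) \<le> L2_norm f" unfolding L2_norm_def by (rule real_sqrt_le_mono)
  then show "sqrt (2 * r) * l \<le> L2_norm f" using l by (simp add: real_sqrt_mult mult.commute)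
next
  assume f: "f \<in> Linf"
  show "l \<le> Linf_norm f"
  proof (rule ccontr)
    assume "\<not> l \<le> Linf_norm f"
    have "AE \<zeta> in lborel. \<zeta> \<notin> {x - r..x + r}"
      using Linf_AE[OF f]
    proof eventually_elim
      case (elim \<zeta>)
      show ?case using lb[of \<zeta>] elim \<open>\<not> l \<le> Linf_norm f\<close> by (auto simp: abs_le_iff)
    qed
    then have "{x - r..x + r} \<in> null_sets lborel"
      by (rule AE_iff_null_sets[THEN iffD2, rotated]) simp
    then have "emeasure lborel {x - r..x + r} = 0" by (rule null_setsD1)
    then show False using r by (simp add: emeasure_lborel_Icc_eq)
  qed
qed

theorem corollary4p6:
  fixes \<beta> \<epsilon>\<^sub>0 C\<^sub>\<delta> C :: real and W :: "real \<Rightarrow> real"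
  assumes "admissible_potential W"
    and "small_data_threshold \<beta> W \<epsilon>\<^sub>0 C\<^sub>\<delta> C"
  shows "\<exists>K>0. \<forall>(\<gamma>::real) (\<epsilon>::real) (u :: real \<Rightarrow> real \<Rightarrow> complex)
            (A :: real \<Rightarrow> complex) (P :: real \<Rightarrow> complex).
      0 < \<epsilon> \<longrightarrow> \<epsilon> \<le> \<epsilon>\<^sub>0 \<longrightarrow>
      global_solution \<beta> \<gamma> W u \<longrightarrow> Sigma_norm (u 1) \<le> \<epsilon> \<longrightarrow>
      scattering_profile \<beta> C (C\<^sub>\<delta> * \<bar>\<beta>\<bar> * \<epsilon>\<^sup>2) \<epsilon> u A \<longrightarrow> continuous_on UNIV A \<longrightarrow>
      cubic_profile_limit \<beta> u P \<longrightarrow>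
      (let A0 = A (- \<gamma>);
           M0 = (LINT x|lborel. W x);
           D = (\<lambda>T \<zeta>. P \<zeta> - cubic_profile \<beta> u T \<zeta>)
       in
         (\<forall>T\<ge>1. D T \<in> L2 \<and> D T \<in> Linf \<and>
            L2_norm (D T) \<le> K * \<epsilon> ^ 5 * T powr (- 7/4) \<and>
            Linf_norm (D T) \<le> K * \<epsilon> ^ 5 * T powr (- 3/2)) \<and>
         (of_real M0 * A0 \<noteq> 0 \<longrightarrow>
            (\<exists>c2>0. \<exists>cinf>0. \<exists>Tstar>0. \<forall>T\<ge>Tstar.
               L2_norm (D T) \<ge> c2 * \<bar>M0\<bar> * cmod A0 ^ 5 * T powr (- 7/4) \<and>
               Linf_norm (D T) \<ge> cinf * \<bar>M0\<bar> * cmod A0 ^ 5 * T powr (- 3/2)) \<and>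
            (\<forall>a k. (\<forall>T\<ge>1. L2_norm (D T) \<le> k * \<epsilon> ^ 5 * T powr (- a)) \<longrightarrow> a \<le> 7/4) \<and>
            (\<forall>a k. (\<forall>T\<ge>1. Linf_norm (D T) \<le> k * \<epsilon> ^ 5 * T powr (- a)) \<longrightarrow> a \<le> 3/2)))"
proof -
  have C: "C > 0" using assms(2) by (simp add: small_data_threshold_def)
  define w where "w = (LINT x|lborel. \<bar>W x\<bar>)"
  have w: "w \<ge> 0" by (simp add: w_def)
  define K where "K = 3 * (w * C ^ 5) + 1"
  have K: "K > 0" using w C by (simp add: K_def add_nonneg_pos)
  show ?thesis
  proof (intro exI[of _ K] conjI K allI impI)
    fix \<gamma> \<epsilon> :: real and u :: "real \<Rightarrow> real \<Rightarrow> complex" and A P :: "real \<Rightarrow> complex"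
    assume \<epsilon>: "0 < \<epsilon>" "\<epsilon> \<le> \<epsilon>\<^sub>0" and sol: "global_solution \<beta> \<gamma> W u" and small: "Sigma_norm (u 1) \<le> \<epsilon>"
      and sc: "scattering_profile \<beta> C (C\<^sub>\<delta> * \<bar>\<beta>\<bar> * \<epsilon>\<^sup>2) \<epsilon> u A" and cont: "continuous_on UNIV A"
      and lim: "cubic_profile_limit \<beta> u P"
    obtain a c' L where "scattering_solution \<beta> \<gamma> (C * \<epsilon>) W u A a c' L"
      using scattering_solution_from_threshold[OF assms \<epsilon> sol small sc cont] .
    then interpret scattering_solution \<beta> \<gamma> "C * \<epsilon>" W u A a c' L .
    define D where "D T \<zeta> = P \<zeta> - cubic_profile \<beta> u T \<zeta>" for T \<zeta>
    define G where "G T = oscillatory_tail (quintic \<gamma> W u) T" for T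
    define b where "b = w * (C * \<epsilon>) ^ 5"
    have DG: "cmod (D T \<zeta>) = cmod (G T \<zeta>)" if "T \<ge> 1" for T \<zeta>
      using cubic_profile_limit_eq[OF lim that] by (simp add: D_def G_def norm_mult)
    have DL2: "D T \<in> L2" if "T \<ge> 1" for T
      unfolding D_def[abs_def] using lim that by (intro L2_diff) (auto simp: cubic_profile_limit_def)
    have Gm: "G T \<in> borel_measurable borel" if "T \<ge> 1" for T
      unfolding G_def by (rule oscillatory_tail_Gaussian_L2(1)[OF that, of 1]) simp
    have GL2: "G T \<in> L2" if "T \<ge> 1" for T
      using DL2[OF that] Gm[OF that] by (simp add: L2_def DG[OF that])
    have b: "3 * b \<le> K * \<epsilon> ^ 5" "2/3 * b \<le> K * \<epsilon> ^ 5"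
    proof -
      have "b = w * C ^ 5 * \<epsilon> ^ 5" by (simp add: b_def power_mult_distrib)
      moreover have "0 \<le> w * C ^ 5 * \<epsilon> ^ 5" "0 \<le> \<epsilon> ^ 5" using w C \<epsilon> by auto
      ultimately show "3 * b \<le> K * \<epsilon> ^ 5" "2/3 * b \<le> K * \<epsilon> ^ 5" by (auto simp: K_def algebra_simps)
    qed
    have up2: "L2_norm (D T) \<le> K * \<epsilon> ^ 5 * T powr (- 7/4)" if "T \<ge> 1" for T
    proof -
      have "L2_norm (D T) = L2_norm (G T)" by (simp add: L2_norm_def DG[OF that])
      also have "\<dots> \<le> 3 * b * T powr (- 7/4)"
        using oscillatory_tail_L2[OF that] GL2[OF that] by (simp add: G_def b_def w_def)
      also have "\<dots> \<le> K * \<epsilon> ^ 5 * T powr (- 7/4)" using b by (intro mult_right_mono) auto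
      finally show ?thesis .
    qed
    have upinf: "D T \<in> Linf \<and> Linf_norm (D T) \<le> K * \<epsilon> ^ 5 * T powr (- 3/2)" if "T \<ge> 1" for T
    proof -
      have "cmod (D T \<zeta>) \<le> K * \<epsilon> ^ 5 * T powr (- 3/2)" for \<zeta>
      proof -
        have "cmod (D T \<zeta>) \<le> 2/3 * b * T powr (- 3/2)"
          using oscillatory_tail_bound[OF that, of \<zeta>] DG[OF that, of \<zeta>] by (simp add: G_def b_def w_def)
        also have "\<dots> \<le> K * \<epsilon> ^ 5 * T powr (- 3/2)" using b by (intro mult_right_mono) auto
        finally show ?thesis .
      qed
      then show ?thesis using Linf_norm_le L2_measurable[OF DL2[OF that]] by blast
    qed
    have upper: "\<forall>T\<ge>1. D T \<in> L2 \<and> D T \<in> Linf \<and>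
            L2_norm (D T) \<le> K * \<epsilon> ^ 5 * T powr (- 7/4) \<and>
            Linf_norm (D T) \<le> K * \<epsilon> ^ 5 * T powr (- 3/2)"
      using DL2 up2 upinf by blast
    have lower: "(\<exists>c2>0. \<exists>cinf>0. \<exists>Tstar>0. \<forall>T\<ge>Tstar.
               L2_norm (D T) \<ge> c2 * \<bar>M0\<bar> * cmod A0 ^ 5 * T powr (- 7/4) \<and>
               Linf_norm (D T) \<ge> cinf * \<bar>M0\<bar> * cmod A0 ^ 5 * T powr (- 3/2)) \<and>
            (\<forall>a k. (\<forall>T\<ge>1. L2_norm (D T) \<le> k * \<epsilon> ^ 5 * T powr (- a)) \<longrightarrow> a \<le> 7/4) \<and>
            (\<forall>a k. (\<forall>T\<ge>1. Linf_norm (D T) \<le> k * \<epsilon> ^ 5 * T powr (- a)) \<longrightarrow> a \<le> 3/2)"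
      if ne: "of_real M0 * A0 \<noteq> 0"
    proof -
      obtain k c T0 where k: "k > 0" "c > 0" "T0 \<ge> 1" and lb: "\<And>T \<zeta>. T \<ge> T0 \<Longrightarrow> \<bar>\<zeta> + \<gamma>/2\<bar> \<le> c * T powr (- 1/2) \<Longrightarrow>
         k * T powr (- 3/2) \<le> cmod (oscillatory_tail (quintic \<gamma> W u) T \<zeta>)"
        using oscillatory_tail_lower_bound[OF ne] by blast
      define N where "N = \<bar>M0\<bar> * cmod A0 ^ 5"
      have N: "N > 0" using ne by (simp add: N_def)
      have inf: "k * T powr (- 3/2) \<le> Linf_norm (D T)" and two: "sqrt (2 * c) * k * T powr (- 7/4) \<le> L2_norm (D T)"
        if T: "T \<ge> T0" for T
      proof -
        have T1: "T \<ge> 1" using T k by simp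
        define r where "r = c * T powr (- 1/2)"
        have r: "r > 0" using k T1 by (simp add: r_def)
        have lbD: "k * T powr (- 3/2) \<le> cmod (D T \<zeta>)" if "\<bar>\<zeta> - (- \<gamma>/2)\<bar> \<le> r" for \<zeta>
          using lb[OF T, of \<zeta>] that by (simp add: DG[OF T1] G_def r_def)
        have nn: "0 \<le> k * T powr (- 3/2)" using k by simp
        show "k * T powr (- 3/2) \<le> Linf_norm (D T)"
          using norm_lower_bounds_from_interval(2)[of "- \<gamma>/2" r "k * T powr (- 3/2)" "D T", OF lbD r nn] upinf[OF T1] by simp
        have "sqrt (2 * r) = sqrt (2 * c) * T powr (- 1/4)"
        proof -
          have "sqrt (T powr (- 1/2)) = T powr (- 1/4)"
            by (simp add: powr_powr flip: powr_half_sqrt)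
          then show ?thesis by (simp add: r_def real_sqrt_mult)
        qed
        then have "sqrt (2 * r) * (k * T powr (- 3/2)) = sqrt (2 * c) * k * (T powr (- 1/4) * T powr (- 3/2))"
          by (simp only: mult_ac)
        also have "T powr (- 1/4) * T powr (- 3/2) = T powr (- 7/4)" by (simp flip: powr_add)
        finally show "sqrt (2 * c) * k * T powr (- 7/4) \<le> L2_norm (D T)"
          using norm_lower_bounds_from_interval(1)[of "- \<gamma>/2" r "k * T powr (- 3/2)" "D T", OF lbD r nn DL2[OF T1]] by (simp only:)
      qed
      have c2: "sqrt (2 * c) * k > 0" using k by simp
      have "\<exists>c2>0. \<exists>cinf>0. \<exists>Tstar>0. \<forall>T\<ge>Tstar.
               L2_norm (D T) \<ge> c2 * \<bar>M0\<bar> * cmod A0 ^ 5 * T powr (- 7/4) \<and>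
               Linf_norm (D T) \<ge> cinf * \<bar>M0\<bar> * cmod A0 ^ 5 * T powr (- 3/2)"
      proof (intro exI conjI allI impI)
        show "sqrt (2 * c) * k / N > 0" "k / N > 0" "T0 > 0" using c2 k N by auto
        have cN: "z / N * \<bar>M0\<bar> * cmod A0 ^ 5 = z" for z
        proof -
          have "z / N * \<bar>M0\<bar> * cmod A0 ^ 5 = z / N * N" by (simp only: N_def mult.assoc)
          then show ?thesis using N by simp
        qed
        fix T assume "T \<ge> T0"
        then show "L2_norm (D T) \<ge> sqrt (2 * c) * k / N * \<bar>M0\<bar> * cmod A0 ^ 5 * T powr (- 7/4)"
          "Linf_norm (D T) \<ge> k / N * \<bar>M0\<bar> * cmod A0 ^ 5 * T powr (- 3/2)"
          unfolding cN using inf two by auto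
      qed
      moreover have "e \<le> 7/4" if up: "\<forall>T\<ge>1. L2_norm (D T) \<le> h * \<epsilon> ^ 5 * T powr (- e)" for e h
      proof (rule powr_rate_le[OF c2])
        fix T assume "T \<ge> T0"
        then show "sqrt (2 * c) * k * T powr (- (7/4)) \<le> h * \<epsilon> ^ 5 * T powr (- e)"
          using two[of T] up k(3) by (simp add: order_trans)
      qed
      moreover have "e \<le> 3/2" if up: "\<forall>T\<ge>1. Linf_norm (D T) \<le> h * \<epsilon> ^ 5 * T powr (- e)" for e h
      proof (rule powr_rate_le[OF k(1)])
        fix T assume "T \<ge> T0"
        then show "k * T powr (- (3/2)) \<le> h * \<epsilon> ^ 5 * T powr (- e)"
          using inf[of T] up k(3) by (simp add: order_trans)
      qed
      ultimately show ?thesis by blast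
    qed
    have D: "(\<lambda>T \<zeta>. P \<zeta> - cubic_profile \<beta> u T \<zeta>) = D" by (simp add: D_def fun_eq_iff)
    show "let A0 = A (- \<gamma>);
           M0 = (LINT x|lborel. W x);
           D = (\<lambda>T \<zeta>. P \<zeta> - cubic_profile \<beta> u T \<zeta>)
       in
         (\<forall>T\<ge>1. D T \<in> L2 \<and> D T \<in> Linf \<and>
            L2_norm (D T) \<le> K * \<epsilon> ^ 5 * T powr (- 7/4) \<and>
            Linf_norm (D T) \<le> K * \<epsilon> ^ 5 * T powr (- 3/2)) \<and>
         (of_real M0 * A0 \<noteq> 0 \<longrightarrow>
            (\<exists>c2>0. \<exists>cinf>0. \<exists>Tstar>0. \<forall>T\<ge>Tstar.
               L2_norm (D T) \<ge> c2 * \<bar>M0\<bar> * cmod A0 ^ 5 * T powr (- 7/4) \<and>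
               Linf_norm (D T) \<ge> cinf * \<bar>M0\<bar> * cmod A0 ^ 5 * T powr (- 3/2)) \<and>
            (\<forall>a k. (\<forall>T\<ge>1. L2_norm (D T) \<le> k * \<epsilon> ^ 5 * T powr (- a)) \<longrightarrow> a \<le> 7/4) \<and>
            (\<forall>a k. (\<forall>T\<ge>1. Linf_norm (D T) \<le> k * \<epsilon> ^ 5 * T powr (- a)) \<longrightarrow> a \<le> 3/2))"
      unfolding D Let_def by (rule conjI[OF upper impI[OF lower]])
  qed
qed

end
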